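(* Let $\gamma$ be a $C^2$-regular anti-convex curve in the real projective plane $P^2$ which is not a line. Then $\gamma$ has at least three inflection points with the property that the tangent lines at these inflection points cross $\gamma$ only once.
   Context: A simple closed curve $\gamma$ in $P^2$ ($C^1$-regular) is anti-convex if for each point $p$ on $\gamma$ there is a projective line which is transversal to $\gamma$ and meets $\gamma$ only at $p$. An inflection point of a $C^2$-regular curve is a point at which the tangent line has contact of order higher than first order with the curve; equivalently, writing $\gamma(t)=[F(t)]$ with $F$ a local $C^2$ lift to $\mathbb R^3\setminus\{0\}$, $\det(F,F',F'')=0$ at that point. Crossing: let $\gamma_1,\gamma_2$ be two arcs in an affine plane (the complement of a line in $P^2$). $\gamma_1$ crosses $\gamma_2$ in a closed arc $\alpha$ (possibly a single point) if $\alpha$ is a maximal common arc of $\gamma_1$ and $\gamma_2$ and there is an open subarc $\tilde\alpha$ of $\gamma_1$ containing $\alpha$ such that the two components of $\tilde\alpha\setminus\alpha$ do not lie on the same side of $\gamma_2$ (they need not be disjoint from $\gamma_2$), i.e. one lies in one closed side of $\gamma_2$ and the other in the opposite closed side. For closed curves and lines the notion is applied locally. A line crosses $\gamma$ only once if there is exactly one such arc $\alpha$ in which it crosses $\gamma$. *)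

theory Defs
  imports "HOL-Analysis.Analysis"
begin

text \<open>
  The real projective plane is modelled inside \<open>real^3\<close>: points are the one-dimensional and lines
  the two-dimensional linear subspaces, and a point lies on a line iff it is a subset of it.
  The point with homogeneous coordinates \<open>v \<noteq> 0\<close> is \<open>span {v}\<close>.
\<close>

definition proj_point :: "(real^3) set \<Rightarrow> bool" where
  "proj_point p \<longleftrightarrow> subspace p \<and> dim p = 1"

definition proj_line :: "(real^3) set \<Rightarrow> bool" where
  "proj_line L \<longleftrightarrow> subspace L \<and> dim L = 2"

definition is_whole_line :: "(real \<Rightarrow> (real^3) set) \<Rightarrow> bool" where
  "is_whole_line \<gamma> \<longleftrightarrow> (\<exists>L. proj_line L \<and> range \<gamma> = {p. proj_point p \<and> p \<subseteq> L})"

abbreviation vderiv :: "(real \<Rightarrow> real^3) \<Rightarrow> real \<Rightarrow> real^3" where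
  "vderiv F \<equiv> \<lambda>t. vector_derivative F (at t)"

definition C1_lift :: "(real \<Rightarrow> (real^3) set) \<Rightarrow> real \<Rightarrow> (real \<Rightarrow> real^3) \<Rightarrow> bool" where
  "C1_lift \<gamma> t F \<longleftrightarrow>
     (\<exists>e>0. F C1_differentiable_on ball t e \<and> (\<forall>s\<in>ball t e. F s \<noteq> 0 \<and> \<gamma> s = span {F s}))"

definition C2_lift :: "(real \<Rightarrow> (real^3) set) \<Rightarrow> real \<Rightarrow> (real \<Rightarrow> real^3) \<Rightarrow> bool" where
  "C2_lift \<gamma> t F \<longleftrightarrow>
     (\<exists>e>0. F C1_differentiable_on ball t e \<and> vderiv F C1_differentiable_on ball t e \<and>
            (\<forall>s\<in>ball t e. F s \<noteq> 0 \<and> \<gamma> s = span {F s}))"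

text \<open>
  The velocity of \<open>[F]\<close> at \<open>t\<close> is nonzero iff \<open>F t\<close> and its derivative are linearly independent.
\<close>

definition C1_regular :: "(real \<Rightarrow> (real^3) set) \<Rightarrow> bool" where
  "C1_regular \<gamma> \<longleftrightarrow> (\<forall>t. \<exists>F. C1_lift \<gamma> t F \<and> dim {F t, vderiv F t} = 2)"

definition C2_regular :: "(real \<Rightarrow> (real^3) set) \<Rightarrow> bool" where
  "C2_regular \<gamma> \<longleftrightarrow> (\<forall>t. \<exists>F. C2_lift \<gamma> t F \<and> dim {F t, vderiv F t} = 2)"

text \<open>Closed curves are parametrized over the real line with period \<open>1\<close>.\<close>

definition simple_closed :: "(real \<Rightarrow> (real^3) set) \<Rightarrow> bool" where
  "simple_closed \<gamma> \<longleftrightarrow> (\<forall>t. \<gamma> (t + 1) = \<gamma> t) \<and> inj_on \<gamma> {0..<1}"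

definition tangent_line :: "(real \<Rightarrow> (real^3) set) \<Rightarrow> real \<Rightarrow> (real^3) set" where
  "tangent_line \<gamma> t = (THE L. \<exists>F. C1_lift \<gamma> t F \<and> L = span {F t, vderiv F t})"

lemma tangent_span_subset:
  assumes F: "C1_lift \<gamma> t F" and G: "C1_lift \<gamma> t G"
  shows "span {G t, vderiv G t} \<subseteq> span {F t, vderiv F t}"
proof -
  obtain e where e: "e > 0" "F C1_differentiable_on ball t e"
    "\<And>s. s \<in> ball t e \<Longrightarrow> F s \<noteq> 0 \<and> \<gamma> s = span {F s}"
    using F unfolding C1_lift_def by blast
  obtain d where d: "d > 0" "G C1_differentiable_on ball t d"
    "\<And>s. s \<in> ball t d \<Longrightarrow> G s \<noteq> 0 \<and> \<gamma> s = span {G s}"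
    using G unfolding C1_lift_def by blast
  define c where "c = (\<lambda>s. (G s \<bullet> F s) / (F s \<bullet> F s))"
  have tF: "F t \<noteq> 0" using e by auto
  have GcF: "c s *\<^sub>R F s = G s" if "s \<in> ball t (min e d)" for s
  proof -
    have s: "s \<in> ball t e" "s \<in> ball t d" using that by auto
    have "G s \<in> span {F s}"
      using e(3)[OF s(1)] d(3)[OF s(2)] by (metis insertI1 span_base)
    then obtain k where "G s = k *\<^sub>R F s" by (auto simp: span_singleton)
    with e(3)[OF s(1)] show ?thesis by (simp add: c_def)
  qed
  have dF: "(F has_vector_derivative vderiv F t) (at t)"
    using e(1,2) C1_differentiable_on_eq vector_derivative_works by (metis centre_in_ball)
  have dG: "(G has_vector_derivative vderiv G t) (at t)"
    using d(1,2) C1_differentiable_on_eq vector_derivative_works by (metis centre_in_ball)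
  have "c differentiable at t"
    unfolding c_def using dF dG tF
    by (intro differentiable_divide differentiable_inner)
      (auto intro: differentiableI_vector)
  then obtain c' where c': "(c has_real_derivative c') (at t)"
    by (auto simp: real_differentiable_def)
  have "((\<lambda>s. c s *\<^sub>R F s) has_vector_derivative (c t *\<^sub>R vderiv F t + c' *\<^sub>R F t)) (at t)"
    by (rule has_vector_derivative_scaleR[OF c' dF])
  then have "(G has_vector_derivative (c t *\<^sub>R vderiv F t + c' *\<^sub>R F t)) (at t)"
    by (rule has_vector_derivative_transform_within_open[where S = "ball t (min e d)"])
      (use e d GcF in auto)
  then have G': "vderiv G t = c t *\<^sub>R vderiv F t + c' *\<^sub>R F t"
    by (rule vector_derivative_at)
  have Gt: "G t = c t *\<^sub>R F t" using GcF[of t] e(1) d(1) by simp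
  have "{G t, vderiv G t} \<subseteq> span {F t, vderiv F t}"
    unfolding G' Gt by (simp add: span_add span_scale span_base)
  then show ?thesis by (rule span_minimal) (rule subspace_span)
qed

lemma tangent_line_eq:
  assumes "C1_lift \<gamma> t F"
  shows "tangent_line \<gamma> t = span {F t, vderiv F t}"
  unfolding tangent_line_def
  using assms tangent_span_subset by (intro the_equality) (blast, fast)

definition transversal :: "(real \<Rightarrow> (real^3) set) \<Rightarrow> (real^3) set \<Rightarrow> bool" where
  "transversal \<gamma> L \<longleftrightarrow> (\<forall>t. \<gamma> t \<subseteq> L \<longrightarrow> tangent_line \<gamma> t \<noteq> L)"

definition anti_convex :: "(real \<Rightarrow> (real^3) set) \<Rightarrow> bool" where
  "anti_convex \<gamma> \<longleftrightarrow> simple_closed \<gamma> \<and> C1_regular \<gamma> \<and>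
     (\<forall>p\<in>range \<gamma>. \<exists>L. proj_line L \<and> transversal \<gamma> L \<and> {q \<in> range \<gamma>. q \<subseteq> L} = {p})"

definition inflection :: "(real \<Rightarrow> (real^3) set) \<Rightarrow> real \<Rightarrow> bool" where
  "inflection \<gamma> t \<longleftrightarrow>
     (\<exists>F. C2_lift \<gamma> t F \<and> det (vector [F t, vderiv F t, vderiv (vderiv F) t] :: real^3^3) = 0)"

text \<open>
  Crossings in an affine plane \<open>A\<close>, for one-dimensional subsets \<open>c1\<close>, \<open>c2\<close> of \<open>A\<close>. The two sides of
  \<open>c2\<close> make sense only near \<open>\<alpha>\<close>: they are the two components \<open>S\<close>, \<open>T\<close> of \<open>U - c2\<close> for some
  connected open neighbourhood \<open>U\<close> of \<open>\<alpha>\<close> that is divided by \<open>c2\<close> into exactly two parts.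
  An open arc lies on a closed side if it is contained in the closure; it may meet \<open>c2\<close>.
\<close>

definition closed_arc :: "(real^3) set \<Rightarrow> bool" where
  "closed_arc \<alpha> \<longleftrightarrow> (\<exists>x. \<alpha> = {x}) \<or> (\<exists>g. arc g \<and> \<alpha> = path_image g)"

definition maximal_common_arc :: "(real^3) set \<Rightarrow> (real^3) set \<Rightarrow> (real^3) set \<Rightarrow> bool" where
  "maximal_common_arc c1 c2 \<alpha> \<longleftrightarrow> closed_arc \<alpha> \<and> \<alpha> \<subseteq> c1 \<inter> c2 \<and>
     (\<forall>\<beta>. closed_arc \<beta> \<and> \<alpha> \<subseteq> \<beta> \<and> \<beta> \<subseteq> c1 \<inter> c2 \<longrightarrow> \<beta> = \<alpha>)"

definition open_subarc :: "(real^3) set \<Rightarrow> (real^3) set \<Rightarrow> bool" where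
  "open_subarc B c \<longleftrightarrow> (\<exists>g. arc g \<and> path_image g \<subseteq> c \<and> B = g ` {0<..<1})"

definition crosses_in ::
  "(real^3) set \<Rightarrow> (real^3) set \<Rightarrow> (real^3) set \<Rightarrow> (real^3) set \<Rightarrow> bool" where
  "crosses_in A c1 c2 \<alpha> \<longleftrightarrow> maximal_common_arc c1 c2 \<alpha> \<and>
     (\<exists>B P Q U S T.
        open_subarc B c1 \<and> \<alpha> \<subseteq> B \<and> P \<noteq> Q \<and> components (B - \<alpha>) = {P, Q} \<and>
        openin (top_of_set A) U \<and> connected U \<and> B \<subseteq> U \<and>
        S \<noteq> T \<and> components (U - c2) = {S, T} \<and>
        P \<subseteq> closure S \<and> Q \<subseteq> closure T)"

text \<open>
  For \<open>n \<noteq> 0\<close>, the map \<open>v \<mapsto> span {v}\<close> identifies the affine plane \<open>affine_chart n\<close> with the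
  complement of the projective line \<open>{v. n \<bullet> v = 0}\<close>.
\<close>

definition affine_chart :: "real^3 \<Rightarrow> (real^3) set" where
  "affine_chart n = {v. n \<bullet> v = 1}"

definition line_crosses_in ::
  "(real^3) set \<Rightarrow> (real \<Rightarrow> (real^3) set) \<Rightarrow> (real^3) set set \<Rightarrow> bool" where
  "line_crosses_in L \<gamma> \<alpha> \<longleftrightarrow>
     (\<exists>n a. n \<noteq> 0 \<and>
        crosses_in (affine_chart n) {v \<in> affine_chart n. span {v} \<subseteq> L}
          {v \<in> affine_chart n. span {v} \<in> range \<gamma>} a \<and>
        \<alpha> = (\<lambda>v. span {v}) ` a)"

definition crosses_only_once :: "(real^3) set \<Rightarrow> (real \<Rightarrow> (real^3) set) \<Rightarrow> bool" where
  "crosses_only_once L \<gamma> \<longleftrightarrow> (\<exists>!\<alpha>. line_crosses_in L \<gamma> \<alpha>)"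

end

theory Submission
  imports Defs
begin

text \<open>
  Idea: lift the curve to \<open>f\<close> with \<open>f (t + 1) = - f t\<close>. Anti-convexity says that every \<open>t\<close> has
  a functional \<open>m\<close> with \<open>m \<bullet> f t = 0\<close> that is positive on \<open>f\<close> over \<open>]t, t + 1[\<close>. Call \<open>t\<close> clean
  if \<open>g = f t \<times> f' t\<close> has constant sign on \<open>f\<close> over \<open>[t, t + 1]\<close>: the tangent line at \<open>t\<close> then changes
  sides only there, and it has contact of order two because \<open>g \<bullet> f\<close> changes sign at its double zero.
  If \<open>t\<close> is not clean with a given sign, rotating \<open>m\<close> about \<open>f t\<close> towards \<open>g\<close> stops at a line that is
  tangent at some \<open>s\<close> in \<open>]t, t + 1[\<close> and crosses only at \<open>t\<close>. Such chords \<open>(t, s)\<close> can be shortened: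
  rotating at a parameter strictly between yields a shorter chord of the same orientation, so a shortest
  one degenerates to a clean point strictly between \<open>t\<close> and \<open>s\<close>; by time reversal there is also one
  between \<open>s\<close> and \<open>t + 1\<close>. Starting from a clean \<open>t\<close>, and using the sign with which \<open>t\<close> is not clean,
  one obtains three clean points.
\<close>

text \<open>The lift changes sign over one period because the line given by anti-convexity meets the
  curve once and transversally: \<open>m \<bullet> f\<close> keeps one sign along
  \<open>]t, t + 1[\<close> and changes it at \<open>t\<close>. Parameters therefore live on the
  double cover. A chord that leaves \<open>[a, b]\<close> far to the right reenters on the left
  after a shift by 1, with forward and backward exchanged, which is why both kinds occur. A shortest
  chord exists by compactness only if the conditions on a chord are equations and weak inequalities
  that still make sense for \<open>a = b\<close>. The price is that the limit could be one of the
  endpoints \<open>t\<close> and \<open>s\<close>; the strict signs of the initial chord exclude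
  this. The other obstacle is a new chord that interleaves with the old one; it turns out to lie on
  a line through the old tangent point. For the crossings, \<open>n \<bullet> f\<close> may vanish
  on whole intervals, and its zeros may accumulate at their ends. So crossings are decided by
  maximal intervals of zeros instead of isolated zeros, each enclosed in a box in which the curve is
  a graph over the line.\<close>

unbundle cross3_syntax

section \<open>Clean points of antiperiodic curves\<close>

text \<open>Lagrange's identity makes \<open>n \<times> (a \<times> b)\<close> vanish. The
  coefficient is kept explicit because its sign, that of \<open>n \<bullet> (a \<times> b)\<close>,
  is what the orientation arguments need.\<close>

lemma parallel_to_cross:
  fixes n a b :: "real^3"
  assumes "n \<bullet> a = 0" "n \<bullet> b = 0" "a \<times> b \<noteq> 0"
  shows "n = ((n \<bullet> (a \<times> b)) / ((a \<times> b) \<bullet> (a \<times> b))) *\<^sub>R (a \<times> b)"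
proof -
  let ?u = "a \<times> b"
  have 1: "n \<times> ?u = 0" using assms(1,2) by (simp only: Lagrange) simp
  have "?u \<times> (n \<times> ?u) = (?u \<bullet> ?u) *\<^sub>R n - (n \<bullet> ?u) *\<^sub>R ?u"
    by (metis Lagrange inner_commute)
  then have "(?u \<bullet> ?u) *\<^sub>R n = (n \<bullet> ?u) *\<^sub>R ?u" using 1 by simp
  then have "(1 / (?u \<bullet> ?u)) *\<^sub>R ((?u \<bullet> ?u) *\<^sub>R n) = (1 / (?u \<bullet> ?u)) *\<^sub>R ((n \<bullet> ?u) *\<^sub>R ?u)"
    by simp
  then show ?thesis using assms(3) by simp
qed

text \<open>Cramer's rule as the linear dependence of four vectors in space; each coefficient is, up
  to sign, the triple product of the other three. Applying a functional turns it into a relation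
  between signs, which replaces planar incidence arguments.\<close>

lemma four_point_relation:
  fixes p q r s :: "real^3"
  shows "(q \<bullet> (r \<times> s)) *\<^sub>R p - (p \<bullet> (r \<times> s)) *\<^sub>R q + (p \<bullet> (q \<times> s)) *\<^sub>R r
    - (p \<bullet> (q \<times> r)) *\<^sub>R s = 0"
  by (simp add: vec_eq_iff forall_3 cross3_def inner_vec_def sum_3 algebra_simps)

lemma periodic_add_int:
  fixes f :: "real \<Rightarrow> 'a"
  assumes "\<And>s. f (s + 1) = f s"
  shows "f (s + of_int k) = f s"
proof (induction k rule: int_induct[where k = 0])
  case (step1 i)
  then show ?case using assms[of "s + of_int i"] by (simp add: algebra_simps)
next
  case (step2 i)
  then show ?case using assms[of "s + of_int i - 1"] by (simp add: algebra_simps)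
qed simp

lemma antiperiodic_add_int:
  fixes f :: "real \<Rightarrow> 'a :: real_vector"
  assumes "\<And>s. f (s + 1) = - f s"
  shows "f (s + of_int k) = (if even k then f s else - f s)"
proof (induction k rule: int_induct[where k = 0])
  case (step1 i)
  then show ?case using assms[of "s + of_int i"] by (simp add: algebra_simps)
next
  case (step2 i)
  moreover have "f (s + of_int i - 1) = - f (s + of_int i)" using assms[of "s + of_int i - 1"] by simp
  ultimately show ?case by (simp add: algebra_simps)
qed simp

text \<open>L'Hopital's rule of first order: the quotient of the functions is the quotient of their
  difference quotients at \<open>x\<close>.\<close>

lemma quotient_tendsto_0:
  fixes u v :: "real \<Rightarrow> real"
  assumes "(u has_real_derivative 0) (at x)" "(v has_real_derivative D) (at x)" "D \<noteq> 0"
    and "u x = 0" "v x = 0"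
  shows "((\<lambda>y. u y / v y) \<longlongrightarrow> 0) (at x)"
proof -
  have "((\<lambda>y. ((u y - u x) / (y - x)) / ((v y - v x) / (y - x))) \<longlongrightarrow> 0 / D) (at x)"
    using assms by (intro tendsto_divide) (auto simp: has_field_derivative_iff)
  then show ?thesis
    unfolding div_0 by (rule Lim_transform_eventually) (use assms in \<open>auto simp: eventually_at_filter\<close>)
qed

text \<open>\<open>regular\<close> says that \<open>f t\<close> and \<open>f' t\<close> span the
  tangent plane. \<open>support\<close> is anti-convexity, with transversality in the form
  \<open>0 < m \<bullet> f' t\<close>, which also normalises the sign of \<open>m\<close>. The
  search for clean points takes place in class C1.\<close>

locale antiperiodic_curve =
  fixes f f' :: "real \<Rightarrow> real^3"
  assumes has_deriv: "\<And>t. (f has_vector_derivative f' t) (at t)"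
    and cont_deriv: "continuous_on UNIV f'"
    and antiperiodic: "\<And>t. f (t + 1) = - f t"
    and regular: "\<And>t. f t \<times> f' t \<noteq> 0"
    and support: "\<And>t. \<exists>m. m \<bullet> f t = 0 \<and> 0 < m \<bullet> f' t \<and> (\<forall>s. t < s \<and> s < t + 1 \<longrightarrow> 0 < m \<bullet> f s)"
begin

lemma cont: "continuous_on S f"
  using has_deriv has_vector_derivative_continuous by (blast intro: continuous_at_imp_continuous_on)

lemma cont_f [continuous_intros]: "continuous_on S g \<Longrightarrow> continuous_on S (\<lambda>x. f (g x))"
  by (rule continuous_on_compose2[OF cont[of UNIV]]) auto

lemma cont_f' [continuous_intros]: "continuous_on S g \<Longrightarrow> continuous_on S (\<lambda>x. f' (g x))"
  by (rule continuous_on_compose2[OF cont_deriv]) auto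

lemma nonzero: "f t \<noteq> 0"
  using regular[of t] by auto

lemma antiperiodic': "f (t - 1) = - f t"
  using antiperiodic[of "t - 1"] by simp

lemma deriv_antiperiodic: "f' (t + 1) = - f' t"
proof -
  have "((f \<circ> (\<lambda>x. x + 1)) has_vector_derivative 1 *\<^sub>R f' (t + 1)) (at t)"
    by (rule vector_diff_chain_at) (auto intro!: derivative_eq_intros has_deriv)
  moreover have "((\<lambda>x. - f x) has_vector_derivative - f' t) (at t)"
    by (intro has_vector_derivative_minus has_deriv)
  ultimately show ?thesis
    by (simp add: o_def antiperiodic vector_derivative_unique_at)
qed

lemma deriv_antiperiodic': "f' (t - 1) = - f' t"
  using deriv_antiperiodic[of "t - 1"] by simp

lemma dot_deriv: "((\<lambda>x. n \<bullet> f x) has_real_derivative n \<bullet> f' t) (at t)"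
  unfolding has_real_derivative_iff_has_vector_derivative
  by (rule bounded_linear.has_vector_derivative[OF bounded_linear_inner_right has_deriv])

lemma dot_pos_after:
  assumes "n \<bullet> f t = 0" "0 < n \<bullet> f' t"
  obtains d where "d > 0" "\<And>s. t < s \<Longrightarrow> s < t + d \<Longrightarrow> 0 < n \<bullet> f s"
proof -
  from DERIV_pos_inc_right[OF dot_deriv assms(2)] obtain d
    where "d > 0" "\<forall>h>0. h < d \<longrightarrow> n \<bullet> f t < n \<bullet> f (t + h)" by blast
  then have d: "0 < n \<bullet> f s" if "t < s" "s < t + d" for s
    using that assms(1) by (auto dest!: spec[where x = "s - t"])
  with \<open>d > 0\<close> show ?thesis by (rule that)
qed

text \<open>By antiperiodicity the sign over \<open>]t, t + 1[\<close> determines the sign over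
  \<open>]t - 1, t[\<close>: one plane separates the period after \<open>t\<close> from the period
  before it.\<close>

lemma supportE:
  obtains m where "m \<bullet> f t = 0" "0 < m \<bullet> f' t"
    "\<And>s. t < s \<Longrightarrow> s < t + 1 \<Longrightarrow> 0 < m \<bullet> f s"
    "\<And>s. t - 1 < s \<Longrightarrow> s < t \<Longrightarrow> m \<bullet> f s < 0"
proof -
  from support[of t] obtain m where m: "m \<bullet> f t = 0" "0 < m \<bullet> f' t"
    "\<And>s. t < s \<Longrightarrow> s < t + 1 \<Longrightarrow> 0 < m \<bullet> f s" by blast
  have "m \<bullet> f s < 0" if "t - 1 < s" "s < t" for s
    using m(3)[of "s + 1"] that antiperiodic[of s] by simp
  with m show ?thesis by (rule that)
qed

lemma independent:
  assumes "a < b" "b < a + 1"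
  shows "f a \<times> f b \<noteq> 0"
proof
  assume 0: "f a \<times> f b = 0"
  obtain m where m: "m \<bullet> f a = 0" "0 < m \<bullet> f' a"
    "\<And>s. a < s \<Longrightarrow> s < a + 1 \<Longrightarrow> 0 < m \<bullet> f s"
    "\<And>s. a - 1 < s \<Longrightarrow> s < a \<Longrightarrow> m \<bullet> f s < 0"
    by (rule supportE[of "a"]) (rule that)
  have "m \<times> (f a \<times> f b) = (m \<bullet> f b) *\<^sub>R f a" using m(1) by (simp only: Lagrange) simp
  with 0 m(3)[of b] assms nonzero[of a] show False by simp
qed

lemma deriv_zero_at_min:
  assumes "\<forall>x\<in>{0..1}. 0 \<le> n \<bullet> f (a + x)" "a < b" "b < a + 1" "n \<bullet> f b = 0"
  shows "n \<bullet> f' b = 0"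
proof (rule DERIV_local_min[OF dot_deriv])
  show "0 < min (b - a) (a + 1 - b)" using assms by simp
  show "\<forall>y. \<bar>b - y\<bar> < min (b - a) (a + 1 - b) \<longrightarrow> n \<bullet> f b \<le> n \<bullet> f y"
  proof (intro allI impI)
    fix y assume "\<bar>b - y\<bar> < min (b - a) (a + 1 - b)"
    then have "y - a \<in> {0..1}" by auto
    with assms(1) have "0 \<le> n \<bullet> f (a + (y - a))" by blast
    with assms(4) show "n \<bullet> f b \<le> n \<bullet> f y" by simp
  qed
qed

text \<open>Both cross products are normal to the same plane, hence proportional. The support
  functional \<open>m\<close> at \<open>b\<close> fixes the sign of the factor: the cross product of
  \<open>m\<close> with them is \<open>m \<bullet> f' b\<close> and
  \<open>- (m \<bullet> f a)\<close> times \<open>f b\<close>, and both numbers are positive because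
  \<open>a\<close> lies less than 1 before \<open>b\<close>. So the orientation of a chord can be
  read off at its tangent point.\<close>

lemma tangent_direction_end:
  assumes n: "n \<noteq> 0" "n \<bullet> f a = 0" "n \<bullet> f b = 0" "n \<bullet> f' b = 0" and ab: "a < b" "b < a + 1"
  obtains k where "k > 0" "f b \<times> f' b = k *\<^sub>R (f a \<times> f b)"
proof -
  obtain m where m: "m \<bullet> f b = 0" "0 < m \<bullet> f' b"
    "\<And>s. b < s \<Longrightarrow> s < b + 1 \<Longrightarrow> 0 < m \<bullet> f s"
    "\<And>s. b - 1 < s \<Longrightarrow> s < b \<Longrightarrow> m \<bullet> f s < 0"
    by (rule supportE[of "b"]) (rule that)
  define l where "l = (n \<bullet> (f b \<times> f' b)) / ((f b \<times> f' b) \<bullet> (f b \<times> f' b))"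
  define l' where "l' = (n \<bullet> (f a \<times> f b)) / ((f a \<times> f b) \<bullet> (f a \<times> f b))"
  have l: "n = l *\<^sub>R (f b \<times> f' b)" unfolding l_def
    by (rule parallel_to_cross) (use n regular in auto)
  have l': "n = l' *\<^sub>R (f a \<times> f b)" unfolding l'_def
    by (rule parallel_to_cross) (use n independent ab in auto)
  have "l \<noteq> 0" using l n by auto
  define k where "k = l' / l"
  have k: "f b \<times> f' b = k *\<^sub>R (f a \<times> f b)"
  proof -
    have "(1/l) *\<^sub>R (l *\<^sub>R (f b \<times> f' b)) = (1/l) *\<^sub>R (l' *\<^sub>R (f a \<times> f b))" using l l' by simp
    then show ?thesis using \<open>l \<noteq> 0\<close> by (simp add: k_def)
  qed
  have "m \<times> (f b \<times> f' b) = (m \<bullet> f' b) *\<^sub>R f b" using m(1) by (simp only: Lagrange) simp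
  moreover have "m \<times> (f a \<times> f b) = - (m \<bullet> f a) *\<^sub>R f b" using m(1) by (simp only: Lagrange) simp
  ultimately have "(m \<bullet> f' b) *\<^sub>R f b = (- k * (m \<bullet> f a)) *\<^sub>R f b"
    using k by (simp add: cross_mult_right)
  then have "m \<bullet> f' b = - k * (m \<bullet> f a)" using nonzero by (metis scaleR_cancel_right)
  moreover have "m \<bullet> f a < 0" using m(4)[of a] ab by simp
  ultimately have "k > 0" using m(2)
    by (smt (verit) mult_nonneg_nonpos mult_nonneg_nonneg mult_minus_left)
  with k that show ?thesis by blast
qed

text \<open>The support functional at \<open>a\<close> is positive on both \<open>f b\<close> and
  \<open>f c\<close>, so replacing the end of a chord by another point of the same line keeps the
  orientation.\<close>

lemma chord_direction:
  assumes n: "n \<noteq> 0" "n \<bullet> f a = 0" "n \<bullet> f b = 0" "n \<bullet> f c = 0"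
    and bc: "a < b" "b < a + 1" "a < c" "c < a + 1"
  obtains k where "k > 0" "f a \<times> f b = k *\<^sub>R (f a \<times> f c)"
proof -
  obtain m where m: "m \<bullet> f a = 0" "0 < m \<bullet> f' a"
    "\<And>s. a < s \<Longrightarrow> s < a + 1 \<Longrightarrow> 0 < m \<bullet> f s"
    "\<And>s. a - 1 < s \<Longrightarrow> s < a \<Longrightarrow> m \<bullet> f s < 0"
    by (rule supportE[of "a"]) (rule that)
  define l where "l = (n \<bullet> (f a \<times> f b)) / ((f a \<times> f b) \<bullet> (f a \<times> f b))"
  define l' where "l' = (n \<bullet> (f a \<times> f c)) / ((f a \<times> f c) \<bullet> (f a \<times> f c))"
  have l: "n = l *\<^sub>R (f a \<times> f b)" unfolding l_def
    by (rule parallel_to_cross) (use n independent bc in auto)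
  have l': "n = l' *\<^sub>R (f a \<times> f c)" unfolding l'_def
    by (rule parallel_to_cross) (use n independent bc in auto)
  have "l \<noteq> 0" using l n by auto
  define k where "k = l' / l"
  have k: "f a \<times> f b = k *\<^sub>R (f a \<times> f c)"
  proof -
    have "(1/l) *\<^sub>R (l *\<^sub>R (f a \<times> f b)) = (1/l) *\<^sub>R (l' *\<^sub>R (f a \<times> f c))" using l l' by simp
    then show ?thesis using \<open>l \<noteq> 0\<close> by (simp add: k_def)
  qed
  have "m \<times> (f a \<times> f b) = (m \<bullet> f b) *\<^sub>R f a" using m(1) by (simp only: Lagrange) simp
  moreover have "m \<times> (f a \<times> f c) = (m \<bullet> f c) *\<^sub>R f a" using m(1) by (simp only: Lagrange) simp
  ultimately have "(m \<bullet> f b) *\<^sub>R f a = (k * (m \<bullet> f c)) *\<^sub>R f a"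
    using k by (metis cross_mult_right scaleR_scaleR)
  then have "m \<bullet> f b = k * (m \<bullet> f c)" using nonzero by (metis scaleR_cancel_right)
  moreover have "m \<bullet> f b > 0" "m \<bullet> f c > 0" using m(3) bc by auto
  ultimately have "k > 0" by (metis zero_less_mult_pos2)
  with k that show ?thesis by blast
qed

text \<open>Shifting \<open>c\<close> by \<open>1\<close> exchanges the two signs, so they only make sense on the double cover.\<close>

definition pos_clean :: "real \<Rightarrow> bool" where
  "pos_clean c \<longleftrightarrow> (\<forall>x\<in>{0..1}. 0 \<le> (f c \<times> f' c) \<bullet> f (c + x))"

definition neg_clean :: "real \<Rightarrow> bool" where
  "neg_clean c \<longleftrightarrow> (\<forall>x\<in>{0..1}. (f c \<times> f' c) \<bullet> f (c + x) \<le> 0)"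

text \<open>The lines through \<open>f t\<close> other than the tangent form the pencil
  \<open>m + \<lambda> *\<^sub>R g\<close>. For \<open>\<lambda> \<ge> 0\<close> such a functional
  is nonnegative on the arc exactly as long as \<open>\<lambda> * q \<le> 1\<close>. Since
  \<open>t\<close> is not clean, \<open>q\<close> is positive somewhere; since it tends to 0 at both
  ends, its maximum is attained inside the arc, and there the rotating line first touches the
  curve.\<close>

lemma support_tangent_exists:
  assumes "\<not> pos_clean t"
  obtains s n where "t < s" "s < t + 1" "n \<noteq> 0" "\<forall>x\<in>{0..1}. 0 \<le> n \<bullet> f (t + x)"
    "n \<bullet> f t = 0" "0 < n \<bullet> f' t" "n \<bullet> f s = 0" "0 < n \<bullet> (f t \<times> f s)"
proof -
  define g where "g = f t \<times> f' t"
  obtain m where m: "m \<bullet> f t = 0" "0 < m \<bullet> f' t"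
    "\<And>s. t < s \<Longrightarrow> s < t + 1 \<Longrightarrow> 0 < m \<bullet> f s"
    "\<And>s. t - 1 < s \<Longrightarrow> s < t \<Longrightarrow> m \<bullet> f s < 0"
    by (rule supportE[of "t"]) (rule that)
  have m1: "m \<bullet> f (t + 1) = 0" using m(1) antiperiodic by simp
  have g: "g \<bullet> f t = 0" "g \<bullet> f' t = 0" "g \<bullet> f (t + 1) = 0" "g \<bullet> f' (t + 1) = 0"
    by (auto simp: g_def dot_cross_self antiperiodic deriv_antiperiodic)
  \<comment> \<open>At both ends the value is \<open>0 / 0 = 0\<close>, which is also the limit.\<close>
  define q where "q = (\<lambda>s. (- g \<bullet> f s) / (m \<bullet> f s))"
  have q0: "q t = 0" "q (t + 1) = 0" by (auto simp: q_def m m1)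
  have lim: "(q \<longlongrightarrow> 0) (at x)" if "x = t \<or> x = t + 1" for x
    unfolding q_def
    by (rule quotient_tendsto_0[where D = "m \<bullet> f' x"], rule DERIV_cong[OF dot_deriv])
       (use that m m1 g deriv_antiperiodic in \<open>auto intro: dot_deriv\<close>)
  have "continuous_on {t..t+1} q"
    unfolding continuous_on_eq_continuous_within
  proof
    fix x assume x: "x \<in> {t..t+1}"
    show "continuous (at x within {t..t+1}) q"
    proof (cases "x = t \<or> x = t + 1")
      case True
      then have "(q \<longlongrightarrow> q x) (at x)" using lim[OF True] q0 by auto
      then show ?thesis unfolding continuous_within by (rule tendsto_within_subset[of _ _ _ UNIV]) auto
    next
      case False
      then have "m \<bullet> f x \<noteq> 0" using m(3)[of x] x by force
      moreover have "isCont f x" using has_deriv has_vector_derivative_continuous by blast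
      ultimately have "isCont q x" unfolding q_def by (intro continuous_intros) auto
      then show ?thesis using continuous_at_imp_continuous_at_within by blast
    qed
  qed
  then obtain s where s: "s \<in> {t..t+1}" "\<And>y. y \<in> {t..t+1} \<Longrightarrow> q y \<le> q s"
    using continuous_attains_sup[of "{t..t+1}" q] by auto
  obtain x where x: "x \<in> {0..1}" "g \<bullet> f (t + x) < 0"
    using assms unfolding pos_clean_def g_def[symmetric] by force
  have x01: "0 < x" "x < 1" using x g by (auto simp: less_le)
  have "0 < q (t + x)" using x01 m(3)[of "t + x"] x by (auto simp: q_def divide_neg_pos)
  also have "\<dots> \<le> q s" using s(2)[of "t + x"] x by auto
  finally have qs: "0 < q s" .
  then have ts: "t < s" "s < t + 1" using s(1) q0 by (auto simp: less_le)
  have ms: "0 < m \<bullet> f s" using m(3) ts by auto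
  \<comment> \<open>The parameter \<open>1 / q s\<close> is the largest one for which the pencil
    functional stays nonnegative on the arc.\<close>
  define n where "n = m + (1 / q s) *\<^sub>R g"
  have n_dot: "n \<bullet> v = m \<bullet> v + (g \<bullet> v) / q s" for v by (simp add: n_def inner_add_left)
  have nf: "n \<bullet> f t = 0" "0 < n \<bullet> f' t" using m g by (auto simp: n_dot)
  have gs: "g \<bullet> f s = - q s * (m \<bullet> f s)" using ms by (simp add: q_def)
  have ns: "n \<bullet> f s = 0" using gs qs by (simp add: n_dot)
  have nn: "\<forall>x\<in>{0..1}. 0 \<le> n \<bullet> f (t + x)"
  proof
    fix y :: real assume y: "y \<in> {0..1}"
    show "0 \<le> n \<bullet> f (t + y)"
    proof (cases "y = 0 \<or> y = 1")
      case True then show ?thesis using nf antiperiodic by auto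
    next
      case False
      then have my: "0 < m \<bullet> f (t + y)" using m(3)[of "t + y"] y by auto
      have "q (t + y) \<le> q s" using s(2)[of "t + y"] y by auto
      moreover have "q (t + y) = - (g \<bullet> f (t + y)) / (m \<bullet> f (t + y))" by (simp add: q_def)
      ultimately have "- (g \<bullet> f (t + y)) \<le> q s * (m \<bullet> f (t + y))"
        using my by (simp only: pos_divide_le_eq)
      then have "- (g \<bullet> f (t + y)) / q s \<le> m \<bullet> f (t + y)"
        using qs by (simp only: pos_divide_le_eq mult.commute)
      then show ?thesis by (simp add: n_dot)
    qed
  qed
  \<comment> \<open>The orientation is found from the derivative at \<open>t\<close>:
    \<open>n\<close> is a multiple of \<open>u\<close>, and both are positive on \<open>f' t\<close>
    because \<open>g \<bullet> f s\<close> is negative.\<close>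
  define u where "u = f t \<times> f s"
  have "u \<bullet> f' t = - (g \<bullet> f s)" by (simp add: u_def g_def cross3_simps)
  then have upos: "0 < u \<bullet> f' t" using gs qs ms by simp
  have "n = ((n \<bullet> u) / (u \<bullet> u)) *\<^sub>R u" unfolding u_def
    by (rule parallel_to_cross) (use nf ns independent ts in auto)
  then have "n \<bullet> f' t = ((n \<bullet> u) / (u \<bullet> u)) * (u \<bullet> f' t)" by (metis inner_scaleR_left)
  then have "0 < (n \<bullet> u) / (u \<bullet> u)" using nf(2) upos by (metis zero_less_mult_pos2)
  then have "0 < n \<bullet> u" by (metis inner_ge_zero zero_less_divide_iff not_less)
  moreover have "n \<noteq> 0" using nf by auto
  ultimately show ?thesis using ts nf ns nn by (intro that[of s n]) (auto simp: u_def)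
qed

text \<open>A chord from \<open>f a\<close> to \<open>f b\<close> spans the line \<open>n \<bullet> v = 0\<close>. A forward chord changes sides at \<open>a\<close> and
  is tangent at \<open>b\<close>; for a backward chord it is the other way round. The condition on the cross
  product at the tangent point fixes the orientation and, unlike \<open>0 < n \<bullet> (f a \<times> f b)\<close>, survives
  the limit \<open>a = b\<close>.\<close>

definition fwd_chord :: "real \<Rightarrow> real \<Rightarrow> real^3 \<Rightarrow> bool" where
  "fwd_chord a b n \<longleftrightarrow> n \<bullet> f a = 0 \<and> n \<bullet> f b = 0 \<and> n \<bullet> f' b = 0 \<and> 0 \<le> n \<bullet> (f b \<times> f' b) \<and>
     (\<forall>x\<in>{0..1}. 0 \<le> n \<bullet> f (a + x))"

definition bwd_chord :: "real \<Rightarrow> real \<Rightarrow> real^3 \<Rightarrow> bool" where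
  "bwd_chord a b n \<longleftrightarrow> n \<bullet> f a = 0 \<and> n \<bullet> f b = 0 \<and> n \<bullet> f' a = 0 \<and> 0 \<le> n \<bullet> (f a \<times> f' a) \<and>
     (\<forall>x\<in>{0..1}. 0 \<le> n \<bullet> f (b + x))"

text \<open>The end \<open>b\<close> is an interior minimum of \<open>n \<bullet> f\<close>, hence a
  point of tangency, and the orientation there agrees with the sign of
  \<open>n \<bullet> (f a \<times> f b)\<close>.\<close>

lemma fwd_chordI:
  assumes "n \<noteq> 0" "a < b" "b < a + 1" "\<forall>x\<in>{0..1}. 0 \<le> n \<bullet> f (a + x)" "n \<bullet> f a = 0"
    and "n \<bullet> f b = 0" "0 \<le> n \<bullet> (f a \<times> f b)"
  shows "fwd_chord a b n"
proof -
  have d: "n \<bullet> f' b = 0" by (rule deriv_zero_at_min[of _ a]) (use assms in auto)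
  obtain k where "k > 0" "f b \<times> f' b = k *\<^sub>R (f a \<times> f b)"
    by (rule tangent_direction_end[of n a b]) (use assms d in auto)
  then show ?thesis using assms d by (simp add: fwd_chord_def)
qed

text \<open>The values of \<open>n\<close> at \<open>c\<close> and \<open>d\<close> and of
  \<open>n'\<close> at \<open>b\<close> give the signs of three triple products. The support
  functional at \<open>b\<close> is negative on \<open>f a\<close> and \<open>f c\<close>, zero on
  \<open>f b\<close> and positive on \<open>f d\<close>. Applied to the four-point relation it
  yields a vanishing sum of three nonnegative terms, so each of them is zero.\<close>

lemma crossing_chords_collinear:
  assumes n: "\<forall>x\<in>{0..1}. 0 \<le> n \<bullet> f (a + x)" "n \<bullet> f a = 0" "n \<bullet> f b = 0" "0 < n \<bullet> (f a \<times> f b)"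
    and n': "\<forall>x\<in>{0..1}. 0 \<le> n' \<bullet> f (c + x)" "n' \<bullet> f c = 0" "n' \<bullet> f d = 0" "0 < n' \<bullet> (f c \<times> f d)"
    and ord: "a < c" "c < b" "b < d" "d < a + 1"
  shows "n' \<bullet> f b = 0"
proof -
  let ?p = "f a" and ?q = "f c" and ?r = "f b" and ?s = "f d"
  define l where "l = (n \<bullet> (?p \<times> ?r)) / ((?p \<times> ?r) \<bullet> (?p \<times> ?r))"
  define l' where "l' = (n' \<bullet> (?q \<times> ?s)) / ((?q \<times> ?s) \<bullet> (?q \<times> ?s))"
  have ind: "?p \<times> ?r \<noteq> 0" "?q \<times> ?s \<noteq> 0" using independent ord by auto
  have l: "n = l *\<^sub>R (?p \<times> ?r)" unfolding l_def
    by (rule parallel_to_cross) (use n ind in auto)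
  have l': "n' = l' *\<^sub>R (?q \<times> ?s)" unfolding l'_def
    by (rule parallel_to_cross) (use n' ind in auto)
  have pos: "l > 0" "l' > 0" using n n' ind by (auto simp: l_def l'_def)
  have "0 \<le> n \<bullet> ?q" "0 \<le> n \<bullet> ?s"
    using bspec[OF n(1), of "c - a"] bspec[OF n(1), of "d - a"] ord by auto
  then have D1: "?p \<bullet> (?q \<times> ?r) \<le> 0" and D2: "0 \<le> ?p \<bullet> (?r \<times> ?s)"
  proof -
    have "n \<bullet> ?q = - l * (?p \<bullet> (?q \<times> ?r))" "n \<bullet> ?s = l * (?p \<bullet> (?r \<times> ?s))"
      by (subst l, simp add: cross3_simps)+
    with \<open>0 \<le> n \<bullet> ?q\<close> \<open>0 \<le> n \<bullet> ?s\<close> pos show "?p \<bullet> (?q \<times> ?r) \<le> 0" "0 \<le> ?p \<bullet> (?r \<times> ?s)"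
      by (auto simp: zero_le_mult_iff mult_le_0_iff)
  qed
  have "0 \<le> n' \<bullet> ?r" using bspec[OF n'(1), of "b - c"] ord by auto
  moreover have nr: "n' \<bullet> ?r = - l' * (?q \<bullet> (?r \<times> ?s))"
    by (subst l', simp add: cross3_simps)
  ultimately have D3: "?q \<bullet> (?r \<times> ?s) \<le> 0" using pos by (auto simp: mult_le_0_iff)
  obtain m where m: "m \<bullet> f b = 0" "0 < m \<bullet> f' b"
    "\<And>s. b < s \<Longrightarrow> s < b + 1 \<Longrightarrow> 0 < m \<bullet> f s"
    "\<And>s. b - 1 < s \<Longrightarrow> s < b \<Longrightarrow> m \<bullet> f s < 0"
    by (rule supportE[of "b"]) (rule that)
  have mm: "m \<bullet> ?p < 0" "m \<bullet> ?q < 0" "0 < m \<bullet> ?s" using m(3)[of d] m(4)[of a] m(4)[of c] ord by auto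
  have "m \<bullet> ((?q \<bullet> (?r \<times> ?s)) *\<^sub>R ?p - (?p \<bullet> (?r \<times> ?s)) *\<^sub>R ?q + (?p \<bullet> (?q \<times> ?s)) *\<^sub>R ?r
    - (?p \<bullet> (?q \<times> ?r)) *\<^sub>R ?s) = 0" by (simp only: four_point_relation) simp
  then have "(?q \<bullet> (?r \<times> ?s)) * (m \<bullet> ?p) - (?p \<bullet> (?r \<times> ?s)) * (m \<bullet> ?q)
     - (?p \<bullet> (?q \<times> ?r)) * (m \<bullet> ?s) = 0"
    using m(1) by (simp add: inner_diff_right inner_add_right)
  moreover have "0 \<le> (?q \<bullet> (?r \<times> ?s)) * (m \<bullet> ?p)" using D3 mm by (simp add: zero_le_mult_iff)
  moreover have "(?p \<bullet> (?r \<times> ?s)) * (m \<bullet> ?q) \<le> 0" using D2 mm by (simp add: mult_le_0_iff)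
  moreover have "(?p \<bullet> (?q \<times> ?r)) * (m \<bullet> ?s) \<le> 0" using D1 mm by (simp add: mult_le_0_iff)
  ultimately have "(?q \<bullet> (?r \<times> ?s)) * (m \<bullet> ?p) = 0" by linarith
  with mm nr show ?thesis by auto
qed

text \<open>Rotating at \<open>c\<close> produces a touching point \<open>d\<close> in
  \<open>]c, c + 1[\<close>; its position relative to \<open>b\<close> and \<open>a + 1\<close>
  decides which pair of parameters in \<open>[a, b]\<close> bounds the shorter chord.\<close>

lemma shorter_chord:
  assumes ch: "fwd_chord a b n" and n: "n \<noteq> 0" and ab: "a < b" "b < a + 1"
    and c: "a < c" "c < b" "\<not> pos_clean c"
  shows "\<exists>a' b' n'. n' \<noteq> 0 \<and> a \<le> a' \<and> a' < b' \<and> b' \<le> b \<and> b' - a' < b - a \<and>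
     (fwd_chord a' b' n' \<or> bwd_chord a' b' n')"
proof -
  obtain d n' where d: "c < d" "d < c + 1" and n'0: "n' \<noteq> 0"
    and n': "\<forall>x\<in>{0..1}. 0 \<le> n' \<bullet> f (c + x)" "n' \<bullet> f c = 0" "n' \<bullet> f d = 0" "0 < n' \<bullet> (f c \<times> f d)"
    by (rule support_tangent_exists[OF c(3)]) (rule that)
  have fwd: "fwd_chord c d n'" by (rule fwd_chordI) (use d n'0 n' in auto)
  consider "d \<le> b" | "a + 1 \<le> d" | "b < d" "d < a + 1" by linarith
  then show ?thesis
  proof cases
    case 1
    then show ?thesis using fwd n'0 c d by (intro exI[of _ c] exI[of _ d] exI[of _ n']) auto
  next
    case 2
    \<comment> \<open>Shifted back by 1, the tangent point lies in \<open>[a, c[\<close>. The sign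
      change of \<open>f\<close> and \<open>f'\<close> cancels in their cross product, so the same
      \<open>n'\<close> gives a backward chord.\<close>
    have "bwd_chord (d - 1) c n'"
      using fwd n' by (simp add: fwd_chord_def bwd_chord_def antiperiodic' deriv_antiperiodic')
    then show ?thesis using 2 n'0 c d by (intro exI[of _ "d - 1"] exI[of _ c] exI[of _ n']) auto
  next
    case 3
    \<comment> \<open>Here the chords interleave. The new line must then pass through
      \<open>f b\<close> as well, so \<open>b\<close> can take the place of
      \<open>d\<close>.\<close>
    obtain k where k: "k > 0" "f b \<times> f' b = k *\<^sub>R (f a \<times> f b)"
      by (rule tangent_direction_end[of n a b]) (use ch n ab in \<open>auto simp: fwd_chord_def\<close>)
    have "0 \<le> n \<bullet> (f a \<times> f b)" using ch k by (auto simp: fwd_chord_def zero_le_mult_iff)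
    moreover have "n \<bullet> (f a \<times> f b) \<noteq> 0"
      using parallel_to_cross[of n "f a" "f b"] ch n independent[OF ab] by (auto simp: fwd_chord_def)
    ultimately have pos: "0 < n \<bullet> (f a \<times> f b)" by simp
    have 0: "n' \<bullet> f b = 0"
      by (rule crossing_chords_collinear[of n a b n' c d])
         (use ch n' pos c 3 in \<open>auto simp: fwd_chord_def\<close>)
    obtain k where "k > 0" "f c \<times> f b = k *\<^sub>R (f c \<times> f d)"
      by (rule chord_direction[of n' c b d]) (use n' n'0 0 c d 3 ab in auto)
    then have "fwd_chord c b n'" by (intro fwd_chordI) (use n' n'0 0 c ab in auto)
    then show ?thesis using n'0 c by (intro exI[of _ c] exI[of _ b] exI[of _ n']) auto
  qed
qed

section \<open>Symmetries: time reversal and change of sign\<close>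

lemma reverse: "antiperiodic_curve (\<lambda>x. f (- x)) (\<lambda>x. - f' (- x))"
proof
  fix t
  have "((f \<circ> (\<lambda>x. - x)) has_vector_derivative (-1) *\<^sub>R f' (- t)) (at t)"
    by (rule vector_diff_chain_at) (auto intro!: derivative_eq_intros has_deriv)
  then show "((\<lambda>x. f (- x)) has_vector_derivative - f' (- t)) (at t)" by (simp add: o_def)
  show "f (- (t + 1)) = - f (- t)" using antiperiodic'[of "-t"] by simp
  show "f (- t) \<times> - f' (- t) \<noteq> 0" using regular by simp
  obtain m where m: "m \<bullet> f (-t) = 0" "0 < m \<bullet> f' (-t)"
    "\<And>s. -t < s \<Longrightarrow> s < -t + 1 \<Longrightarrow> 0 < m \<bullet> f s"
    "\<And>s. -t - 1 < s \<Longrightarrow> s < -t \<Longrightarrow> m \<bullet> f s < 0"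
    by (rule supportE[of "-t"]) (rule that)
  show "\<exists>m. m \<bullet> f (- t) = 0 \<and> 0 < m \<bullet> - f' (- t) \<and> (\<forall>s. t < s \<and> s < t + 1 \<longrightarrow> 0 < m \<bullet> f (- s))"
    using m by (intro exI[of _ "-m"]) auto
qed (intro continuous_intros)

text \<open>Replacing \<open>f\<close> by \<open>- f\<close> keeps \<open>f \<times> f'\<close> and
  negates its values on the arc, so positive and negative cleanness change places.\<close>

lemma negate: "antiperiodic_curve (\<lambda>x. - f x) (\<lambda>x. - f' x)"
proof
  fix t
  show "((\<lambda>x. - f x) has_vector_derivative - f' t) (at t)"
    by (intro has_vector_derivative_minus has_deriv)
  obtain m where m: "m \<bullet> f t = 0" "0 < m \<bullet> f' t"
    "\<And>s. t < s \<Longrightarrow> s < t + 1 \<Longrightarrow> 0 < m \<bullet> f s"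
    "\<And>s. t - 1 < s \<Longrightarrow> s < t \<Longrightarrow> m \<bullet> f s < 0"
    by (rule supportE[of "t"]) (rule that)
  from m(1-3) show "\<exists>m. m \<bullet> - f t = 0 \<and> 0 < m \<bullet> - f' t \<and> (\<forall>s. t < s \<and> s < t + 1 \<longrightarrow> 0 < m \<bullet> - f s)"
    by (intro exI[of _ "-m"]) auto
qed (use antiperiodic regular in \<open>auto intro!: continuous_intros\<close>)

text \<open>Reversal negates the tangent normal, and
  \<open>f (- (c + x)) = - f (- c + (1 - x))\<close> negates the values on the arc; the two signs
  cancel, while \<open>x\<close> becomes \<open>1 - x\<close>.\<close>

lemma pos_clean_reverse:
  "antiperiodic_curve.pos_clean (\<lambda>x. f (- x)) (\<lambda>x. - f' (- x)) c \<longleftrightarrow> pos_clean (- c)"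
proof -
  interpret rev: antiperiodic_curve "\<lambda>x. f (- x)" "\<lambda>x. - f' (- x)" by (rule reverse)
  have eq: "f (- (c + x)) = - f (- c + (1 - x))" for x using antiperiodic'[of "- c + (1 - x)"]
    by (simp add: algebra_simps)
  have "rev.pos_clean c \<longleftrightarrow> (\<forall>x\<in>{0..1}. 0 \<le> (f (-c) \<times> f' (-c)) \<bullet> f (- c + (1 - x)))"
    unfolding rev.pos_clean_def eq by simp
  also have "\<dots> \<longleftrightarrow> pos_clean (- c)" unfolding pos_clean_def
  proof (intro iffI ballI)
    fix x :: real assume *: "\<forall>x\<in>{0..1}. 0 \<le> (f (-c) \<times> f' (-c)) \<bullet> f (- c + (1 - x))" "x \<in> {0..1}"
    then have "1 - x \<in> {0..1}" by auto
    with *(1) have "0 \<le> (f (-c) \<times> f' (-c)) \<bullet> f (- c + (1 - (1 - x)))" by blast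
    then show "0 \<le> (f (-c) \<times> f' (-c)) \<bullet> f (- c + x)" by simp
  qed auto
  finally show ?thesis .
qed

text \<open>Reversal exchanges the crossing end with the tangent end. The functional changes sign
  because the reversed arc consists of the negated vectors.\<close>

lemma fwd_chord_reverse:
  "antiperiodic_curve.fwd_chord (\<lambda>x. f (- x)) (\<lambda>x. - f' (- x)) a b n \<longleftrightarrow> bwd_chord (- b) (- a) (- n)"
proof -
  interpret rev: antiperiodic_curve "\<lambda>x. f (- x)" "\<lambda>x. - f' (- x)" by (rule reverse)
  have eq: "f (- (c + x)) = - f (- c + (1 - x))" for c x using antiperiodic'[of "- c + (1 - x)"]
    by (simp add: algebra_simps)
  have refl: "(\<forall>x\<in>{0..1}. P (1 - x)) \<longleftrightarrow> (\<forall>x\<in>{0..1}. P x)" for P :: "real \<Rightarrow> bool"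
  proof (intro iffI ballI)
    fix x :: real assume *: "\<forall>x\<in>{0..1}. P (1 - x)" "x \<in> {0..1}"
    then have "1 - x \<in> {0..1}" by auto
    with *(1) have "P (1 - (1 - x))" by blast
    then show "P x" by simp
  qed auto
  have "(\<forall>x\<in>{0..1}. 0 \<le> n \<bullet> f (- (a + x))) \<longleftrightarrow> (\<forall>x\<in>{0..1}. 0 \<le> - n \<bullet> f (- a + x))"
    unfolding eq using refl[of "\<lambda>x. 0 \<le> - n \<bullet> f (- a + x)"] by simp
  then show ?thesis unfolding rev.fwd_chord_def bwd_chord_def by auto
qed

lemma bwd_chord_reverse:
  "antiperiodic_curve.bwd_chord (\<lambda>x. f (- x)) (\<lambda>x. - f' (- x)) a b n \<longleftrightarrow> fwd_chord (- b) (- a) (- n)"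
proof -
  interpret rev: antiperiodic_curve "\<lambda>x. f (- x)" "\<lambda>x. - f' (- x)" by (rule reverse)
  show ?thesis using rev.fwd_chord_reverse[of "-b" "-a" "-n"] by simp
qed

lemma shorter_chord':
  assumes ch: "bwd_chord a b n" and n: "n \<noteq> 0" and ab: "a < b" "b < a + 1"
    and c: "a < c" "c < b" "\<not> pos_clean c"
  shows "\<exists>a' b' n'. n' \<noteq> 0 \<and> a \<le> a' \<and> a' < b' \<and> b' \<le> b \<and> b' - a' < b - a \<and>
     (fwd_chord a' b' n' \<or> bwd_chord a' b' n')"
proof -
  interpret rev: antiperiodic_curve "\<lambda>x. f (- x)" "\<lambda>x. - f' (- x)" by (rule reverse)
  have "\<exists>a' b' n'. n' \<noteq> 0 \<and> -b \<le> a' \<and> a' < b' \<and> b' \<le> -a \<and> b' - a' < -a - -b \<and>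
     (rev.fwd_chord a' b' n' \<or> rev.bwd_chord a' b' n')"
    by (rule rev.shorter_chord[of "-b" "-a" "-n" "-c"])
       (use assms in \<open>auto simp: fwd_chord_reverse pos_clean_reverse\<close>)
  then obtain a' b' n' where "n' \<noteq> 0" "-b \<le> a'" "a' < b'" "b' \<le> -a" "b' - a' < -a - -b"
     "bwd_chord (-b') (-a') (-n') \<or> fwd_chord (-b') (-a') (-n')"
    by (auto simp: fwd_chord_reverse bwd_chord_reverse)
  then show ?thesis by (intro exI[of _ "-b'"] exI[of _ "-a'"] exI[of _ "-n'"]) auto
qed

section \<open>Compactness of the set of chords and the shortest chord\<close>

lemma fwd_chord_scale: "k > 0 \<Longrightarrow> fwd_chord a b (k *\<^sub>R n) \<longleftrightarrow> fwd_chord a b n"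
  by (simp add: fwd_chord_def zero_le_mult_iff)

lemma bwd_chord_scale: "k > 0 \<Longrightarrow> bwd_chord a b (k *\<^sub>R n) \<longleftrightarrow> bwd_chord a b n"
  by (simp add: bwd_chord_def zero_le_mult_iff)

lemma closed_nonneg_chord:
  assumes "continuous_on UNIV g" "continuous_on UNIV h"
  shows "closed {z :: 'a :: topological_space. \<forall>x\<in>{0..1}. 0 \<le> g z \<bullet> f (h z + x)}"
proof -
  have "{z. \<forall>x\<in>{0..1}. 0 \<le> g z \<bullet> f (h z + x)} = (\<Inter>x\<in>{0..1}. {z. 0 \<le> g z \<bullet> f (h z + x)})" by auto
  also have "closed \<dots>"
    by (intro closed_INT ballI closed_Collect_le continuous_intros assms)
  finally show ?thesis .
qed

lemma compact_chords:
  "compact {z. t \<le> fst z \<and> fst z \<le> fst (snd z) \<and> fst (snd z) \<le> s \<and> norm (snd (snd z)) = 1 \<and>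
     (fwd_chord (fst z) (fst (snd z)) (snd (snd z)) \<or> bwd_chord (fst z) (fst (snd z)) (snd (snd z)))}"
  (is "compact ?X")
proof -
  let ?K = "Sigma (cbox t s) (\<lambda>_. Sigma (cbox t s) (\<lambda>_. cball (0 :: real^3) 1))"
  have K: "compact (Sigma (cbox t s) (\<lambda>_. Sigma (cbox t s) (\<lambda>_. cball (0 :: real^3) 1)))"
    by (intro compact_Times) auto
  have sub: "?X \<subseteq> Sigma (cbox t s) (\<lambda>_. Sigma (cbox t s) (\<lambda>_. cball (0 :: real^3) 1))" by auto
  have g1: "continuous_on UNIV (\<lambda>z :: real \<times> real \<times> (real^3). f (fst z) \<times> f' (fst z))"
    by (rule continuous_on_cross) (intro continuous_intros)+
  have g2: "continuous_on UNIV (\<lambda>z :: real \<times> real \<times> (real^3). f (fst (snd z)) \<times> f' (fst (snd z)))"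
    by (rule continuous_on_cross) (intro continuous_intros)+
  have "closed ?X" unfolding fwd_chord_def bwd_chord_def
    by (intro closed_Collect_conj closed_Collect_disj closed_Collect_le closed_Collect_eq
        closed_nonneg_chord g1 g2 continuous_intros)
  then have "compact (?K \<inter> ?X)" by (rule compact_Int_closed[OF K])
  then show ?thesis by (simp only: Int_absorb1[OF sub])
qed

text \<open>A shortest chord of positive length could be shortened at its midpoint, which is not
  clean by assumption. At length 0 the functional is a positive multiple of
  \<open>f a \<times> f' a\<close>, so \<open>a\<close> is clean; it remains to see that
  \<open>a\<close> is neither \<open>t\<close> nor \<open>s\<close>.\<close>

theorem pos_clean_between:
  assumes ts: "t < s" "s < t + 1" and n: "\<forall>x\<in>{0..1}. 0 \<le> n \<bullet> f (t + x)"
    "n \<bullet> f t = 0" "0 < n \<bullet> f' t" "n \<bullet> f s = 0" "0 < n \<bullet> (f t \<times> f s)"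
  shows "\<exists>c. t < c \<and> c < s \<and> pos_clean c"
proof (rule ccontr)
  assume no: "\<not> ?thesis"
  let ?X = "{z. t \<le> fst z \<and> fst z \<le> fst (snd z) \<and> fst (snd z) \<le> s \<and> norm (snd (snd z)) = 1 \<and>
     (fwd_chord (fst z) (fst (snd z)) (snd (snd z)) \<or> bwd_chord (fst z) (fst (snd z)) (snd (snd z)))}"
  have n0: "n \<noteq> 0" using n by auto
  have XI: "(a, b, (1 / norm m) *\<^sub>R m) \<in> ?X"
    if "m \<noteq> 0" "t \<le> a" "a \<le> b" "b \<le> s" "fwd_chord a b m \<or> bwd_chord a b m" for a b m
    using that by (simp add: fwd_chord_scale bwd_chord_scale)
  have fwd: "fwd_chord t s n" by (rule fwd_chordI) (use ts n n0 in auto)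
  then have "?X \<noteq> {}" using XI[of n t s] n0 ts by force
  moreover have "continuous_on ?X (\<lambda>z. fst (snd z) - fst z)" by (intro continuous_intros)
  ultimately have "\<exists>z\<in>?X. \<forall>y\<in>?X. fst (snd z) - fst z \<le> fst (snd y) - fst y"
    by (rule continuous_attains_inf[OF compact_chords])
  then obtain z where z: "z \<in> ?X"
    "\<And>y. y \<in> ?X \<Longrightarrow> fst (snd z) - fst z \<le> fst (snd y) - fst y"
    by (elim bexE) (rule that, assumption, erule (1) bspec)
  obtain a b m where zeq: "z = (a, b, m)" using prod_cases3 by blast
  have abm: "t \<le> a" "a \<le> b" "b \<le> s" "norm m = 1" "fwd_chord a b m \<or> bwd_chord a b m"
    using z(1) by (auto simp: zeq)
  have m0: "m \<noteq> 0" using abm by auto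
  have "\<not> a < b"
  proof
    assume ab: "a < b"
    then have c: "a < (a + b) / 2" "(a + b) / 2 < b" by auto
    then have "\<not> pos_clean ((a + b) / 2)" using no abm by force
    moreover have "b < a + 1" using abm ts by simp
    ultimately obtain a' b' n' where "n' \<noteq> 0" "a \<le> a'" "a' < b'" "b' \<le> b" "b' - a' < b - a"
      "fwd_chord a' b' n' \<or> bwd_chord a' b' n'"
      using abm(5) m0 ab c shorter_chord[of a b m "(a+b)/2"] shorter_chord'[of a b m "(a+b)/2"] by blast
    then show False using z(2)[OF XI[of n' a' b']] abm by (simp add: zeq)
  qed
  then have ab: "a = b" using abm by simp
  have m: "m \<bullet> f a = 0" "m \<bullet> f' a = 0" "0 \<le> m \<bullet> (f a \<times> f' a)" "\<forall>x\<in>{0..1}. 0 \<le> m \<bullet> f (a + x)"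
    using abm(5) unfolding ab fwd_chord_def bwd_chord_def by auto
  define g where "g = f a \<times> f' a"
  define k where "k = (m \<bullet> g) / (g \<bullet> g)"
  have mk: "m = k *\<^sub>R g" unfolding k_def g_def by (rule parallel_to_cross) (use m regular in auto)
  have "k \<ge> 0" using m(3) by (simp add: k_def g_def)
  then have k: "k > 0" using mk m0 by (auto simp: less_le)
  have clean: "\<forall>x\<in>{0..1}. 0 \<le> g \<bullet> f (a + x)" using m(4) k by (simp add: mk zero_le_mult_iff)
  then have "pos_clean a" by (simp add: pos_clean_def g_def)
  then have "a = t \<or> a = s" using no abm ab by (auto simp: less_le)
  then show False
  proof
    \<comment> \<open>\<open>n\<close> is a positive multiple of \<open>f t \<times> f s\<close>, so
      \<open>0 < n \<bullet> f' t\<close> forces \<open>g \<bullet> f s < 0\<close>, against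
      cleanness of \<open>t\<close>.\<close>
    assume at: "a = t"
    define u where "u = f t \<times> f s"
    have u: "n = ((n \<bullet> u) / (u \<bullet> u)) *\<^sub>R u" unfolding u_def
      by (rule parallel_to_cross) (use n independent ts in auto)
    have "(n \<bullet> u) / (u \<bullet> u) > 0" using n(5) independent[OF ts] by (simp add: u_def)
    moreover have "n \<bullet> f' t = ((n \<bullet> u) / (u \<bullet> u)) * (u \<bullet> f' t)" by (metis u inner_scaleR_left)
    ultimately have "0 < u \<bullet> f' t" using n(3) by (metis zero_less_mult_pos)
    moreover have "u \<bullet> f' t = - (g \<bullet> f s)" by (simp add: u_def g_def at cross3_simps)
    moreover have "0 \<le> g \<bullet> f s" using bspec[OF clean, of "s - t"] at ts by simp
    ultimately show False by simp
  next
    \<comment> \<open>Here \<open>n\<close> is \<open>l\<close> times \<open>g\<close>, and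
      \<open>g\<close> is nonnegative over \<open>[s, s + 1]\<close>. This interval contains
      \<open>t + 1\<close> in its interior, where \<open>n \<bullet> f\<close> changes sign, so
      \<open>l\<close> would have both signs.\<close>
    assume as: "a = s"
    have d: "n \<bullet> f' s = 0" by (rule deriv_zero_at_min[of _ t]) (use ts n in auto)
    define l where "l = (n \<bullet> g) / (g \<bullet> g)"
    have nl: "n = l *\<^sub>R g" unfolding l_def g_def as by (rule parallel_to_cross) (use n d regular in auto)
    have sgn: "0 \<le> g \<bullet> f y" if "s \<le> y" "y \<le> s + 1" for y
      using bspec[OF clean, of "y - s"] that by (simp add: as)
    obtain e where e: "e > 0" "\<And>y. t < y \<Longrightarrow> y < t + e \<Longrightarrow> 0 < n \<bullet> f y"
      by (rule dot_pos_after[OF n(2,3)]) (rule that)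
    define e' where "e' = min (e / 2) ((s - t) / 2)"
    have e': "e' > 0" "e' < e" "t + e' < s" using e ts by (auto simp: e'_def min_def field_simps)
    have 1: "n \<bullet> f (t + e') > 0" using e e' by auto
    have "0 \<le> g \<bullet> f (t + e' + 1)" using e' ts by (intro sgn) auto
    then have "l < 0" using 1 nl by (auto simp: antiperiodic zero_less_mult_iff)
    interpret rev: antiperiodic_curve "\<lambda>x. f (- x)" "\<lambda>x. - f' (- x)" by (rule reverse)
    have "n \<bullet> f (- (- t - 1)) = 0" "0 < n \<bullet> - f' (- (- t - 1))"
      using n antiperiodic[of t] deriv_antiperiodic[of t] by (auto simp: add.commute)
    from rev.dot_pos_after[OF this] obtain e where
      e: "e > 0" "\<And>y. - t - 1 < y \<Longrightarrow> y < - t - 1 + e \<Longrightarrow> 0 < n \<bullet> f (- y)" by blast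
    define e' where "e' = min (e / 2) ((t + 1 - s) / 2)"
    have e': "e' > 0" "e' < e" "s < t + 1 - e'" using e ts by (auto simp: e'_def min_def field_simps)
    have 1: "n \<bullet> f (t + 1 - e') > 0" using e(2)[of "- t - 1 + e'"] e' by (simp add: algebra_simps)
    have "0 \<le> g \<bullet> f (t + 1 - e')" using e' ts by (intro sgn) auto
    then have "0 < l" using 1 nl by (auto simp: zero_less_mult_iff)
    with \<open>l < 0\<close> show False by simp
  qed
qed

section \<open>Three clean points in a period\<close>

definition clean :: "real \<Rightarrow> bool" where
  "clean c \<longleftrightarrow> pos_clean c \<or> neg_clean c"

lemma clean_shift: "clean (c + 1) \<longleftrightarrow> clean c"
proof -
  have eq: "f (c + 1 + x) = - f (c + x)" for x
    using antiperiodic[of "c + x"] by (simp add: algebra_simps)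
  show ?thesis
    unfolding clean_def pos_clean_def neg_clean_def eq antiperiodic deriv_antiperiodic by auto
qed

lemma pos_clean_negate:
  "antiperiodic_curve.pos_clean (\<lambda>x. - f x) (\<lambda>x. - f' x) c \<longleftrightarrow> neg_clean c"
proof -
  interpret neg: antiperiodic_curve "\<lambda>x. - f x" "\<lambda>x. - f' x" by (rule negate)
  show ?thesis unfolding neg.pos_clean_def neg_clean_def by simp
qed

lemma clean_reverse:
  "antiperiodic_curve.clean (\<lambda>x. f (- x)) (\<lambda>x. - f' (- x)) c \<longleftrightarrow> clean (- c)"
proof -
  interpret rev: antiperiodic_curve "\<lambda>x. f (- x)" "\<lambda>x. - f' (- x)" by (rule reverse)
  interpret neg: antiperiodic_curve "\<lambda>x. - f x" "\<lambda>x. - f' x" by (rule negate)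
  show ?thesis
    unfolding clean_def rev.clean_def rev.pos_clean_negate[symmetric] pos_clean_negate[symmetric]
    using neg.pos_clean_reverse[of c] pos_clean_reverse[of c] by simp
qed

text \<open>No orientation is prescribed: \<open>n\<close> does not vanish on
  \<open>f t \<times> f s\<close>, and if the sign is negative, \<open>- n\<close> is a chord of the
  right orientation for the curve \<open>- f\<close>.\<close>

lemma clean_between:
  assumes ts: "t < s" "s < t + 1" and n: "\<forall>x\<in>{0..1}. 0 \<le> n \<bullet> f (t + x)"
    "n \<bullet> f t = 0" "0 < n \<bullet> f' t" "n \<bullet> f s = 0"
  shows "\<exists>c. t < c \<and> c < s \<and> clean c"
proof -
  have "n \<bullet> (f t \<times> f s) \<noteq> 0"
    using parallel_to_cross[OF n(2,4) independent[OF ts]] n(3) by auto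
  then consider "0 < n \<bullet> (f t \<times> f s)" | "0 < - n \<bullet> (f t \<times> f s)" by fastforce
  then show ?thesis
  proof cases
    case 1
    then show ?thesis using pos_clean_between[OF ts n] by (auto simp: clean_def)
  next
    case 2
    interpret neg: antiperiodic_curve "\<lambda>x. - f x" "\<lambda>x. - f' x" by (rule negate)
    have "\<exists>c. t < c \<and> c < s \<and> neg.pos_clean c"
      by (rule neg.pos_clean_between[of t s "- n"]) (use ts n 2 in auto)
    then show ?thesis by (auto simp: pos_clean_negate clean_def)
  qed
qed

text \<open>Read backwards, the arc from \<open>s\<close> to \<open>t + 1\<close> is the initial arc
  of the reversed curve started at \<open>- (t + 1)\<close>. The same \<open>n\<close> serves, since
  its line changes sides at \<open>t + 1\<close> as it does at \<open>t\<close>.\<close>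

lemma clean_between':
  assumes ts: "t < s" "s < t + 1" and n: "\<forall>x\<in>{0..1}. 0 \<le> n \<bullet> f (t + x)"
    "n \<bullet> f t = 0" "0 < n \<bullet> f' t" "n \<bullet> f s = 0"
  shows "\<exists>c. s < c \<and> c < t + 1 \<and> clean c"
proof -
  interpret rev: antiperiodic_curve "\<lambda>x. f (- x)" "\<lambda>x. - f' (- x)" by (rule reverse)
  have "f (1 + t) = - f t" "f' (1 + t) = - f' t"
    using antiperiodic[of t] deriv_antiperiodic[of t] by (simp_all add: add.commute)
  moreover have "0 \<le> n \<bullet> f (- (- (t + 1) + x))" if "x \<in> {0..1}" for x
    using bspec[OF n(1), of "1 - x"] that by (simp add: algebra_simps)
  ultimately have "\<exists>c. - (t + 1) < c \<and> c < - s \<and> rev.clean c"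
    by (intro rev.clean_between[of "- (t + 1)" "- s" n]) (use ts n in \<open>simp_all\<close>)
  then obtain c where "- (t + 1) < c" "c < - s" "clean (- c)" by (auto simp: clean_reverse)
  then show ?thesis by (intro exI[of _ "- c"]) auto
qed

text \<open>Failing one of the two signs suffices: the curve or its negative then has a line through
  \<open>f t\<close> touching at some \<open>s\<close>, and this one chord yields a clean point on
  either side of \<open>s\<close>.\<close>

lemma clean_on_both_sides:
  assumes "\<not> (pos_clean t \<and> neg_clean t)"
  obtains c d where "t < c" "c < d" "d < t + 1" "clean c" "clean d"
proof -
  obtain s n where ts: "t < s" "s < t + 1" and n: "\<forall>x\<in>{0..1}. 0 \<le> n \<bullet> f (t + x)"
    "n \<bullet> f t = 0" "0 < n \<bullet> f' t" "n \<bullet> f s = 0"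
  proof (cases "pos_clean t")
    case False
    then show ?thesis by (rule support_tangent_exists) (rule that)
  next
    case True
    interpret neg: antiperiodic_curve "\<lambda>x. - f x" "\<lambda>x. - f' x" by (rule negate)
    have "\<not> neg.pos_clean t" using assms True by (simp add: pos_clean_negate)
    then obtain s n where "t < s" "s < t + 1" "\<forall>x\<in>{0..1}. 0 \<le> n \<bullet> - f (t + x)"
    "n \<bullet> - f t = 0" "0 < n \<bullet> - f' t" "n \<bullet> - f s = 0" by (rule neg.support_tangent_exists)
    then show ?thesis by (intro that[of s "- n"]) auto
  qed
  obtain c where c: "t < c" "c < s" "clean c" using clean_between[OF ts n] by blast
  obtain d where d: "s < d" "d < t + 1" "clean d" using clean_between'[OF ts n] by blast
  show ?thesis by (rule that[of c d]) (use c d in auto)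
qed

text \<open>The application at 0 only provides a clean \<open>a\<close>; the one at \<open>a\<close>
  adds the other two.\<close>

theorem three_clean:
  assumes "\<And>t. \<not> (pos_clean t \<and> neg_clean t)"
  obtains a b c where "a < b" "b < c" "c < a + 1" "clean a" "clean b" "clean c"
proof -
  obtain a d where "clean a" by (rule clean_on_both_sides[OF assms[of 0]])
  moreover obtain b c where "a < b" "b < c" "c < a + 1" "clean b" "clean c"
    by (rule clean_on_both_sides[OF assms[of a]])
  ultimately show ?thesis by (intro that)
qed

end

section \<open>The curve as a graph near its tangent line\<close>

lemma open_superset_of_interval:
  fixes W :: "real set"
  assumes "open W" "{c..d} \<subseteq> W" "c \<le> d"
  obtains e where "e > 0" "{c - e..d + e} \<subseteq> W"
proof -
  have "c \<in> W" "d \<in> W" using assms by auto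
  then obtain e1 e2 where e: "e1 > 0" "ball c e1 \<subseteq> W" "e2 > 0" "ball d e2 \<subseteq> W"
    using assms(1) unfolding open_contains_ball by meson
  define e where "e = min e1 e2 / 2"
  have "x \<in> W" if "c - e \<le> x" "x \<le> d + e" for x
  proof -
    consider "x < c" | "x \<in> {c..d}" | "d < x" by fastforce
    then show ?thesis
    proof cases
      case 1
      then have "x \<in> ball c e1" using that e by (auto simp: dist_real_def e_def)
      then show ?thesis using e by blast
    next
      case 2 then show ?thesis using assms by blast
    next
      case 3
      then have "x \<in> ball d e2" using that e by (auto simp: dist_real_def e_def)
      then show ?thesis using e by blast
    qed
  qed
  moreover have "e > 0" using e by (simp add: e_def)
  ultimately show ?thesis by (intro that[of e]) auto
qed

lemma norm_cross_le: "norm (a \<times> b) \<le> norm a * norm b"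
proof (rule power2_le_imp_le)
  show "(norm (a \<times> b))\<^sup>2 \<le> (norm a * norm b)\<^sup>2"
    using norm_cross_dot[of a b] zero_le_power2[of "a \<bullet> b"] by linarith
qed simp

lemma chart_point_eq:
  assumes "v \<times> q = 0" "m \<bullet> v = 1" "q \<noteq> (0 :: real^3)"
  shows "m \<bullet> q \<noteq> 0" "v = (1 / (m \<bullet> q)) *\<^sub>R q"
proof -
  have "m \<times> (v \<times> q) = (m \<bullet> q) *\<^sub>R v - q" using assms(2) by (simp only: Lagrange) simp
  then have eq: "(m \<bullet> q) *\<^sub>R v = q" using assms(1) by simp
  then show nz: "m \<bullet> q \<noteq> 0" using assms(3) by auto
  have "(1 / (m \<bullet> q)) *\<^sub>R q = (1 / (m \<bullet> q)) *\<^sub>R ((m \<bullet> q) *\<^sub>R v)" using eq by simp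
  then show "v = (1 / (m \<bullet> q)) *\<^sub>R q" using nz by simp
qed

text \<open>The functionals \<open>m\<close>, \<open>\<xi>\<close>, \<open>n\<close> are independent
  because their determinant \<open>D\<close> is \<open>\<tau>\<close> times the squared norm of
  \<open>m \<times> n\<close>. The dual basis given by Cramer's rule provides \<open>p\<close>,
  \<open>w\<close>, \<open>u\<close>, so \<open>(x, y)\<close> are affine coordinates on the
  chart.\<close>

lemma dual_coordinates:
  fixes m n \<xi> :: "real^3"
  assumes mn: "m \<times> n \<noteq> 0" and \<tau>: "\<tau> \<noteq> 0" "\<xi> = \<tau> *\<^sub>R (m \<times> n)"
  obtains p w u :: "real^3" where
    "\<And>v x y. m \<bullet> v = 1 \<and> \<xi> \<bullet> v = x \<and> n \<bullet> v = y \<longleftrightarrow> v = p + x *\<^sub>R w + y *\<^sub>R u"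
proof -
  define D where "D = m \<bullet> (n \<times> \<xi>)"
  have "m \<bullet> (n \<times> (m \<times> n)) = (m \<times> n) \<bullet> (m \<times> n)" by (simp add: cross3_simps)
  then have D: "D \<noteq> 0" using \<tau> mn by (auto simp: D_def cross_mult_right)
  have id: "D *\<^sub>R v = (m \<bullet> v) *\<^sub>R (n \<times> \<xi>) + (\<xi> \<bullet> v) *\<^sub>R (m \<times> n) + (n \<bullet> v) *\<^sub>R (\<xi> \<times> m)" for v
    by (simp add: D_def vec_eq_iff forall_3 cross3_def inner_vec_def sum_3 algebra_simps)
  show ?thesis
  proof (rule that[of "(1 / D) *\<^sub>R (n \<times> \<xi>)" "(1 / D) *\<^sub>R (m \<times> n)" "(1 / D) *\<^sub>R (\<xi> \<times> m)"])
    fix v x y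
    show "m \<bullet> v = 1 \<and> \<xi> \<bullet> v = x \<and> n \<bullet> v = y \<longleftrightarrow>
      v = (1 / D) *\<^sub>R (n \<times> \<xi>) + x *\<^sub>R ((1 / D) *\<^sub>R (m \<times> n)) + y *\<^sub>R ((1 / D) *\<^sub>R (\<xi> \<times> m))" (is "?l \<longleftrightarrow> v = ?r")
    proof
      assume l: ?l
      have "v = (1 / D) *\<^sub>R (D *\<^sub>R v)" using D by simp
      also have "\<dots> = ?r" unfolding id[of v] using l by (simp add: scaleR_add_right mult.commute)
      finally show "v = ?r" .
    next
      have "m \<bullet> (n \<times> \<xi>) = D" "\<xi> \<bullet> (m \<times> n) = D" "n \<bullet> (\<xi> \<times> m) = D"
        by (simp_all add: D_def cross3_simps)
      moreover assume "v = ?r"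
      ultimately show ?l using D by (simp add: inner_add_right dot_cross_self)
    qed
  qed
qed

context antiperiodic_curve
begin

lemma shift_int: "f (s + of_int k) = (if even k then f s else - f s)"
  by (rule antiperiodic_add_int[of f, OF antiperiodic])

lemma reduce_mod_1:
  obtains s' where "a \<le> s'" "s' < a + 1" "f s' = f s \<or> f s' = - f s"
proof
  let ?k = "- \<lfloor>s - a\<rfloor>"
  show "a \<le> s + of_int ?k" "s + of_int ?k < a + 1" by (simp, linarith)+
  show "f (s + of_int ?k) = f s \<or> f (s + of_int ?k) = - f s" by (metis shift_int)
qed

text \<open>Central projection to the affine plane \<open>m \<bullet> v = 1\<close>. If
  \<open>m \<bullet> f s = 0\<close>, the point lies at infinity, and division by zero makes the
  value 0.\<close>

definition chart :: "real^3 \<Rightarrow> real \<Rightarrow> real^3" where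
  "chart m s = (1 / (m \<bullet> f s)) *\<^sub>R f s"

lemma dot_chart: "v \<bullet> chart m s = (v \<bullet> f s) / (m \<bullet> f s)"
  by (simp add: chart_def)

lemma chart_cross: "chart m s \<times> f s = 0"
  by (simp add: chart_def cross_mult_left)

lemma continuous_on_chart:
  assumes "\<And>s. s \<in> S \<Longrightarrow> m \<bullet> f s \<noteq> 0"
  shows "continuous_on S (chart m)"
  unfolding chart_def by (intro continuous_intros cont) (use assms in auto)

lemma chart_unique:
  assumes "v \<times> f s = 0" "m \<bullet> v = 1"
  shows "m \<bullet> f s \<noteq> 0" "v = chart m s"
  using chart_point_eq[OF assms nonzero] by (auto simp: chart_def)

text \<open>The numerator in the quotient rule is a determinant of pairings, which the Binet-Cauchy
  identity turns into \<open>(m \<times> \<xi>) \<bullet> (f s \<times> f' s)\<close>.\<close>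

lemma dot_chart_strict_mono:
  assumes "\<And>s. s \<in> {a..b} \<Longrightarrow> m \<bullet> f s > 0"
    and "\<And>s. s \<in> {a..b} \<Longrightarrow> 0 < (m \<times> \<xi>) \<bullet> (f s \<times> f' s)"
  shows "strict_mono_on {a..b} (\<lambda>s. \<xi> \<bullet> chart m s)"
proof (rule strict_mono_onI)
  fix x y assume xy: "x \<in> {a..b}" "y \<in> {a..b}" "x < y"
  show "\<xi> \<bullet> chart m x < \<xi> \<bullet> chart m y"
  proof (rule DERIV_pos_imp_increasing[OF xy(3)])
    fix s assume s: "x \<le> s" "s \<le> y"
    then have s': "s \<in> {a..b}" using xy by auto
    have "((\<lambda>s. (\<xi> \<bullet> f s) / (m \<bullet> f s)) has_real_derivative
        ((\<xi> \<bullet> f' s) * (m \<bullet> f s) - (\<xi> \<bullet> f s) * (m \<bullet> f' s)) / ((m \<bullet> f s) * (m \<bullet> f s))) (at s)"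
      using assms(1)[OF s'] by (intro DERIV_divide dot_deriv) auto
    moreover have "(\<xi> \<bullet> f' s) * (m \<bullet> f s) - (\<xi> \<bullet> f s) * (m \<bullet> f' s) = (m \<times> \<xi>) \<bullet> (f s \<times> f' s)"
      by (simp add: dot_cross)
    ultimately show "\<exists>D. ((\<lambda>s. \<xi> \<bullet> chart m s) has_real_derivative D) (at s) \<and> 0 < D"
      unfolding dot_chart using assms(1,2)[OF s']
      by - (rule exI, rule conjI, assumption, simp add: zero_less_divide_iff)
  qed
qed

text \<open>The coordinates \<open>(\<xi> \<bullet> v, n \<bullet> v)\<close> on the chart \<open>m \<bullet> v = 1\<close> come from the dual basis of
  \<open>(m, \<xi>, n)\<close>, where \<open>\<xi>\<close> is \<open>m \<times> n\<close> up to a sign that makes the curve run forward.\<close>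

lemma forward_coordinate:
  assumes "n \<noteq> 0" "c \<le> d"
    and z: "\<And>s. s \<in> {c..d} \<Longrightarrow> n \<bullet> f s = 0 \<and> n \<bullet> f' s = 0"
    and m: "\<And>s. s \<in> {c..d} \<Longrightarrow> 0 < m \<bullet> f s"
  obtains \<xi> p w u :: "real^3" where
    "\<And>v x y. m \<bullet> v = 1 \<and> \<xi> \<bullet> v = x \<and> n \<bullet> v = y \<longleftrightarrow> v = p + x *\<^sub>R w + y *\<^sub>R u"
    "\<And>s. s \<in> {c..d} \<Longrightarrow> 0 < (m \<times> \<xi>) \<bullet> (f s \<times> f' s)"
proof -
  define \<zeta> where "\<zeta> = m \<times> n"
  have "f c \<times> \<zeta> = (f c \<bullet> n) *\<^sub>R m - (f c \<bullet> m) *\<^sub>R n" unfolding \<zeta>_def by (rule Lagrange)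
  then have "f c \<times> \<zeta> = - (m \<bullet> f c) *\<^sub>R n" using z[of c] assms(2) by (simp add: inner_commute)
  then have \<zeta>: "\<zeta> \<noteq> 0" using m[of c] assms(1,2) by (auto simp del: scaleR_minus_left)
  \<comment> \<open>\<open>N\<close> is the numerator of the derivative of the coordinate
    \<open>\<zeta>\<close>. On \<open>[c, d]\<close> the tangent normal is parallel to
    \<open>n\<close>, and \<open>(m \<times> \<zeta>) \<bullet> n = - (\<zeta> \<bullet>
    \<zeta>)\<close>, so \<open>N\<close> has no zero and keeps its sign.\<close>
  define N where "N = (\<lambda>s. (m \<times> \<zeta>) \<bullet> (f s \<times> f' s))"
  have N0: "N s \<noteq> 0" if s: "s \<in> {c..d}" for s
  proof -
    let ?g = "f s \<times> f' s"
    define k where "k = (n \<bullet> ?g) / (?g \<bullet> ?g)"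
    have k: "n = k *\<^sub>R ?g" unfolding k_def by (rule parallel_to_cross) (use z s regular in auto)
    have "(m \<times> \<zeta>) \<bullet> n = - (\<zeta> \<bullet> \<zeta>)" by (simp add: \<zeta>_def cross3_simps)
    moreover have "(m \<times> \<zeta>) \<bullet> n = k * N s" unfolding N_def by (subst k) simp
    ultimately show ?thesis using \<zeta> by auto
  qed
  have contN: "continuous_on {c..d} N" unfolding N_def
    by (intro continuous_intros continuous_on_cross cont continuous_on_subset[OF cont_deriv]) auto
  have "(\<forall>s\<in>{c..d}. 0 < N s) \<or> (\<forall>s\<in>{c..d}. N s < 0)"
  proof (rule ccontr)
    assume "\<not> ?thesis"
    then obtain x y where xy: "x \<in> {c..d}" "N x \<le> 0" "y \<in> {c..d}" "0 \<le> N y" by (auto simp: not_less)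
    have "connected (N ` {c..d})" by (intro connected_continuous_image contN) auto
    then have "0 \<in> N ` {c..d}" using xy by (auto simp: connected_iff_interval)
    then show False using N0 by force
  qed
  then obtain \<tau> :: real where \<tau>: "\<tau> = 1 \<or> \<tau> = -1" "\<And>s. s \<in> {c..d} \<Longrightarrow> 0 < \<tau> * N s"
    by (elim disjE) (rule that[of 1], simp, simp, rule that[of "-1"], auto)
  define \<xi> where "\<xi> = \<tau> *\<^sub>R \<zeta>"
  have "m \<times> n \<noteq> 0" "\<tau> \<noteq> 0" using \<zeta> \<tau>(1) by (auto simp: \<zeta>_def)
  then obtain p w u where
    "\<And>v x y. m \<bullet> v = 1 \<and> \<xi> \<bullet> v = x \<and> n \<bullet> v = y \<longleftrightarrow> v = p + x *\<^sub>R w + y *\<^sub>R u"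
    by (rule dual_coordinates[where \<xi> = \<xi>]) (auto simp: \<xi>_def \<zeta>_def)
  moreover have "0 < (m \<times> \<xi>) \<bullet> (f s \<times> f' s)" if "s \<in> {c..d}" for s
    using \<tau>(2)[OF that] by (simp add: \<xi>_def N_def cross_mult_right)
  ultimately show ?thesis by (rule that)
qed

end

text \<open>A rectangle of the chart \<open>m \<bullet> v = 1\<close> in which the curve is the graph of \<open>h\<close> over the line
  \<open>n \<bullet> v = 0\<close>.\<close>

locale graph_box = antiperiodic_curve +
  fixes n m \<xi> p w u :: "real^3" and a b \<epsilon> :: real and h :: "real \<Rightarrow> real"
  assumes coords: "\<And>v x y. m \<bullet> v = 1 \<and> \<xi> \<bullet> v = x \<and> n \<bullet> v = y \<longleftrightarrow> v = p + x *\<^sub>R w + y *\<^sub>R u"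
    and ab: "a < b"
    and chart_pos: "\<And>s. s \<in> {a..b} \<Longrightarrow> 0 < m \<bullet> f s"
    and mono: "strict_mono_on {a..b} (\<lambda>s. \<xi> \<bullet> chart m s)"
    and graph: "\<And>s. s \<in> {a..b} \<Longrightarrow> h (\<xi> \<bullet> chart m s) = n \<bullet> chart m s"
    and cont_h: "continuous_on {\<xi> \<bullet> chart m a..\<xi> \<bullet> chart m b} h"
    and small: "\<And>x. x \<in> {\<xi> \<bullet> chart m a..\<xi> \<bullet> chart m b} \<Longrightarrow> \<bar>h x\<bar> < \<epsilon>"
    and on_curve: "\<And>v. m \<bullet> v = 1 \<Longrightarrow> \<xi> \<bullet> chart m a < \<xi> \<bullet> v \<Longrightarrow> \<xi> \<bullet> v < \<xi> \<bullet> chart m b \<Longrightarrow>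
      \<bar>n \<bullet> v\<bar> < \<epsilon> \<Longrightarrow> (\<exists>s. v \<times> f s = 0) \<longleftrightarrow> n \<bullet> v = h (\<xi> \<bullet> v)"
begin

definition X :: "real \<Rightarrow> real" where "X s = \<xi> \<bullet> chart m s"

definition box :: "(real^3) set" where
  "box = {v. m \<bullet> v = 1 \<and> X a < \<xi> \<bullet> v \<and> \<xi> \<bullet> v < X b \<and> \<bar>n \<bullet> v\<bar> < \<epsilon>}"

definition above :: "(real^3) set" where "above = {v \<in> box. h (\<xi> \<bullet> v) < n \<bullet> v}"
definition below :: "(real^3) set" where "below = {v \<in> box. n \<bullet> v < h (\<xi> \<bullet> v)}"

lemma X_mono: "s \<in> {a..b} \<Longrightarrow> t \<in> {a..b} \<Longrightarrow> s < t \<Longrightarrow> X s < X t"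
  using mono by (auto simp: X_def strict_mono_on_def)

lemma X_mono_iff: "s \<in> {a..b} \<Longrightarrow> t \<in> {a..b} \<Longrightarrow> X s < X t \<longleftrightarrow> s < t"
  using X_mono[of s t] X_mono[of t s] by (cases s t rule: linorder_cases) auto

lemma X_surj:
  assumes "s \<in> {a..b}" "t \<in> {a..b}" "X s \<le> x" "x \<le> X t"
  obtains r where "s \<le> r" "r \<le> t" "X r = x"
proof -
  have "s \<le> t" using assms X_mono[of t s] by (meson not_le order.trans leD)
  moreover have "continuous_on {s..t} X" unfolding X_def
    by (intro continuous_intros continuous_on_chart) (use assms chart_pos in \<open>auto simp: less_le\<close>)
  ultimately show ?thesis using IVT'[of X s x t] assms that by auto
qed

lemma eps_pos: "0 < \<epsilon>"
  using small[of "X a"] X_mono[of a b] ab by (auto simp: X_def)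

text \<open>Linear interpolation between the two graphs makes the strip a continuous image of a
  rectangle. The box and both of its sides are strips of this kind.\<close>

lemma connected_strip:
  assumes "continuous_on {X a<..<X b} l" "continuous_on {X a<..<X b} k"
    and lk: "\<And>x. x \<in> {X a<..<X b} \<Longrightarrow> l x < k x"
  shows "connected {v. m \<bullet> v = 1 \<and> X a < \<xi> \<bullet> v \<and> \<xi> \<bullet> v < X b \<and> l (\<xi> \<bullet> v) < n \<bullet> v \<and> n \<bullet> v < k (\<xi> \<bullet> v)}"
    (is "connected ?S")
proof -
  let ?D = "Sigma {X a<..<X b} (\<lambda>_. {0<..<1 :: real})"
  let ?F = "\<lambda>z. p + fst z *\<^sub>R w + (l (fst z) + snd z * (k (fst z) - l (fst z))) *\<^sub>R u"
  have c: "m \<bullet> (p + x *\<^sub>R w + y *\<^sub>R u) = 1" "\<xi> \<bullet> (p + x *\<^sub>R w + y *\<^sub>R u) = x"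
    "n \<bullet> (p + x *\<^sub>R w + y *\<^sub>R u) = y" for x y
    using coords[of "p + x *\<^sub>R w + y *\<^sub>R u" x y] by auto
  have "?S = ?F ` ?D"
  proof (intro equalityI subsetI)
    fix v assume v: "v \<in> ?S"
    define x y where "x = \<xi> \<bullet> v" and "y = (n \<bullet> v - l x) / (k x - l x)"
    have x: "x \<in> {X a<..<X b}" "l x < n \<bullet> v" "n \<bullet> v < k x" using v by (auto simp: x_def)
    then have "(x, y) \<in> ?D" by (auto simp: y_def divide_simps)
    moreover have "v = ?F (x, y)" using coords[of v x "n \<bullet> v"] v x by (auto simp: x_def y_def)
    ultimately show "v \<in> ?F ` ?D" by blast
  next
    fix v assume "v \<in> ?F ` ?D"
    then obtain x y where v: "x \<in> {X a<..<X b}" "0 < y" "y < 1"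
      "v = p + x *\<^sub>R w + (l x + y * (k x - l x)) *\<^sub>R u" by auto
    have "0 < y * (k x - l x)" "y * (k x - l x) < 1 * (k x - l x)"
      using v lk[OF v(1)] by (auto intro: mult_strict_right_mono)
    then show "v \<in> ?S" using v(1) unfolding v(4) mem_Collect_eq c by auto
  qed
  moreover have "connected (?F ` ?D)"
  proof (rule connected_continuous_image)
    have "convex ?D" by (intro convex_Times) auto
    then show "connected ?D" by (rule convex_connected)
    have sub: "fst ` ?D \<subseteq> {X a<..<X b}" by auto
    show "continuous_on ?D ?F"
      by (intro continuous_intros continuous_on_compose2[OF assms(1) _ sub]
          continuous_on_compose2[OF assms(2) _ sub])
  qed
  ultimately show ?thesis by simp
qed

lemma cont_h': "continuous_on {X a<..<X b} h"
  by (rule continuous_on_subset[OF cont_h]) (auto simp: X_def)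

lemma small': "x \<in> {X a<..<X b} \<Longrightarrow> \<bar>h x\<bar> < \<epsilon>"
  using small[of x] by (auto simp: X_def)

lemma connected_box: "connected box"
proof -
  have "box = {v. m \<bullet> v = 1 \<and> X a < \<xi> \<bullet> v \<and> \<xi> \<bullet> v < X b \<and> - \<epsilon> < n \<bullet> v \<and> n \<bullet> v < \<epsilon>}"
    by (auto simp: box_def)
  then show ?thesis using connected_strip[of "\<lambda>_. - \<epsilon>" "\<lambda>_. \<epsilon>"] eps_pos by simp
qed

lemma connected_above: "connected above"
proof -
  have "above = {v. m \<bullet> v = 1 \<and> X a < \<xi> \<bullet> v \<and> \<xi> \<bullet> v < X b \<and> h (\<xi> \<bullet> v) < n \<bullet> v \<and> n \<bullet> v < \<epsilon>}"
    using small' by (force simp: above_def box_def)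
  then show ?thesis using connected_strip[of h "\<lambda>_. \<epsilon>"] cont_h' small' by (simp add: abs_less_iff)
qed

lemma connected_below: "connected below"
proof -
  have "below = {v. m \<bullet> v = 1 \<and> X a < \<xi> \<bullet> v \<and> \<xi> \<bullet> v < X b \<and> - \<epsilon> < n \<bullet> v \<and> n \<bullet> v < h (\<xi> \<bullet> v)}"
    using small' by (force simp: below_def box_def)
  then show ?thesis using connected_strip[of "\<lambda>_. - \<epsilon>" h] cont_h' small'
    by (simp add: abs_less_iff minus_less_iff)
qed

lemma box_minus_curve: "box - {v. m \<bullet> v = 1 \<and> (\<exists>s. v \<times> f s = 0)} = above \<union> below"
  using on_curve by (fastforce simp: above_def below_def box_def X_def)

lemma open_box_part:
  assumes "continuous_on {X a<..<X b} l"
  shows "openin (top_of_set (affine_chart m)) {v \<in> box. l (\<xi> \<bullet> v) < n \<bullet> v}"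
    "openin (top_of_set (affine_chart m)) {v \<in> box. n \<bullet> v < l (\<xi> \<bullet> v)}"
proof -
  define O' where "O' = {v. X a < \<xi> \<bullet> v \<and> \<xi> \<bullet> v < X b \<and> \<bar>n \<bullet> v\<bar> < \<epsilon>}"
  have O': "open O'" unfolding O'_def
    by (intro open_Collect_conj open_Collect_less continuous_intros)
  have c: "continuous_on O' (\<lambda>v. l (\<xi> \<bullet> v) - n \<bullet> v)"
    by (intro continuous_intros continuous_on_compose2[OF assms]) (auto simp: O'_def)
  have 1: "open (O' \<inter> (\<lambda>v. l (\<xi> \<bullet> v) - n \<bullet> v) -` {..<0})"
    by (rule continuous_open_preimage[OF c O']) auto
  have 2: "open (O' \<inter> (\<lambda>v. l (\<xi> \<bullet> v) - n \<bullet> v) -` {0<..})"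
    by (rule continuous_open_preimage[OF c O']) auto
  have "{v \<in> box. l (\<xi> \<bullet> v) < n \<bullet> v} = affine_chart m \<inter> (O' \<inter> (\<lambda>v. l (\<xi> \<bullet> v) - n \<bullet> v) -` {..<0})"
    by (auto simp: box_def O'_def affine_chart_def)
  then show "openin (top_of_set (affine_chart m)) {v \<in> box. l (\<xi> \<bullet> v) < n \<bullet> v}"
    using 1 by (simp add: openin_open_Int)
  have "{v \<in> box. n \<bullet> v < l (\<xi> \<bullet> v)} = affine_chart m \<inter> (O' \<inter> (\<lambda>v. l (\<xi> \<bullet> v) - n \<bullet> v) -` {0<..})"
    by (auto simp: box_def O'_def affine_chart_def)
  then show "openin (top_of_set (affine_chart m)) {v \<in> box. n \<bullet> v < l (\<xi> \<bullet> v)}"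
    using 2 by (simp add: openin_open_Int)
qed

lemma open_above: "openin (top_of_set (affine_chart m)) above"
  and open_below: "openin (top_of_set (affine_chart m)) below"
  unfolding above_def below_def by (intro open_box_part cont_h')+

lemma open_box: "openin (top_of_set (affine_chart m)) box"
proof -
  have "box = {v \<in> box. - \<epsilon> < n \<bullet> v}" by (auto simp: box_def)
  then show ?thesis using open_box_part(1)[of "\<lambda>_. - \<epsilon>"] by simp
qed

end

context antiperiodic_curve
begin

section \<open>Existence of a box around an arc of zeros\<close>

text \<open>This keeps remote parts of the curve out of the box. The distance of
  \<open>chart m x\<close> from the line spanned by \<open>f s\<close> is
  \<open>norm (chart m x \<times> f s) / norm (f s)\<close>, which is positive and attains its
  minimum on a compact product.\<close>

lemma chart_separation:
  assumes "compact K" "compact K'" "K \<noteq> {}" "K' \<noteq> {}"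
    and ind: "\<And>s x. s \<in> K \<Longrightarrow> x \<in> K' \<Longrightarrow> f x \<times> f s \<noteq> 0"
    and m: "\<And>x. x \<in> K' \<Longrightarrow> m \<bullet> f x \<noteq> 0"
  obtains \<eta> where "\<eta> > 0" "\<And>s x v. s \<in> K \<Longrightarrow> x \<in> K' \<Longrightarrow> v \<times> f s = 0 \<Longrightarrow> \<eta> \<le> norm (v - chart m x)"
proof -
  let ?S = "Sigma K (\<lambda>_. K')"
  define F where "F = (\<lambda>z. norm (chart m (snd z) \<times> f (fst z)) / norm (f (fst z)))"
  have c: "continuous_on ?S (\<lambda>z. chart m (snd z))"
    by (rule continuous_on_compose2[OF continuous_on_chart[of K' m]]) (use m in \<open>auto intro: continuous_intros\<close>)
  have cont: "continuous_on ?S F" unfolding F_def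
    by (intro continuous_intros continuous_on_cross c) (use nonzero in auto)
  have "compact ?S" using assms by (intro compact_Times)
  moreover have "?S \<noteq> {}" using assms by auto
  ultimately have "\<exists>z\<in>?S. \<forall>y\<in>?S. F z \<le> F y" using cont by (rule continuous_attains_inf)
  then obtain z where z: "z \<in> ?S" "\<And>y. y \<in> ?S \<Longrightarrow> F z \<le> F y"
    by (elim bexE) (rule that, assumption, erule (1) bspec)
  show ?thesis
  proof (rule that[of "F z"])
    have "chart m (snd z) \<times> f (fst z) \<noteq> 0"
      unfolding chart_def using z ind[of "fst z" "snd z"] m[of "snd z"] by (auto simp: cross_mult_left)
    then show "0 < F z" by (simp add: F_def nonzero)
  next
    fix s x v assume *: "s \<in> K" "x \<in> K'" "v \<times> f s = 0"
    have "F z \<le> F (s, x)" using * by (intro z(2)) auto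
    also have "\<dots> = norm ((v - chart m x) \<times> f s) / norm (f s)"
      using *(3) by (simp add: F_def Cross3.left_diff_distrib)
    also have "\<dots> \<le> norm (v - chart m x)"
      using norm_cross_le[of "v - chart m x" "f s"] nonzero[of s] by (simp add: divide_le_eq)
    finally show "F z \<le> norm (v - chart m x)" .
  qed
qed

text \<open>The box must also fit into a prescribed open set \<open>E\<close>, and its parameters
  into \<open>]c - r, d + r[\<close>. The choices are nested: inside \<open>W\<close> the coordinate
  \<open>\<xi>\<close> increases, \<open>\<eta>\<close> bounds the distance to the rest of the
  period, and \<open>\<epsilon>\<close> is small compared with \<open>\<eta>\<close> and with the
  radius \<open>\<rho>\<close> available in \<open>E\<close>.\<close>

lemma graph_box_exists:
  assumes n: "n \<noteq> 0" and cd: "c \<le> d" "d < c + 1"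
    and z: "\<And>s. s \<in> {c..d} \<Longrightarrow> n \<bullet> f s = 0 \<and> n \<bullet> f' s = 0"
    and m: "\<And>s. s \<in> {c..d} \<Longrightarrow> 0 < m \<bullet> f s"
    and E: "open E" "\<And>s. s \<in> {c..d} \<Longrightarrow> chart m s \<in> E" and r: "r > 0"
  obtains \<xi> p w u a b \<epsilon> h where "graph_box f f' n m \<xi> p w u a b \<epsilon> h" "a < c" "d < b" "c - r < a" "b < d + r"
    "\<And>v. m \<bullet> v = 1 \<Longrightarrow> \<xi> \<bullet> chart m a < \<xi> \<bullet> v \<Longrightarrow> \<xi> \<bullet> v < \<xi> \<bullet> chart m b \<Longrightarrow> \<bar>n \<bullet> v\<bar> < \<epsilon> \<Longrightarrow> v \<in> E"
proof -
  obtain \<xi> p w u where coords: "\<And>v x y. m \<bullet> v = 1 \<and> \<xi> \<bullet> v = x \<and> n \<bullet> v = y \<longleftrightarrow> v = p + x *\<^sub>R w + y *\<^sub>R u"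
    and fw: "\<And>s. s \<in> {c..d} \<Longrightarrow> 0 < (m \<times> \<xi>) \<bullet> (f s \<times> f' s)"
    by (rule forward_coordinate[OF n cd(1)], erule z, erule m) (rule that)
  \<comment> \<open>Half of what \<open>[c, d]\<close> lacks to a full period, so that the enlarged
    interval does not overlap its translates.\<close>
  define \<kappa> where "\<kappa> = (1 - (d - c)) / 2"
  have \<kappa>: "0 < \<kappa>" "d + \<kappa> = c - \<kappa> + 1" using cd by (auto simp: \<kappa>_def field_simps)
  define W where "W = {s. 0 < m \<bullet> f s} \<inter> {s. 0 < (m \<times> \<xi>) \<bullet> (f s \<times> f' s)} \<inter> {c - \<kappa><..<d + \<kappa>}"
  have W: "open W" unfolding W_def
    by (intro open_Int open_Collect_less continuous_intros continuous_on_cross cont cont_deriv open_greaterThanLessThan)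
  have cW: "continuous_on W (chart m)" by (rule continuous_on_chart) (auto simp: W_def)
  have "compact (chart m ` {c..d})"
    by (intro compact_continuous_image continuous_on_chart) (use m in \<open>auto simp: less_le\<close>)
  moreover have "chart m ` {c..d} \<subseteq> E" using E by auto
  ultimately obtain \<rho> where \<rho>: "\<rho> > 0" "(\<Union>x\<in>chart m ` {c..d}. ball x \<rho>) \<subseteq> E"
    by (rule compact_subset_open_imp_ball_epsilon_subset[OF _ E(1)])
  \<comment> \<open>Half of the radius \<open>\<rho>\<close>; the other half is reserved for the
    vertical extent of the box.\<close>
  define N where "N = (\<Union>x\<in>chart m ` {c..d}. ball x (\<rho> / 2))"
  define W2 where "W2 = W \<inter> chart m -` N"
  have "open W2" unfolding W2_def N_def by (intro continuous_open_preimage cW W) auto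
  moreover have "{c..d} \<subseteq> W2"
  proof
    fix s assume s: "s \<in> {c..d}"
    then have "s \<in> W" using m[OF s] fw[OF s] \<kappa>(1) unfolding W_def by auto
    moreover have "chart m s \<in> N" unfolding N_def using s \<rho>(1) by (intro UN_I[of "chart m s"]) auto
    ultimately show "s \<in> W2" unfolding W2_def by blast
  qed
  ultimately obtain \<delta> where \<delta>: "\<delta> > 0" "{c - \<delta>..d + \<delta>} \<subseteq> W2"
    by (rule open_superset_of_interval[OF _ _ cd(1)])
  have "c - \<delta> \<in> W" "d + \<delta> \<in> W" using \<delta> cd by (auto simp: W2_def)
  then have "c - \<kappa> < c - \<delta>" "d + \<delta> < d + \<kappa>" unfolding W_def by auto
  then have \<delta>1: "d + \<delta> < c - \<delta> + 1" using \<kappa> by linarith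
  have Wpos: "0 < m \<bullet> f s" "0 < (m \<times> \<xi>) \<bullet> (f s \<times> f' s)" "chart m s \<in> N" if "s \<in> {c - \<delta>..d + \<delta>}" for s
    using \<delta>(2) that by (auto simp: W2_def W_def)
  have mono: "strict_mono_on {c - \<delta>..d + \<delta>} (\<lambda>s. \<xi> \<bullet> chart m s)"
    by (rule dot_chart_strict_mono) (use Wpos in auto)
  \<comment> \<open>Shrinking by \<open>\<delta> / 2\<close> makes \<open>K'\<close> disjoint from
    the remaining parameters \<open>[d + \<delta>, c - \<delta> + 1]\<close> even up to a shift by
    1.\<close>
  define K' where "K' = {c - \<delta> / 2..d + \<delta> / 2}"
  obtain \<eta> where \<eta>: "\<eta> > 0"
    "\<And>s x v. s \<in> {d + \<delta>..c - \<delta> + 1} \<Longrightarrow> x \<in> K' \<Longrightarrow> v \<times> f s = 0 \<Longrightarrow> \<eta> \<le> norm (v - chart m x)"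
  proof (rule chart_separation[of "{d + \<delta>..c - \<delta> + 1}" K' m])
    show "m \<bullet> f x \<noteq> 0" if "x \<in> K'" for x using Wpos(1)[of x] that \<delta>(1) by (auto simp: K'_def)
    show "f x \<times> f s \<noteq> 0" if "s \<in> {d + \<delta>..c - \<delta> + 1}" "x \<in> K'" for s x
      by (rule independent) (use that \<delta>(1) in \<open>auto simp: K'_def\<close>)
  qed (use \<delta>(1) \<delta>1 cd in \<open>auto simp: K'_def\<close>)
  \<comment> \<open>A point of the box differs from the curve point with the same coordinate
    \<open>\<xi>\<close> by at most \<open>2 * \<epsilon> * norm u\<close>; the summand 1 keeps the
    denominator positive.\<close>
  define \<epsilon> where "\<epsilon> = min (\<rho> / 2) \<eta> / (2 * (norm u + 1))"
  have eps: "\<epsilon> > 0" using \<rho> \<eta> by (auto simp: \<epsilon>_def intro!: divide_pos_pos add_nonneg_pos)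
  have "2 * \<epsilon> * (norm u + 1) = min (\<rho> / 2) \<eta>"
    using add_nonneg_pos[OF norm_ge_zero[of u] zero_less_one] unfolding \<epsilon>_def
    by (simp del: distrib_left_numeral add: field_simps)
  then have eps2: "2 * \<epsilon> * norm u < \<rho> / 2" "2 * \<epsilon> * norm u < \<eta>" using eps by (auto simp: algebra_simps)
  define W3 where "W3 = {c - \<delta> / 2<..<d + \<delta> / 2} \<inter> {c - r<..<d + r} \<inter> (W \<inter> chart m -` {v. \<bar>n \<bullet> v\<bar> < \<epsilon>})"
  have "open (W \<inter> chart m -` {v. \<bar>n \<bullet> v\<bar> < \<epsilon>})"
    by (intro continuous_open_preimage cW W open_Collect_less continuous_intros)
  then have "open W3" unfolding W3_def
    by (rule open_Int[OF open_Int[OF open_greaterThanLessThan open_greaterThanLessThan]])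
  moreover have "{c..d} \<subseteq> W3"
  proof
    fix s assume s: "s \<in> {c..d}"
    then have "s \<in> W" using m[OF s] fw[OF s] \<kappa>(1) unfolding W_def by auto
    then show "s \<in> W3" unfolding W3_def using z[OF s] s \<delta>(1) r eps by (auto simp: dot_chart)
  qed
  ultimately obtain e where e: "e > 0" "{c - e..d + e} \<subseteq> W3"
    by (rule open_superset_of_interval[OF _ _ cd(1)])
  define a b where "a = c - e" and "b = d + e"
  have abW: "{a..b} \<subseteq> W3" using e by (simp add: a_def b_def)
  have ab: "a < b" "a < c" "d < b" using e cd by (auto simp: a_def b_def)
  have "a \<in> W3" "b \<in> W3" using ab(1) by (auto intro!: subsetD[OF abW])
  then have abr: "c - r < a" "b < d + r" "c - \<delta> / 2 < a" "b < d + \<delta> / 2" unfolding W3_def by simp_all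
  then have sub: "{a..b} \<subseteq> {c - \<delta>..d + \<delta>}" "{a..b} \<subseteq> K'" using \<delta>(1) by (auto simp: K'_def)
  define X where "X = (\<lambda>s. \<xi> \<bullet> chart m s)"
  have Xmono: "X s < X t" if "s \<in> {c - \<delta>..d + \<delta>}" "t \<in> {c - \<delta>..d + \<delta>}" "s < t" for s t
    using mono that by (auto simp: X_def strict_mono_on_def)
  have inj: "inj_on X {a..b}"
    unfolding X_def using inj_on_subset[OF strict_mono_on_imp_inj_on[OF mono] sub(1)] .
  have contc: "continuous_on {a..b} (chart m)"
    by (rule continuous_on_chart) (use Wpos(1) sub in \<open>auto simp: less_le\<close>)
  have contX: "continuous_on {a..b} X" unfolding X_def by (intro continuous_intros contc)
  have Xim: "X ` {a..b} = {X a..X b}"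
  proof (intro equalityI subsetI)
    fix x assume "x \<in> X ` {a..b}"
    then obtain s where s: "s \<in> {a..b}" "x = X s" by auto
    then have "s = a \<or> X a < X s" "s = b \<or> X s < X b"
      using Xmono[of a s] Xmono[of s b] subsetD[OF sub(1)] ab(1)
      by (metis atLeastAtMost_iff order.order_iff_strict)+
    then have "X a \<le> X s" "X s \<le> X b" by auto
    then show "x \<in> {X a..X b}" using s by simp
  next
    fix x assume "x \<in> {X a..X b}"
    then obtain s where "a \<le> s" "s \<le> b" "X s = x" using IVT'[of X a x b] contX ab by auto
    then show "x \<in> X ` {a..b}" by auto
  qed
  define h where "h = (\<lambda>x. n \<bullet> chart m (inv_into {a..b} X x))"
  have hX: "h (X s) = n \<bullet> chart m s" if "s \<in> {a..b}" for s
    using inj that by (simp add: h_def)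
  have cinv: "continuous_on {X a..X b} (inv_into {a..b} X)"
    unfolding Xim[symmetric] by (rule continuous_on_inv[OF contX]) (use inj in auto)
  have cont_h: "continuous_on {X a..X b} h" unfolding h_def
    by (intro continuous_intros continuous_on_compose2[OF contc cinv])
       (simp only: Xim[symmetric], blast intro: inv_into_into)
  have small: "\<bar>n \<bullet> chart m s\<bar> < \<epsilon>" if "s \<in> {a..b}" for s
    using that abW by (auto simp: W3_def)
  \<comment> \<open>The two points lie on one vertical segment, in direction \<open>u\<close>, and
    both have height less than \<open>\<epsilon>\<close> in absolute value.\<close>
  have near: "\<exists>s. a < s \<and> s < b \<and> X s = \<xi> \<bullet> v \<and> v - chart m s = (n \<bullet> v - h (\<xi> \<bullet> v)) *\<^sub>R u \<and>
      norm (v - chart m s) \<le> 2 * \<epsilon> * norm u"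
    if v: "m \<bullet> v = 1" "X a < \<xi> \<bullet> v" "\<xi> \<bullet> v < X b" "\<bar>n \<bullet> v\<bar> < \<epsilon>" for v
  proof -
    have "\<xi> \<bullet> v \<in> X ` {a..b}" unfolding Xim using v by auto
    then obtain s where s: "s \<in> {a..b}" "X s = \<xi> \<bullet> v" by auto
    then have "s \<noteq> a" "s \<noteq> b" using v by auto
    then have s': "a < s" "s < b" using s by auto
    have ms: "m \<bullet> f s > 0" using Wpos(1)[of s] s sub by auto
    then have "m \<bullet> chart m s = 1" by (simp add: dot_chart)
    then have "chart m s = p + X s *\<^sub>R w + (n \<bullet> chart m s) *\<^sub>R u"
      using coords[of "chart m s" "X s" "n \<bullet> chart m s"] unfolding X_def by blast
    moreover have "v = p + X s *\<^sub>R w + (n \<bullet> v) *\<^sub>R u"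
      using coords[of v "X s" "n \<bullet> v"] v(1) s(2) by metis
    ultimately have eq: "v - chart m s = (n \<bullet> v - h (\<xi> \<bullet> v)) *\<^sub>R u"
      using hX[OF s(1)] s(2) by (metis add_diff_cancel_left scaleR_left_diff_distrib)
    have "\<bar>n \<bullet> v - h (\<xi> \<bullet> v)\<bar> \<le> 2 * \<epsilon>" using small[OF s(1)] hX[OF s(1)] s(2) v by auto
    then have "norm (v - chart m s) \<le> 2 * \<epsilon> * norm u" unfolding eq by (simp add: mult_right_mono)
    with s s' eq show ?thesis by blast
  qed
  show ?thesis
  proof (rule that)
    show "graph_box f f' n m \<xi> p w u a b \<epsilon> h"
    proof
      fix v x y show "(m \<bullet> v = 1 \<and> \<xi> \<bullet> v = x \<and> n \<bullet> v = y) = (v = p + x *\<^sub>R w + y *\<^sub>R u)"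
        by (rule coords)
    next
      fix v assume v: "m \<bullet> v = 1" "\<xi> \<bullet> chart m a < \<xi> \<bullet> v" "\<xi> \<bullet> v < \<xi> \<bullet> chart m b" "\<bar>n \<bullet> v\<bar> < \<epsilon>"
      then obtain s where s: "a < s" "s < b" "X s = \<xi> \<bullet> v" "v - chart m s = (n \<bullet> v - h (\<xi> \<bullet> v)) *\<^sub>R u"
          "norm (v - chart m s) \<le> 2 * \<epsilon> * norm u"
        using near[of v] unfolding X_def by blast
      show "(\<exists>s. v \<times> f s = 0) \<longleftrightarrow> n \<bullet> v = h (\<xi> \<bullet> v)"
      proof
        assume "n \<bullet> v = h (\<xi> \<bullet> v)"
        then have "v = chart m s" using s(4) by simp
        then show "\<exists>s. v \<times> f s = 0" using chart_cross by blast
      next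
        assume "\<exists>s. v \<times> f s = 0"
        then obtain t0 where t0: "v \<times> f t0 = 0" by blast
        \<comment> \<open>Every curve point has a parameter in the period from
          \<open>c - \<delta>\<close>. If it is at most \<open>d + \<delta>\<close>, the coordinate
          \<open>\<xi>\<close> identifies it with \<open>s\<close>; otherwise the point is too far
          away for the box.\<close>
        obtain t where t: "c - \<delta> \<le> t" "t < c - \<delta> + 1" "f t = f t0 \<or> f t = - f t0"
          by (rule reduce_mod_1[of "c - \<delta>" t0]) (rule that)
        then have vt: "v \<times> f t = 0" using t0 by auto
        show "n \<bullet> v = h (\<xi> \<bullet> v)"
        proof (cases "t \<le> d + \<delta>")
          case True
          have "v = chart m t" using chart_unique(2)[OF vt v(1)] .
          then have "X s = X t" using s(3) by (simp add: X_def)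
          moreover have "s \<in> {c - \<delta>..d + \<delta>}" using s sub(1) by auto
          ultimately have "s = t" using Xmono[of s t] Xmono[of t s] True t
            by (cases s t rule: linorder_cases) auto
          then show ?thesis using \<open>v = chart m t\<close> hX[of s] s by (simp add: X_def)
        next
          case False
          then have "\<eta> \<le> norm (v - chart m s)"
            using t vt s sub(2) by (intro \<eta>(2)[of t]) auto
          then show ?thesis using s(5) eps2(2) by simp
        qed
      qed
    next
      show "a < b" by (rule ab)
      show "strict_mono_on {a..b} (\<lambda>s. \<xi> \<bullet> chart m s)"
        by (rule monotone_on_subset[OF mono sub(1)])
      show "continuous_on {\<xi> \<bullet> chart m a..\<xi> \<bullet> chart m b} h" using cont_h by (simp add: X_def)
    next
      fix s assume s: "s \<in> {a..b}"
      show "0 < m \<bullet> f s" using Wpos(1) sub(1) s by blast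
      show "h (\<xi> \<bullet> chart m s) = n \<bullet> chart m s" using hX[OF s] by (simp add: X_def)
    next
      fix x assume "x \<in> {\<xi> \<bullet> chart m a..\<xi> \<bullet> chart m b}"
      then have "x \<in> X ` {a..b}" unfolding Xim by (simp add: X_def)
      then obtain s where "s \<in> {a..b}" "x = X s" by blast
      then show "\<bar>h x\<bar> < \<epsilon>" using small[of s] hX[of s] by simp
    qed
  next
    fix v assume v: "m \<bullet> v = 1" "\<xi> \<bullet> chart m a < \<xi> \<bullet> v" "\<xi> \<bullet> v < \<xi> \<bullet> chart m b" "\<bar>n \<bullet> v\<bar> < \<epsilon>"
    then obtain s where s: "a < s" "s < b" "norm (v - chart m s) \<le> 2 * \<epsilon> * norm u"
      using near[of v] unfolding X_def by blast
    have "chart m s \<in> N" using Wpos(3)[of s] s sub by auto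
    then obtain x where x: "x \<in> chart m ` {c..d}" "dist x (chart m s) < \<rho> / 2" by (auto simp: N_def)
    have "dist (chart m s) v < \<rho> / 2" using s eps2 by (simp add: dist_norm norm_minus_commute)
    then have "dist x v < \<rho>" using x(2) dist_triangle[of x v "chart m s"] by (simp add: dist_commute)
    then have "v \<in> ball x \<rho>" by simp
    with x(1) show "v \<in> E" by (intro subsetD[OF \<rho>(2)] UN_I)
  qed (use ab abr in auto)
qed

end

section \<open>Crossings with a line\<close>

lemma components_two:
  assumes "connected A" "connected B" "A \<noteq> {}" "B \<noteq> {}"
    and U: "open U" "A \<subseteq> U" "B \<inter> U = {}" and V: "open V" "B \<subseteq> V" "A \<inter> V = {}"
  shows "components (A \<union> B) = {A, B}"
proof -
  have 1: "A \<in> components (A \<union> B)"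
    if "connected A" "A \<noteq> {}" "open U" "A \<subseteq> U" "B \<inter> U = {}" "open V" "B \<subseteq> V" "A \<inter> V = {}" for A B U V :: "'a set"
    unfolding in_components_maximal
  proof (intro conjI allI impI)
    fix D assume D: "D \<noteq> {} \<and> A \<subseteq> D \<and> D \<subseteq> A \<union> B \<and> connected D"
    have "U \<inter> D = {} \<or> V \<inter> D = {}"
      by (rule connectedD[of D U V]) (use D that in blast)+
    with that D have "V \<inter> D = {}" by blast
    with that D show "D = A" by blast
  qed (use that in auto)
  have A: "A \<in> components (A \<union> B)" by (rule 1) (use assms in auto)
  have "B \<in> components (B \<union> A)" by (rule 1) (use assms in auto)
  then have B: "B \<in> components (A \<union> B)" by (simp add: Un_commute)
  have "C = A \<or> C = B" if C: "C \<in> components (A \<union> B)" for C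
  proof -
    have "C \<noteq> {}" "C \<subseteq> A \<union> B"
      using in_components_nonempty[OF C] in_components_subset[OF C] by auto
    then have "C \<inter> A \<noteq> {} \<or> C \<inter> B \<noteq> {}" by blast
    then show ?thesis using components_eq[OF C A] components_eq[OF C B] by blast
  qed
  with A B show ?thesis by blast
qed

lemma closed_arcD:
  assumes "closed_arc K"
  shows "compact K" "connected K" "K \<noteq> {}"
  using assms by (auto simp: closed_arc_def compact_path_image connected_path_image arc_imp_path)

definition line_in :: "real^3 \<Rightarrow> real^3 \<Rightarrow> (real^3) set" where
  "line_in m n = {v. m \<bullet> v = 1 \<and> n \<bullet> v = 0}"

lemma line_image_Icc:
  fixes p w :: "'a :: real_vector"
  assumes "x \<le> y"
  shows "(\<lambda>t. p + t *\<^sub>R w) ` {x..y} = closed_segment (p + x *\<^sub>R w) (p + y *\<^sub>R w)"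
proof -
  have "(1 - t) *\<^sub>R (p + x *\<^sub>R w) + t *\<^sub>R (p + y *\<^sub>R w) = p + ((1 - t) *\<^sub>R x + t *\<^sub>R y) *\<^sub>R w" for t
    by (simp add: algebra_simps)
  then have "closed_segment (p + x *\<^sub>R w) (p + y *\<^sub>R w) = (\<lambda>t. p + t *\<^sub>R w) ` closed_segment x y"
    unfolding closed_segment_def by auto
  then show ?thesis using assms by (simp add: closed_segment_eq_real_ivl)
qed

text \<open>The coordinate \<open>\<xi>\<close> embeds the line into the reals, where compact
  connected sets are intervals. Within a line, closed arcs are thus the nonempty compact connected
  sets, the form in which maximality is exploited.\<close>

lemma connected_compact_in_line_closed_arc:
  assumes coords: "\<And>v x y. m \<bullet> v = 1 \<and> \<xi> \<bullet> v = x \<and> n \<bullet> v = y \<longleftrightarrow> v = p + x *\<^sub>R w + y *\<^sub>R u"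
    and K: "K \<subseteq> line_in m n" "compact K" "connected K" "K \<noteq> {}"
  shows "closed_arc K"
proof -
  let ?L = "\<lambda>x. p + x *\<^sub>R w"
  have L: "v = ?L (\<xi> \<bullet> v)" if "v \<in> K" for v
    using coords[of v "\<xi> \<bullet> v" 0] subsetD[OF K(1) that] by (simp add: line_in_def)
  have \<xi>L: "\<xi> \<bullet> ?L x = x" for x using coords[of "?L x" x 0] by simp
  have c: "continuous_on K (\<lambda>v. \<xi> \<bullet> v)" by (intro continuous_intros)
  have "connected ((\<lambda>v. \<xi> \<bullet> v) ` K) \<and> compact ((\<lambda>v. \<xi> \<bullet> v) ` K)"
    using connected_continuous_image[OF c K(3)] compact_continuous_image[OF c K(2)] by (rule conjI)
  then have "\<exists>x y. (\<lambda>v. \<xi> \<bullet> v) ` K = {x..y}" by (rule iffD1[OF connected_compact_interval_1])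
  then obtain x y where xy: "(\<lambda>v. \<xi> \<bullet> v) ` K = {x..y}" by (elim exE) (rule that)
  moreover have "(\<lambda>v. \<xi> \<bullet> v) ` K \<noteq> {}" using K(4) by simp
  ultimately have "{x..y} \<noteq> {}" by (simp only:) simp
  then have "x \<le> y" by simp
  have "K = ?L ` (\<lambda>v. \<xi> \<bullet> v) ` K"
  proof (intro equalityI subsetI)
    fix v assume "v \<in> K" then show "v \<in> ?L ` (\<lambda>v. \<xi> \<bullet> v) ` K" using L by (intro image_eqI) auto
  next
    fix v assume "v \<in> ?L ` (\<lambda>v. \<xi> \<bullet> v) ` K"
    then obtain v' where "v' \<in> K" "v = ?L (\<xi> \<bullet> v')" by blast
    then show "v \<in> K" using L[of v'] by simp
  qed
  then have seg: "K = closed_segment (?L x) (?L y)" unfolding xy line_image_Icc[OF \<open>x \<le> y\<close>] .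
  show ?thesis
  proof (cases "x = y")
    case True then show ?thesis using seg by (auto simp: closed_arc_def)
  next
    case False
    then have "?L x \<noteq> ?L y" using \<xi>L[of x] \<xi>L[of y] by auto
    then have "arc (linepath (?L x) (?L y))" by (rule arc_linepath)
    moreover have "K = path_image (linepath (?L x) (?L y))" using seg by simp
    ultimately show ?thesis unfolding closed_arc_def by blast
  qed
qed

context antiperiodic_curve
begin

text \<open>Equality of spans is expressed by a vanishing cross product, which makes no difference
  between \<open>f s\<close> and \<open>- f s\<close>.\<close>

definition curve_in :: "real^3 \<Rightarrow> (real^3) set" where
  "curve_in m = {v. m \<bullet> v = 1 \<and> (\<exists>s. v \<times> f s = 0)}"

lemma chart_in_curve: "m \<bullet> f s \<noteq> 0 \<Longrightarrow> chart m s \<in> curve_in m"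
  using chart_cross[of m s] by (auto simp: curve_in_def dot_chart)

lemma chart_in_line: "m \<bullet> f s \<noteq> 0 \<Longrightarrow> n \<bullet> f s = 0 \<Longrightarrow> chart m s \<in> line_in m n"
  by (simp add: line_in_def dot_chart)

end

section \<open>An arc of zeros inside a box\<close>

text \<open>Zeros of \<open>n \<bullet> f\<close> outside \<open>[c, d]\<close> may accumulate at
  both ends, so maximality is stated by nonzero values arbitrarily near, of unspecified
  sign.\<close>

locale zero_box = graph_box +
  fixes c d :: real
  assumes cd: "a < c" "c \<le> d" "d < b"
    and zero: "\<And>s. s \<in> {c..d} \<Longrightarrow> n \<bullet> f s = 0"
    and right_max: "\<And>e. e > 0 \<Longrightarrow> \<exists>s. d < s \<and> s < d + e \<and> n \<bullet> f s \<noteq> 0"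
    and left_max: "\<And>e. e > 0 \<Longrightarrow> \<exists>s. c - e < s \<and> s < c \<and> n \<bullet> f s \<noteq> 0"
begin

lemma cd_in: "a \<in> {a..b}" "b \<in> {a..b}" "c \<in> {a..b}" "d \<in> {a..b}"
  using cd by auto

lemma coords_eq:
  assumes "m \<bullet> v = 1" "m \<bullet> v' = 1" "\<xi> \<bullet> v = \<xi> \<bullet> v'" "n \<bullet> v = n \<bullet> v'"
  shows "v = v'"
  using coords[of v "\<xi> \<bullet> v'" "n \<bullet> v'"] coords[of v' "\<xi> \<bullet> v'" "n \<bullet> v'"] assms by simp

lemma line_pt: "m \<bullet> (p + x *\<^sub>R w) = 1" "\<xi> \<bullet> (p + x *\<^sub>R w) = x" "n \<bullet> (p + x *\<^sub>R w) = 0"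
  using coords[of "p + x *\<^sub>R w" x 0] by auto

lemma line_in_eq: "v \<in> line_in m n \<Longrightarrow> v = p + (\<xi> \<bullet> v) *\<^sub>R w"
  using coords[of v "\<xi> \<bullet> v" 0] by (auto simp: line_in_def)

lemma line_pt_in: "p + x *\<^sub>R w \<in> line_in m n"
  using line_pt[of x] by (simp add: line_in_def)

lemma hX: "s \<in> {a..b} \<Longrightarrow> h (X s) = (n \<bullet> f s) / (m \<bullet> f s)"
  using graph[of s] by (simp add: X_def dot_chart)

lemma arc_eq: "chart m ` {c..d} = {v \<in> line_in m n. X c \<le> \<xi> \<bullet> v \<and> \<xi> \<bullet> v \<le> X d}"
proof (intro equalityI subsetI)
  fix v assume "v \<in> chart m ` {c..d}"
  then obtain s where s: "s \<in> {c..d}" "v = chart m s" by auto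
  then have s': "s \<in> {a..b}" using cd by auto
  have "\<not> X s < X c" "\<not> X d < X s" using X_mono_iff[OF s' cd_in(3)] X_mono_iff[OF cd_in(4) s'] s by auto
  moreover have "chart m s \<in> line_in m n"
    using chart_pos[OF s'] zero[OF s(1)] by (intro chart_in_line) auto
  ultimately show "v \<in> {v \<in> line_in m n. X c \<le> \<xi> \<bullet> v \<and> \<xi> \<bullet> v \<le> X d}"
    using s by (simp add: X_def)
next
  fix v assume v: "v \<in> {v \<in> line_in m n. X c \<le> \<xi> \<bullet> v \<and> \<xi> \<bullet> v \<le> X d}"
  then obtain s where s: "c \<le> s" "s \<le> d" "X s = \<xi> \<bullet> v" using X_surj[OF cd_in(3,4), of "\<xi> \<bullet> v"] by auto
  have "0 < m \<bullet> f s" using chart_pos[of s] s cd by auto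
  then have "chart m s = v" using s zero[of s] v
    by (intro coords_eq) (auto simp: X_def dot_chart line_in_def)
  then show "v \<in> chart m ` {c..d}" using s by auto
qed

text \<open>Maximality restated in the coordinate: the parameter over \<open>min x (X b)\<close>
  lies beyond \<open>d\<close>, and a nonzero value occurs between the two.\<close>

lemma right_nonzero:
  assumes "X d < x"
  obtains s where "d < s" "s < b" "X s < x" "n \<bullet> f s \<noteq> 0"
proof -
  have "X d < X b" using X_mono cd_in cd by auto
  then have "X d \<le> min x (X b)" "min x (X b) \<le> X b" using assms by auto
  then obtain r where r: "d \<le> r" "r \<le> b" "X r = min x (X b)" by (rule X_surj[OF cd_in(4,2)])
  have "r \<noteq> d" using r(3) assms \<open>X d < X b\<close> by auto
  then have "0 < r - d" using r by simp
  then obtain s where s: "d < s" "s < r" "n \<bullet> f s \<noteq> 0" using right_max[of "r - d"] by auto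
  have "X s < X r" using X_mono[of s r] s r(1,2) cd by auto
  then have "X s < x" unfolding r(3) by simp
  with s r show ?thesis by (intro that[of s]) simp_all
qed

lemma left_nonzero:
  assumes "x < X c"
  obtains s where "a < s" "s < c" "x < X s" "n \<bullet> f s \<noteq> 0"
proof -
  have "X a < X c" using X_mono cd_in cd by auto
  then have "X a \<le> max x (X a)" "max x (X a) \<le> X c" using assms by auto
  then obtain r where r: "a \<le> r" "r \<le> c" "X r = max x (X a)" by (rule X_surj[OF cd_in(1,3)])
  have "r \<noteq> c" using r(3) assms \<open>X a < X c\<close> by auto
  then have "0 < c - r" using r by simp
  then obtain s where s: "r < s" "s < c" "n \<bullet> f s \<noteq> 0" using left_max[of "c - r"] by auto
  have "X r < X s" using X_mono[of r s] s r(1,2) cd by auto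
  then have "x < X s" unfolding r(3) by simp
  with s r show ?thesis by (intro that[of s]) simp_all
qed

lemma curve_zero_in_box:
  assumes "v \<in> line_in m n \<inter> curve_in m" "a < s" "s < b" "\<xi> \<bullet> v = X s"
  shows "n \<bullet> f s = 0"
proof -
  have s: "s \<in> {a..b}" using assms by auto
  have "X a < X s" "X s < X b" using X_mono cd_in s assms by auto
  then have "n \<bullet> v = h (\<xi> \<bullet> v)"
    using on_curve[of v] assms eps_pos by (auto simp: X_def line_in_def curve_in_def)
  then have "(n \<bullet> f s) / (m \<bullet> f s) = 0" using hX[OF s] assms by (simp add: line_in_def)
  then show ?thesis using chart_pos[OF s] by simp
qed

text \<open>A connected set that leaves the arc also contains a point whose coordinate is that of
  some \<open>s\<close> with \<open>n \<bullet> f s \<noteq> 0\<close>, by connectedness of its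
  image under \<open>\<xi>\<close>. Over that coordinate line and curve do not meet within the
  box.\<close>

lemma connected_common_part:
  assumes K: "connected K" "K \<subseteq> line_in m n \<inter> curve_in m" and v0: "v0 \<in> K" "v0 \<in> chart m ` {c..d}"
  shows "K \<subseteq> chart m ` {c..d}"
proof
  fix v assume v: "v \<in> K"
  have c: "connected ((\<lambda>v. \<xi> \<bullet> v) ` K)"
    by (intro connected_continuous_image continuous_intros K)
  have between: "\<exists>v'\<in>K. \<xi> \<bullet> v' = y" if "\<xi> \<bullet> x \<le> y" "y \<le> \<xi> \<bullet> z" "x \<in> K" "z \<in> K" for x y z
  proof -
    have "y \<in> (\<lambda>v. \<xi> \<bullet> v) ` K" using c that unfolding connected_iff_interval by blast
    then show ?thesis by auto
  qed
  have v0': "X c \<le> \<xi> \<bullet> v0" "\<xi> \<bullet> v0 \<le> X d" using v0(2) arc_eq by auto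
  have "\<not> X d < \<xi> \<bullet> v"
  proof
    assume "X d < \<xi> \<bullet> v"
    then obtain s where s: "d < s" "s < b" "X s < \<xi> \<bullet> v" "n \<bullet> f s \<noteq> 0" by (rule right_nonzero)
    have "X d < X s" using X_mono s cd by auto
    then have "\<exists>v'\<in>K. \<xi> \<bullet> v' = X s" using v0' v0 v s by (intro between[of v0 "X s" v]) auto
    then obtain v' where "v' \<in> K" "\<xi> \<bullet> v' = X s" by (elim bexE)
    then show False using curve_zero_in_box[of v' s] K(2) s cd by auto
  qed
  moreover have "\<not> \<xi> \<bullet> v < X c"
  proof
    assume "\<xi> \<bullet> v < X c"
    then obtain s where s: "a < s" "s < c" "\<xi> \<bullet> v < X s" "n \<bullet> f s \<noteq> 0" by (rule left_nonzero)
    have "X s < X c" using X_mono s cd by auto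
    then have "\<exists>v'\<in>K. \<xi> \<bullet> v' = X s" using v0' v0 v s by (intro between[of v "X s" v0]) auto
    then obtain v' where "v' \<in> K" "\<xi> \<bullet> v' = X s" by (elim bexE)
    then show False using curve_zero_in_box[of v' s] K(2) s cd by auto
  qed
  ultimately show "v \<in> chart m ` {c..d}" unfolding arc_eq using v K(2) by auto
qed

lemma arc_subset: "chart m ` {c..d} \<subseteq> line_in m n \<inter> curve_in m"
proof
  fix v assume "v \<in> chart m ` {c..d}"
  then obtain s where s: "s \<in> {c..d}" "v = chart m s" by auto
  then have "m \<bullet> f s \<noteq> 0" using chart_pos[of s] cd by auto
  then show "v \<in> line_in m n \<inter> curve_in m"
    using s zero[OF s(1)] by (auto intro: chart_in_curve chart_in_line)
qed

lemma compact_arc: "compact (chart m ` {c..d})" and connected_arc: "connected (chart m ` {c..d})"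
proof -
  have "m \<bullet> f s \<noteq> 0" if "s \<in> {c..d}" for s using chart_pos[of s] that cd by auto
  then have "continuous_on {c..d} (chart m)" by (rule continuous_on_chart)
  then show "compact (chart m ` {c..d})" "connected (chart m ` {c..d})"
    by (auto intro: compact_continuous_image connected_continuous_image)
qed

lemma maximal_arc: "maximal_common_arc (line_in m n) (curve_in m) (chart m ` {c..d})"
  unfolding maximal_common_arc_def
proof (intro conjI allI impI)
  show "closed_arc (chart m ` {c..d})"
    by (rule connected_compact_in_line_closed_arc[OF coords])
       (use arc_subset compact_arc connected_arc cd in auto)
  show "chart m ` {c..d} \<subseteq> line_in m n \<inter> curve_in m" by (rule arc_subset)
  fix \<beta> assume \<beta>: "closed_arc \<beta> \<and> chart m ` {c..d} \<subseteq> \<beta> \<and> \<beta> \<subseteq> line_in m n \<inter> curve_in m"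
  have c: "chart m c \<in> chart m ` {c..d}" using cd by simp
  then have "\<beta> \<subseteq> chart m ` {c..d}"
    using \<beta> closed_arcD(2)[of \<beta>] by (intro connected_common_part[OF _ _ _ c]) auto
  then show "\<beta> = chart m ` {c..d}" using \<beta> by blast
qed

text \<open>Moving slightly in direction \<open>- u\<close> keeps \<open>\<xi>\<close> and makes
  \<open>n\<close> negative, hence leads strictly below the graph. Only the closure is reached,
  since the curve may touch the line at \<open>v\<close> itself.\<close>

lemma closure_below:
  assumes "v \<in> line_in m n" "X a < \<xi> \<bullet> v" "\<xi> \<bullet> v < X b" "0 \<le> h (\<xi> \<bullet> v)"
  shows "v \<in> closure below"
  unfolding closure_approachable
proof (intro allI impI)
  fix e :: real assume e: "e > 0"
  have nu: "0 < norm u + 1" by (simp add: add_nonneg_pos)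
  define t where "t = min (\<epsilon> / 2) (e / (2 * (norm u + 1)))"
  have t: "0 < t" "t < \<epsilon>" using eps_pos e nu by (auto simp: t_def)
  define v' where "v' = p + (\<xi> \<bullet> v) *\<^sub>R w + (- t) *\<^sub>R u"
  have v': "m \<bullet> v' = 1" "\<xi> \<bullet> v' = \<xi> \<bullet> v" "n \<bullet> v' = - t"
    using coords[of v' "\<xi> \<bullet> v" "- t"] by (auto simp: v'_def)
  have "v' - v = (- t) *\<^sub>R u" using line_in_eq[OF assms(1)] by (simp add: v'_def)
  then have "dist v' v = t * norm u" using t by (simp add: dist_norm)
  also have "\<dots> \<le> e / (2 * (norm u + 1)) * norm u" by (intro mult_right_mono) (auto simp: t_def)
  also have "\<dots> < e" using e nu by (simp add: field_simps add_nonneg_pos)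
  finally show "\<exists>y\<in>below. dist y v < e"
    using v' t assms by (intro bexI[of _ v']) (auto simp: below_def box_def)
qed

lemma closure_above:
  assumes "v \<in> line_in m n" "X a < \<xi> \<bullet> v" "\<xi> \<bullet> v < X b" "h (\<xi> \<bullet> v) \<le> 0"
  shows "v \<in> closure above"
  unfolding closure_approachable
proof (intro allI impI)
  fix e :: real assume e: "e > 0"
  have nu: "0 < norm u + 1" by (simp add: add_nonneg_pos)
  define t where "t = min (\<epsilon> / 2) (e / (2 * (norm u + 1)))"
  have t: "0 < t" "t < \<epsilon>" using eps_pos e nu by (auto simp: t_def)
  define v' where "v' = p + (\<xi> \<bullet> v) *\<^sub>R w + t *\<^sub>R u"
  have v': "m \<bullet> v' = 1" "\<xi> \<bullet> v' = \<xi> \<bullet> v" "n \<bullet> v' = t"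
    using coords[of v' "\<xi> \<bullet> v" t] by (auto simp: v'_def)
  have "v' - v = t *\<^sub>R u" using line_in_eq[OF assms(1)] by (simp add: v'_def)
  then have "dist v' v = t * norm u" using t by (simp add: dist_norm)
  also have "\<dots> \<le> e / (2 * (norm u + 1)) * norm u" by (intro mult_right_mono) (auto simp: t_def)
  also have "\<dots> < e" using e nu by (simp add: field_simps add_nonneg_pos)
  finally show "\<exists>y\<in>above. dist y v < e"
    using v' t assms by (intro bexI[of _ v']) (auto simp: above_def box_def)
qed

lemma connected_line_part:
  assumes B: "connected B" "B \<subseteq> line_in m n"
  shows "connected {v \<in> B. x < \<xi> \<bullet> v}" "connected {v \<in> B. \<xi> \<bullet> v < x}"
proof -
  let ?L = "\<lambda>x. p + x *\<^sub>R w"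
  let ?S = "(\<lambda>v. \<xi> \<bullet> v) ` B"
  have "connected ?S" by (intro connected_continuous_image continuous_intros B)
  then have c: "convex ?S" by (simp add: connected_convex_1)
  have img: "{v \<in> B. \<xi> \<bullet> v \<in> I} = ?L ` (?S \<inter> I)" for I
  proof (intro equalityI subsetI)
    fix v assume "v \<in> {v \<in> B. \<xi> \<bullet> v \<in> I}"
    then show "v \<in> ?L ` (?S \<inter> I)" using line_in_eq[of v] B(2) by (intro image_eqI[of _ _ "\<xi> \<bullet> v"]) auto
  next
    fix v assume "v \<in> ?L ` (?S \<inter> I)"
    then obtain v' where "v' \<in> B" "\<xi> \<bullet> v' \<in> I" "v = ?L (\<xi> \<bullet> v')" by blast
    then show "v \<in> {v \<in> B. \<xi> \<bullet> v \<in> I}" using line_in_eq[of v'] B(2) by auto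
  qed
  have "connected {v \<in> B. \<xi> \<bullet> v \<in> I}" if "convex I" for I
    unfolding img
    by (intro connected_continuous_image continuous_intros convex_connected convex_Int c that)
  from this[of "{x<..}"] this[of "{..<x}"]
  show "connected {v \<in> B. x < \<xi> \<bullet> v}" "connected {v \<in> B. \<xi> \<bullet> v < x}" by auto
qed

section \<open>Sign change and crossing\<close>

text \<open>The box is the neighbourhood, and its part of the line is the open subarc. Where the
  curve lies above the line, the line lies in the closed lower side: so the right part
  \<open>P\<close> goes with \<open>below\<close> and the left part \<open>Q\<close> with
  \<open>above\<close>.\<close>

lemma crosses_if_sign_change:
  assumes "\<And>s. s \<in> {a..c} \<Longrightarrow> n \<bullet> f s \<le> 0" "\<And>s. s \<in> {d..b} \<Longrightarrow> 0 \<le> n \<bullet> f s"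
  shows "crosses_in (affine_chart m) (line_in m n) (curve_in m) (chart m ` {c..d})"
proof -
  let ?L = "\<lambda>x. p + x *\<^sub>R w" and ?\<alpha> = "chart m ` {c..d}"
  define B where "B = {v \<in> line_in m n. X a < \<xi> \<bullet> v \<and> \<xi> \<bullet> v < X b}"
  define P where "P = {v \<in> B. X d < \<xi> \<bullet> v}"
  define Q where "Q = {v \<in> B. \<xi> \<bullet> v < X c}"
  have XX: "X a < X c" "X d < X b" "X a < X b" "\<not> X d < X c"
    using X_mono cd_in cd X_mono_iff by auto
  have Limg: "?L ` {X a<..<X b} = B"
  proof (intro equalityI subsetI)
    fix v assume "v \<in> ?L ` {X a<..<X b}"
    then show "v \<in> B" using line_pt line_pt_in by (auto simp: B_def)
  next
    fix v assume "v \<in> B"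
    then show "v \<in> ?L ` {X a<..<X b}" using line_in_eq[of v]
      by (intro image_eqI[of _ _ "\<xi> \<bullet> v"]) (auto simp: B_def)
  qed
  let ?g = "linepath (?L (X a)) (?L (X b))"
  have "open_subarc B (line_in m n)" unfolding open_subarc_def
  proof (intro exI conjI)
    have "?L (X a) \<noteq> ?L (X b)" using line_pt(2) XX(3) by (metis less_irrefl)
    then show "arc ?g" by (rule arc_linepath)
    have "path_image ?g = ?L ` {X a..X b}" using XX(3) by (simp add: line_image_Icc)
    then show "path_image ?g \<subseteq> line_in m n" using line_pt_in by auto
    have "?g t = ?L (X a + t * (X b - X a))" for t by (simp add: linepath_def algebra_simps)
    then have "?g ` {0<..<1} = ?L ` (\<lambda>t. X a + t * (X b - X a)) ` {0<..<1}" by (simp add: image_image)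
    also have "(\<lambda>t. X a + t * (X b - X a)) ` {0<..<1} = {X a<..<X b}"
    proof (intro equalityI subsetI)
      fix x assume "x \<in> (\<lambda>t. X a + t * (X b - X a)) ` {0<..<1}"
      then obtain t where t: "0 < t" "t < 1" "x = X a + t * (X b - X a)" by auto
      have "0 < t * (X b - X a)" "t * (X b - X a) < 1 * (X b - X a)"
        using t XX by (auto intro: mult_strict_right_mono)
      then show "x \<in> {X a<..<X b}" using t by auto
    next
      fix x assume "x \<in> {X a<..<X b}"
      then show "x \<in> (\<lambda>t. X a + t * (X b - X a)) ` {0<..<1}"
        by (intro image_eqI[of _ _ "(x - X a) / (X b - X a)"]) (auto simp: field_simps)
    qed
    finally show "B = ?g ` {0<..<1}" using Limg by simp
  qed
  moreover have "?\<alpha> \<subseteq> B" unfolding arc_eq B_def using XX by auto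
  moreover have conB: "connected B" unfolding Limg[symmetric]
    by (intro connected_continuous_image continuous_intros) auto
  have PQ: "P \<noteq> {}" "Q \<noteq> {}" "P \<inter> Q = {}"
  proof -
    have "?L ((X d + X b) / 2) \<in> P" "?L ((X a + X c) / 2) \<in> Q"
      using line_pt line_pt_in XX by (auto simp: P_def Q_def B_def)
    then show "P \<noteq> {}" "Q \<noteq> {}" by auto
    show "P \<inter> Q = {}" using XX by (auto simp: P_def Q_def)
  qed
  moreover have "components (B - ?\<alpha>) = {P, Q}"
  proof -
    have "B - ?\<alpha> = P \<union> Q" unfolding arc_eq by (auto simp: P_def Q_def B_def)
    moreover have "components (P \<union> Q) = {P, Q}"
    proof (rule components_two)
      show "connected P" "connected Q" unfolding P_def Q_def
        by (rule connected_line_part[OF conB], simp add: B_def)+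
      show "open {v. X d < \<xi> \<bullet> v}" "open {v. \<xi> \<bullet> v < X c}"
        by (intro open_Collect_less continuous_intros)+
    qed (use PQ XX in \<open>auto simp: P_def Q_def\<close>)
    ultimately show ?thesis by simp
  qed
  moreover have "B \<subseteq> box" using eps_pos by (auto simp: B_def box_def line_in_def)
  moreover have ab: "above \<noteq> {}" "below \<noteq> {}" "above \<inter> below = {}"
  proof -
    have "?L (X c) \<in> line_in m n" "\<xi> \<bullet> ?L (X c) = X c" by (rule line_pt_in line_pt)+
    moreover have "h (X c) = 0" using hX[OF cd_in(3)] zero[of c] cd by simp
    moreover have "X c < X b" using XX by auto
    ultimately have "?L (X c) \<in> closure above" "?L (X c) \<in> closure below"
      using XX by (auto intro!: closure_above closure_below)
    then show "above \<noteq> {}" "below \<noteq> {}" by auto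
    show "above \<inter> below = {}" by (auto simp: above_def below_def)
  qed
  moreover have "components (box - curve_in m) = {below, above}"
  proof -
    have "box - curve_in m = below \<union> above"
      using box_minus_curve by (simp add: curve_in_def Un_commute)
    moreover obtain U V where "open U" "above = affine_chart m \<inter> U" "open V" "below = affine_chart m \<inter> V"
      using open_above open_below unfolding openin_open by auto
    then have "components (below \<union> above) = {below, above}"
      using ab by (intro components_two[of below above V U] connected_above connected_below) auto
    ultimately show ?thesis by simp
  qed
  moreover have "P \<subseteq> closure below"
  proof
    fix v assume v: "v \<in> P"
    then have "X d \<le> \<xi> \<bullet> v" "\<xi> \<bullet> v \<le> X b" by (auto simp: P_def B_def)
    then obtain s where s: "d \<le> s" "s \<le> b" "X s = \<xi> \<bullet> v" by (rule X_surj[OF cd_in(4,2)])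
    then have "s \<in> {a..b}" using cd by auto
    then have "0 \<le> h (\<xi> \<bullet> v)" using hX[of s] assms(2)[of s] chart_pos[of s] s by simp
    then show "v \<in> closure below" using v by (intro closure_below) (auto simp: P_def B_def)
  qed
  moreover have "Q \<subseteq> closure above"
  proof
    fix v assume v: "v \<in> Q"
    then have "X a \<le> \<xi> \<bullet> v" "\<xi> \<bullet> v \<le> X c" by (auto simp: Q_def B_def)
    then obtain s where s: "a \<le> s" "s \<le> c" "X s = \<xi> \<bullet> v" by (rule X_surj[OF cd_in(1,3)])
    then have "s \<in> {a..b}" using cd by auto
    then have "h (\<xi> \<bullet> v) \<le> 0" using hX[of s] assms(1)[of s] chart_pos[of s] s
      by (simp add: divide_nonpos_pos)
    then show "v \<in> closure above" using v by (intro closure_above) (auto simp: Q_def B_def)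
  qed
  moreover have "P \<noteq> Q" "below \<noteq> above" using PQ ab by auto
  ultimately show ?thesis
    unfolding crosses_in_def using maximal_arc open_box connected_box
    by - (rule conjI, assumption, rule exI[of _ B], rule exI[of _ P], rule exI[of _ Q],
      rule exI[of _ box], rule exI[of _ below], rule exI[of _ above], simp)
qed

text \<open>The sets \<open>B\<close>, \<open>U\<close>, \<open>S\<close>, \<open>T\<close> belong
  to an arbitrary alleged crossing and have to be compared with the box, which lies in
  \<open>U\<close>. Both parts of \<open>B\<close> meet the relatively open set
  \<open>below\<close>, hence so do \<open>S\<close> and \<open>T\<close>. As \<open>below\<close>
  is connected and avoids the curve, it lies in a single component.\<close>

lemma not_crosses_if_same_sign:
  assumes sign: "\<And>s. s \<in> {a..b} \<Longrightarrow> 0 \<le> n \<bullet> f s"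
    and B: "open_subarc B (line_in m n)" "chart m ` {c..d} \<subseteq> B" "P \<noteq> Q"
      "components (B - chart m ` {c..d}) = {P, Q}"
    and U: "U \<subseteq> affine_chart m" "box \<subseteq> U" "S \<noteq> T" "components (U - curve_in m) = {S, T}"
    and PQ: "P \<subseteq> closure S" "Q \<subseteq> closure T"
  shows False
proof -
  let ?\<alpha> = "chart m ` {c..d}"
  have Bl: "B \<subseteq> line_in m n" and conB: "connected B"
  proof -
    obtain g where g: "arc g" "path_image g \<subseteq> line_in m n" "B = g ` {0<..<1}"
      using B(1) by (auto simp: open_subarc_def)
    show "B \<subseteq> line_in m n" using g(2,3) by (auto simp: path_image_def)
    have "continuous_on {0<..<1} g" using arc_imp_path[OF g(1)] unfolding path_def
      by (rule continuous_on_subset) auto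
    then show "connected B" unfolding g(3) by (rule connected_continuous_image) auto
  qed
  define R where "R = {v \<in> B. X d < \<xi> \<bullet> v}"
  define L where "L = {v \<in> B. \<xi> \<bullet> v < X c}"
  have RL: "B - ?\<alpha> = R \<union> L" unfolding arc_eq using Bl by (auto simp: R_def L_def)
  have Xcd: "\<not> X d < X c" using X_mono_iff cd_in cd by auto
  \<comment> \<open>\<open>P\<close> and \<open>Q\<close> are given only as components; this
    identifies them as the parts to the right and to the left of the arc.\<close>
  have part: "C = R \<or> C = L" if C: "C \<in> components (B - ?\<alpha>)" for C
  proof -
    have conC: "connected C" "C \<noteq> {}" "C \<subseteq> R \<union> L"
      using in_components_connected[OF C] in_components_nonempty[OF C] in_components_subset[OF C] RL by auto
    have conR: "connected R" "connected L" unfolding R_def L_def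
      by (rule connected_line_part[OF conB Bl])+
    have "{v. X d < \<xi> \<bullet> v} \<inter> C = {} \<or> {v. \<xi> \<bullet> v < X c} \<inter> C = {}"
    proof (rule connectedD[OF conC(1)])
      show "open {v. X d < \<xi> \<bullet> v}" "open {v. \<xi> \<bullet> v < X c}"
        by (intro open_Collect_less continuous_intros)+
    qed (use conC Xcd in \<open>auto simp: R_def L_def\<close>)
    then have "C \<subseteq> L \<or> C \<subseteq> R" using conC(3) by (auto simp: R_def L_def)
    moreover have "R \<subseteq> B - ?\<alpha>" "L \<subseteq> B - ?\<alpha>" using RL by auto
    ultimately show ?thesis using C conR conC(2) unfolding in_components_maximal by blast
  qed
  have PQc: "P \<in> components (B - ?\<alpha>)" "Q \<in> components (B - ?\<alpha>)" using B(4) by auto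
  then have PQ': "P = R \<and> Q = L \<or> P = L \<and> Q = R" using part B(3) by blast
  have ne: "R \<noteq> {}" "L \<noteq> {}"
    using in_components_nonempty[OF PQc(1)] in_components_nonempty[OF PQc(2)] PQ' by auto
  have conX: "connected ((\<lambda>v. \<xi> \<bullet> v) ` B)"
    by (intro connected_continuous_image continuous_intros conB)
  have between: "\<exists>v'\<in>B. \<xi> \<bullet> v' = y" if "\<xi> \<bullet> x \<le> y" "y \<le> \<xi> \<bullet> z" "x \<in> B" "z \<in> B" for x y z
  proof -
    have "y \<in> (\<lambda>v. \<xi> \<bullet> v) ` B" using conX that unfolding connected_iff_interval by blast
    then show ?thesis by auto
  qed
  have inbelow: "v \<in> below" if "v \<in> B" "a < s" "s < b" "\<xi> \<bullet> v = X s" "n \<bullet> f s \<noteq> 0" for v s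
  proof -
    have s: "s \<in> {a..b}" using that by auto
    have "0 < n \<bullet> f s" using sign[OF s] that by auto
    then have "0 < h (\<xi> \<bullet> v)" using hX[OF s] chart_pos[OF s] that by simp
    moreover have "X a < X s" "X s < X b" using X_mono cd_in s that by auto
    ultimately show ?thesis using that Bl eps_pos by (auto simp: below_def box_def line_in_def)
  qed
  have \<alpha>B: "chart m c \<in> B" "chart m d \<in> B" using B(2) cd by auto
  have "R \<inter> below \<noteq> {}"
  proof -
    obtain v where v: "v \<in> B" "X d < \<xi> \<bullet> v" using ne by (auto simp: R_def)
    then obtain s where s: "d < s" "s < b" "X s < \<xi> \<bullet> v" "n \<bullet> f s \<noteq> 0" by (elim right_nonzero)
    have "X d < X s" using X_mono cd_in s cd by auto
    then have "\<exists>v'\<in>B. \<xi> \<bullet> v' = X s"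
      using \<alpha>B v s by (intro between[of "chart m d" "X s" v]) (auto simp: X_def)
    then obtain v' where v': "v' \<in> B" "\<xi> \<bullet> v' = X s" by (elim bexE)
    have "v' \<in> below" using v' s cd by (intro inbelow[of v' s]) auto
    then show ?thesis using v' \<open>X d < X s\<close> by (auto simp: R_def)
  qed
  moreover have "L \<inter> below \<noteq> {}"
  proof -
    obtain v where v: "v \<in> B" "\<xi> \<bullet> v < X c" using ne by (auto simp: L_def)
    then obtain s where s: "a < s" "s < c" "\<xi> \<bullet> v < X s" "n \<bullet> f s \<noteq> 0" by (elim left_nonzero)
    have "X s < X c" using X_mono cd_in s cd by auto
    then have "\<exists>v'\<in>B. \<xi> \<bullet> v' = X s"
      using \<alpha>B v s by (intro between[of v "X s" "chart m c"]) (auto simp: X_def)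
    then obtain v' where v': "v' \<in> B" "\<xi> \<bullet> v' = X s" by (elim bexE)
    have "v' \<in> below" using v' s cd by (intro inbelow[of v' s]) auto
    then show ?thesis using v' \<open>X s < X c\<close> by (auto simp: L_def)
  qed
  ultimately have meets: "P \<inter> below \<noteq> {}" "Q \<inter> below \<noteq> {}" using PQ' by auto
  obtain O' where O': "open O'" "below = affine_chart m \<inter> O'"
    using open_below unfolding openin_open by auto
  have sub: "S \<subseteq> affine_chart m" "T \<subseteq> affine_chart m"
  proof -
    have "S \<in> components (U - curve_in m)" "T \<in> components (U - curve_in m)" using U(4) by auto
    then show "S \<subseteq> affine_chart m" "T \<subseteq> affine_chart m" using in_components_subset U(1) by blast+
  qed
  have meet: "C \<inter> below \<noteq> {}" if DC: "D \<inter> below \<noteq> {}" "D \<subseteq> closure C" "C \<subseteq> affine_chart m" for C D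
  proof -
    obtain v where "v \<in> D" "v \<in> below" using DC(1) by blast
    then have "v \<in> closure C" "v \<in> O'" using DC(2) O'(2) by auto
    then have "O' \<inter> closure C \<noteq> {}" by blast
    then have "O' \<inter> C \<noteq> {}" using open_Int_closure_eq_empty[OF O'(1)] by blast
    then show ?thesis using DC(3) O'(2) by auto
  qed
  have "below \<subseteq> U - curve_in m"
    using box_minus_curve U(2) by (auto simp: curve_in_def)
  then have "S = T"
    using joinable_components_eq[of below "U - curve_in m" S T] connected_below U(4)
      meet[OF meets(1) PQ(1) sub(1)] meet[OF meets(2) PQ(2) sub(2)] by auto
  with U(3) show False by simp
qed

end

section \<open>The tangent line at a clean point crosses only once\<close>

lemma span_singleton_eq_iff_cross:
  fixes v q :: "real^3"
  assumes "v \<noteq> 0" "q \<noteq> 0"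
  shows "span {v} = span {q} \<longleftrightarrow> v \<times> q = 0"
proof
  assume "span {v} = span {q}"
  then have "v \<in> span {q}" using span_base[of v "{v}"] by simp
  then obtain k where "v = k *\<^sub>R q" by (auto simp: span_singleton)
  then show "v \<times> q = 0" by (simp add: cross_mult_left)
next
  have sub: "span {v} \<subseteq> span {q}" if "v \<times> q = 0" "q \<noteq> 0" for v q :: "real^3"
  proof -
    have "q \<times> (v \<times> q) = (q \<bullet> q) *\<^sub>R v - (q \<bullet> v) *\<^sub>R q" by (rule Lagrange)
    then have "(q \<bullet> q) *\<^sub>R v = (q \<bullet> v) *\<^sub>R q" using that(1) by simp
    then have "(1 / (q \<bullet> q)) *\<^sub>R ((q \<bullet> q) *\<^sub>R v) = (1 / (q \<bullet> q)) *\<^sub>R ((q \<bullet> v) *\<^sub>R q)" by simp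
    then have "v = ((q \<bullet> v) / (q \<bullet> q)) *\<^sub>R q" using that(2) by simp
    then have "v \<in> span {q}" by (metis span_base span_scale singletonI)
    then show ?thesis by (intro span_minimal) auto
  qed
  assume "v \<times> q = 0"
  moreover from this have "q \<times> v = 0" by (metis cross_skew neg_equal_0_iff_equal)
  ultimately show "span {v} = span {q}" using sub[of v q] sub[of q v] assms by blast
qed

text \<open>The end is the infimum of the later parameters with nonzero value; by continuity the
  value at the infimum itself is still 0.\<close>

lemma zero_run_right_end:
  fixes F :: "real \<Rightarrow> real"
  assumes F: "continuous_on UNIV F" "F s = 0" and x: "s \<le> x" "F x \<noteq> 0"
  obtains d where "s \<le> d" "\<And>y. s \<le> y \<Longrightarrow> y \<le> d \<Longrightarrow> F y = 0"
    "\<And>e. e > 0 \<Longrightarrow> \<exists>y. d < y \<and> y < d + e \<and> F y \<noteq> 0"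
proof -
  let ?A = "{y. s \<le> y \<and> F y \<noteq> 0}"
  define d where "d = Inf ?A"
  have ne: "?A \<noteq> {}" using x by auto
  have bdd: "bdd_below ?A" by (rule bdd_belowI[of _ s]) auto
  have sd: "s \<le> d" unfolding d_def by (rule cInf_greatest[OF ne]) auto
  have lt: "F y = 0" if "s \<le> y" "y < d" for y
    using cInf_lower[OF _ bdd, of y] that unfolding d_def by force
  have Fd: "F d = 0"
  proof (cases "s = d")
    case False
    have "closed {y. F y = 0}" by (intro closed_Collect_eq F continuous_intros)
    then have "closure {s..<d} \<subseteq> {y. F y = 0}" by (rule closure_minimal[rotated]) (use lt in auto)
    then show ?thesis using sd False by auto
  qed (use F in simp)
  have "\<exists>y. d < y \<and> y < d + e \<and> F y \<noteq> 0" if "e > 0" for e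
  proof -
    have "Inf ?A < d + e" using that by (simp add: d_def)
    then obtain y where y: "y \<in> ?A" "y < d + e" using cInf_lessD[OF ne] by blast
    then have "d \<le> y" unfolding d_def using cInf_lower[OF _ bdd] by blast
    moreover have "y \<noteq> d" using y Fd by auto
    ultimately show ?thesis using y by (intro exI[of _ y]) auto
  qed
  moreover have "F y = 0" if "s \<le> y" "y \<le> d" for y using lt[of y] Fd that by (cases "y = d") auto
  ultimately show ?thesis using sd by (intro that)
qed

lemma cross_nonzero_of_functionals:
  fixes m n q :: "real^3"
  assumes "n \<noteq> 0" "n \<bullet> q = 0" "m \<bullet> q \<noteq> 0"
  shows "m \<times> n \<noteq> 0"
proof
  assume 0: "m \<times> n = 0"
  have "q \<times> (m \<times> n) = (q \<bullet> n) *\<^sub>R m - (q \<bullet> m) *\<^sub>R n" by (rule Lagrange)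
  with 0 assms show False by (simp add: inner_commute)
qed

context antiperiodic_curve
begin

lemma deriv_shift_int: "f' (s + of_int k) = (if even k then f' s else - f' s)"
  by (rule antiperiodic_add_int[of f', OF deriv_antiperiodic])

lemma reduce_int:
  fixes a s :: real
  obtains k where "a \<le> s + of_int k" "s + of_int k < a + 1"
proof
  show "a \<le> s + of_int (- \<lfloor>s - a\<rfloor>)" "s + of_int (- \<lfloor>s - a\<rfloor>) < a + 1" by (simp, linarith)+
qed

lemma dot_shift_zero_iff: "n \<bullet> f (s + of_int k) = 0 \<longleftrightarrow> n \<bullet> f s = 0"
  by (simp add: shift_int)

section \<open>Maximal intervals of zeros\<close>

definition zero_interval :: "real^3 \<Rightarrow> real \<Rightarrow> real \<Rightarrow> bool" where
  "zero_interval n c d \<longleftrightarrow> c \<le> d \<and> (\<forall>s\<in>{c..d}. n \<bullet> f s = 0) \<and>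
     (\<forall>e>0. \<exists>s. d < s \<and> s < d + e \<and> n \<bullet> f s \<noteq> 0) \<and>
     (\<forall>e>0. \<exists>s. c - e < s \<and> s < c \<and> n \<bullet> f s \<noteq> 0)"

lemma zero_interval_shift:
  assumes "zero_interval n c d"
  shows "zero_interval n (c + of_int k) (d + of_int k)"
  unfolding zero_interval_def
proof (intro conjI ballI allI impI)
  show "c + of_int k \<le> d + of_int k" using assms by (simp add: zero_interval_def)
next
  fix s assume "s \<in> {c + of_int k..d + of_int k}"
  then have "s - of_int k \<in> {c..d}" by auto
  then have "n \<bullet> f (s - of_int k) = 0" using assms by (auto simp: zero_interval_def)
  then show "n \<bullet> f s = 0" using dot_shift_zero_iff[of n "s - of_int k" k] by simp
next
  fix e :: real assume "e > 0"
  then obtain s where "d < s" "s < d + e" "n \<bullet> f s \<noteq> 0" using assms unfolding zero_interval_def by blast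
  then show "\<exists>s. d + of_int k < s \<and> s < d + of_int k + e \<and> n \<bullet> f s \<noteq> 0"
    by (intro exI[of _ "s + of_int k"]) (simp add: dot_shift_zero_iff)
next
  fix e :: real assume "e > 0"
  then obtain s where "c - e < s" "s < c" "n \<bullet> f s \<noteq> 0" using assms unfolding zero_interval_def by blast
  then show "\<exists>s. c + of_int k - e < s \<and> s < c + of_int k \<and> n \<bullet> f s \<noteq> 0"
    by (intro exI[of _ "s + of_int k"]) (simp add: dot_shift_zero_iff)
qed

lemma zero_interval_eq:
  assumes 1: "zero_interval n c d" and 2: "zero_interval n c' d'" and o: "c \<le> c'" "c' \<le> d"
  shows "c' = c \<and> d' = d"
proof
  have z: "\<And>s. c \<le> s \<Longrightarrow> s \<le> d \<Longrightarrow> n \<bullet> f s = 0" "\<And>s. c' \<le> s \<Longrightarrow> s \<le> d' \<Longrightarrow> n \<bullet> f s = 0"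
    using 1 2 by (auto simp: zero_interval_def)
  have le: "c' \<le> d'" using 2 by (simp add: zero_interval_def)
  show c: "c' = c"
  proof (rule ccontr)
    assume "c' \<noteq> c"
    then have "c' - c > 0" using o by simp
    then obtain s where "c' - (c' - c) < s" "s < c'" "n \<bullet> f s \<noteq> 0"
      using 2 unfolding zero_interval_def by blast
    then show False using z(1)[of s] o by simp
  qed
  show "d' = d"
  proof (rule ccontr)
    assume "d' \<noteq> d"
    then consider "d' - d > 0" | "d - d' > 0" by linarith
    then show False
    proof cases
      case 1
      then obtain s where "d < s" "s < d + (d' - d)" "n \<bullet> f s \<noteq> 0"
        using assms(1) unfolding zero_interval_def by blast
      then show False using z(2)[of s] o by simp
    next
      case 2
      then obtain s where "d' < s" "s < d' + (d - d')" "n \<bullet> f s \<noteq> 0"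
        using assms(2) unfolding zero_interval_def by blast
      then show False using z(1)[of s] le o by simp
    qed
  qed
qed

text \<open>An interval of length 1 contains a translate of every parameter, so the functional would
  vanish on the whole curve.\<close>

lemma zero_interval_short:
  assumes "zero_interval n c d" "n \<bullet> f x \<noteq> 0"
  shows "d < c + 1"
proof (rule ccontr)
  assume "\<not> d < c + 1"
  moreover obtain k where "c \<le> x + of_int k" "x + of_int k < c + 1" by (rule reduce_int)
  ultimately have "n \<bullet> f (x + of_int k) = 0" using assms(1) by (auto simp: zero_interval_def)
  then show False using assms(2) dot_shift_zero_iff by simp
qed

text \<open>The left end is the right end for the reflected function; integer shifts carry the
  nonzero parameter \<open>x\<close> to either side of \<open>s\<close>.\<close>

lemma zero_interval_exists:
  assumes "n \<bullet> f s = 0" "n \<bullet> f x \<noteq> 0"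
  obtains c d where "c \<le> s" "s \<le> d" "zero_interval n c d"
proof -
  obtain k where "s \<le> x + of_int k" by (rule reduce_int)
  moreover have "n \<bullet> f (x + of_int k) \<noteq> 0" using assms(2) dot_shift_zero_iff by simp
  ultimately obtain d where d: "s \<le> d" "\<And>y. s \<le> y \<Longrightarrow> y \<le> d \<Longrightarrow> n \<bullet> f y = 0"
    "\<And>e. e > 0 \<Longrightarrow> \<exists>y. d < y \<and> y < d + e \<and> n \<bullet> f y \<noteq> 0"
    by (rule zero_run_right_end[rotated 2, of _ _ "\<lambda>x. n \<bullet> f x"])
       (auto intro!: continuous_intros simp: assms)
  obtain k where "- s \<le> - x + of_int k" by (rule reduce_int)
  moreover have "n \<bullet> f (- (- x + of_int k)) \<noteq> 0" using assms(2) dot_shift_zero_iff[of n x "- k"] by simp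
  ultimately obtain c where c: "- s \<le> c" "\<And>y. - s \<le> y \<Longrightarrow> y \<le> c \<Longrightarrow> n \<bullet> f (- y) = 0"
    "\<And>e. e > 0 \<Longrightarrow> \<exists>y. c < y \<and> y < c + e \<and> n \<bullet> f (- y) \<noteq> 0"
    by (rule zero_run_right_end[rotated 2, of _ _ "\<lambda>x. n \<bullet> f (- x)"])
       (auto intro!: continuous_intros simp: assms)
  have "zero_interval n (- c) d" unfolding zero_interval_def
  proof (intro conjI ballI allI impI)
    show "- c \<le> d" using c d by simp
  next
    fix y assume "y \<in> {- c..d}"
    then show "n \<bullet> f y = 0" using c(2)[of "- y"] d(2)[of y] by (cases "y \<le> s") auto
  next
    fix e :: real assume e: "e > 0"
    show "\<exists>s. d < s \<and> s < d + e \<and> n \<bullet> f s \<noteq> 0" by (rule d(3)[OF e])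
    obtain y where "c < y" "y < c + e" "n \<bullet> f (- y) \<noteq> 0" using c(3)[OF e] by blast
    then show "\<exists>s. - c - e < s \<and> s < - c \<and> n \<bullet> f s \<noteq> 0" by (intro exI[of _ "- y"]) auto
  qed
  then show ?thesis using c d by (intro that[of "- c" d]) auto
qed

lemma zero_boxI:
  assumes "graph_box f f' n m \<xi> p w u a b \<epsilon> h" "a < c" "d < b" "zero_interval n c d"
  shows "zero_box f f' n m \<xi> p w u a b \<epsilon> h c d"
proof -
  interpret graph_box f f' n m \<xi> p w u a b \<epsilon> h by (rule assms)
  show ?thesis by unfold_locales (use assms in \<open>auto simp: zero_interval_def\<close>)
qed

section \<open>Common arcs of line and curve in a chart\<close>

text \<open>Adding the image of an interval of zeros to \<open>K\<close> gives again a compact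
  connected subset of the line, hence a closed arc, and maximality forbids any growth.\<close>

lemma maximal_common_arc_absorbs:
  assumes K: "maximal_common_arc (line_in m n) (curve_in m) K" and n: "n \<noteq> 0"
    and s: "chart m s \<in> K" and z: "\<And>x. x \<in> closed_segment s z \<Longrightarrow> n \<bullet> f x = 0 \<and> 0 < m \<bullet> f x"
  shows "chart m ` closed_segment s z \<subseteq> K"
proof -
  let ?J = "chart m ` closed_segment s z"
  have zs: "n \<bullet> f s = 0" "0 < m \<bullet> f s" using z[of s] by auto
  have "m \<times> n \<noteq> 0" by (rule cross_nonzero_of_functionals[of n "f s"]) (use zs n in auto)
  then obtain p w u where coords:
    "\<And>v x y. m \<bullet> v = 1 \<and> (m \<times> n) \<bullet> v = x \<and> n \<bullet> v = y \<longleftrightarrow> v = p + x *\<^sub>R w + y *\<^sub>R u"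
    by (rule dual_coordinates[of m n 1]) auto
  have K': "closed_arc K" "K \<subseteq> line_in m n \<inter> curve_in m"
    "\<And>\<beta>. closed_arc \<beta> \<Longrightarrow> K \<subseteq> \<beta> \<Longrightarrow> \<beta> \<subseteq> line_in m n \<inter> curve_in m \<Longrightarrow> \<beta> = K"
    using K by (auto simp: maximal_common_arc_def)
  have cont: "continuous_on (closed_segment s z) (chart m)"
    by (rule continuous_on_chart) (use z in \<open>auto simp: less_le\<close>)
  have J: "?J \<subseteq> line_in m n \<inter> curve_in m"
  proof
    fix v assume "v \<in> ?J"
    then obtain x where x: "x \<in> closed_segment s z" "v = chart m x" by blast
    then show "v \<in> line_in m n \<inter> curve_in m"
      using z[OF x(1)] by (auto intro: chart_in_curve chart_in_line)
  qed
  have "closed_arc (K \<union> ?J)"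
  proof (rule connected_compact_in_line_closed_arc[OF coords])
    show "compact (K \<union> ?J)"
      by (intro compact_Un compact_continuous_image cont compact_segment closed_arcD(1) K'(1))
    show "connected (K \<union> ?J)"
    proof (rule connected_Un)
      show "connected K" by (rule closed_arcD[OF K'(1)])
      show "connected ?J" by (intro connected_continuous_image cont) auto
      show "K \<inter> ?J \<noteq> {}" using s by (auto intro: image_eqI[of _ _ s])
    qed
    show "K \<union> ?J \<subseteq> line_in m n" using K' J by auto
    show "K \<union> ?J \<noteq> {}" using s by auto
  qed
  then have "K \<union> ?J = K" by (rule K'(3)) (use K' J in auto)
  then show ?thesis by blast
qed

text \<open>The danger is that the interval of zeros leaves the chart through the line at infinity.
  Then \<open>K\<close> would contain all chart points before the exit; since \<open>K\<close> is
  bounded, \<open>norm (f (q r)) \<le> M * (m \<bullet> f (q r))\<close> would hold up to the exit,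
  where it forces \<open>f\<close> to be 0. Once the whole interval lies in the chart, a box around
  it confines \<open>K\<close>.\<close>

lemma maximal_common_arc_is_zero_interval:
  assumes K: "maximal_common_arc (line_in m n) (curve_in m) K" and n: "n \<noteq> 0" "n \<bullet> f x0 \<noteq> 0"
    and tang: "\<And>s. n \<bullet> f s = 0 \<Longrightarrow> n \<bullet> f' s = 0"
  obtains c d where "zero_interval n c d" "\<And>s. s \<in> {c..d} \<Longrightarrow> 0 < m \<bullet> f s" "K = chart m ` {c..d}"
proof -
  have K': "closed_arc K" "K \<subseteq> line_in m n \<inter> curve_in m"
    using K by (auto simp: maximal_common_arc_def)
  obtain v0 where v0: "v0 \<in> K" using closed_arcD[OF K'(1)] by blast
  then have v0': "m \<bullet> v0 = 1" "n \<bullet> v0 = 0" "\<exists>s. v0 \<times> f s = 0" using K'(2) by (auto simp: line_in_def curve_in_def)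
  \<comment> \<open>A shift by 1 makes \<open>m \<bullet> f s\<close> positive without changing the
    projective point.\<close>
  obtain s where s: "v0 \<times> f s = 0" "0 < m \<bullet> f s"
  proof -
    obtain s where s: "v0 \<times> f s = 0" using v0'(3) by blast
    have "m \<bullet> f s \<noteq> 0" by (rule chart_unique(1)[OF s v0'(1)])
    then have "0 < m \<bullet> f s \<or> 0 < m \<bullet> f (s + 1)" by (auto simp: antiperiodic)
    then consider "0 < m \<bullet> f s" | "0 < m \<bullet> f (s + 1)" by blast
    then show thesis
      by cases (rule that[of s], use s in simp_all, rule that[of "s + 1"], use s in \<open>simp_all add: antiperiodic\<close>)
  qed
  have v0s: "v0 = chart m s" by (rule chart_unique(2)[OF s(1) v0'(1)])
  have ns: "n \<bullet> f s = 0" using v0'(2) s(2) by (simp add: v0s dot_chart)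
  obtain c d where cd: "c \<le> s" "s \<le> d" and zi: "zero_interval n c d"
    by (rule zero_interval_exists[OF ns n(2)]) (rule that)
  have zero: "n \<bullet> f x = 0" if "x \<in> {c..d}" for x using zi that by (auto simp: zero_interval_def)
  have seg: "closed_segment s z \<subseteq> {c..d}" if "z \<in> {c..d}" for z
    using that cd by (auto simp: closed_segment_eq_real_ivl split: if_splits)
  obtain M where M: "M > 0" "\<And>v. v \<in> K \<Longrightarrow> norm v \<le> M"
    using compact_imp_bounded[OF closed_arcD(1)[OF K'(1)]] bounded_pos by metis
  have pos: "0 < m \<bullet> f z" if z: "z \<in> {c..d}" for z
  proof (rule ccontr)
    assume neg: "\<not> 0 < m \<bullet> f z"
    define q where "q = (\<lambda>r. s + r * (z - s))"
    have cq: "continuous_on S (\<lambda>r. f (q r))" for S unfolding q_def by (intro continuous_intros)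
    \<comment> \<open>\<open>Inf R\<close> is the first exit from the half space
      \<open>0 < m \<bullet> v\<close> on the way from \<open>s\<close> to \<open>z\<close>.\<close>
    define R where "R = {0..1} \<inter> {r. m \<bullet> f (q r) \<le> 0}"
    have "closed R" unfolding R_def
      by (intro closed_Int closed_Collect_le continuous_intros cq closed_atLeastAtMost)
    moreover have "1 \<in> R" using neg by (simp add: R_def q_def)
    then have "R \<noteq> {}" by blast
    moreover have bdd: "bdd_below R" by (rule bdd_belowI[of _ 0]) (auto simp: R_def)
    ultimately have r0: "Inf R \<in> R" by (intro closed_contains_Inf)
    have "Inf R \<noteq> 0" using r0 s(2) by (auto simp: R_def q_def)
    then have r01: "0 < Inf R" "Inf R \<le> 1" using r0 by (auto simp: R_def)
    have bound: "norm (f (q r)) \<le> M * (m \<bullet> f (q r))" if r: "0 \<le> r" "r < Inf R" for r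
    proof -
      have qp: "0 < m \<bullet> f (q r')" if "0 \<le> r'" "r' \<le> r" for r'
      proof (rule ccontr)
        assume "\<not> ?thesis"
        then have "r' \<in> R" using that r r01 by (auto simp: R_def)
        then show False using cInf_lower[OF _ bdd, of r'] that r by simp
      qed
      have qin: "q r' \<in> closed_segment s z" if "0 \<le> r'" "r' \<le> 1" for r'
        using that unfolding closed_segment_def q_def
        by (auto intro!: exI[of _ r'] simp: algebra_simps)
      have "chart m ` closed_segment s (q r) \<subseteq> K"
      proof (rule maximal_common_arc_absorbs[OF K n(1)])
        show "chart m s \<in> K" using v0 v0s by simp
        fix x assume "x \<in> closed_segment s (q r)"
        then obtain y where y: "0 \<le> y" "y \<le> 1" "x = (1 - y) *\<^sub>R s + y *\<^sub>R q r" by (auto simp: closed_segment_def)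
        have x: "x = q (y * r)" using y by (simp add: q_def algebra_simps)
        have yr: "0 \<le> y * r" "y * r \<le> 1 * r" using mult_right_mono[OF y(2) r(1)] y r by simp_all
        then have "x \<in> closed_segment s z" unfolding x using r r01 by (intro qin) auto
        then have "n \<bullet> f x = 0" using seg[OF z] zero by blast
        then show "n \<bullet> f x = 0 \<and> 0 < m \<bullet> f x" using qp[of "y * r"] yr x by simp
      qed
      then have "chart m (q r) \<in> K" by auto
      then have "norm (chart m (q r)) \<le> M" by (rule M)
      moreover have "0 < m \<bullet> f (q r)" using qp[of r] r by simp
      ultimately show ?thesis by (simp add: chart_def divide_le_eq)
    qed
    have "closed {r. norm (f (q r)) \<le> M * (m \<bullet> f (q r))}"
      by (intro closed_Collect_le continuous_intros cq)
    then have "closure {0..<Inf R} \<subseteq> {r. norm (f (q r)) \<le> M * (m \<bullet> f (q r))}"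
      by (rule closure_minimal[rotated]) (use bound in auto)
    moreover have "Inf R \<in> closure {0..<Inf R}" using r01 by simp
    ultimately have "norm (f (q (Inf R))) \<le> M * (m \<bullet> f (q (Inf R)))" by blast
    moreover have "M * (m \<bullet> f (q (Inf R))) \<le> 0" using r0 M(1) by (simp add: R_def mult_le_0_iff)
    ultimately have "norm (f (q (Inf R))) \<le> 0" by (rule order_trans)
    then show False using nonzero[of "q (Inf R)"] by simp
  qed
  have sub: "chart m ` {c..d} \<subseteq> K"
  proof
    fix v assume "v \<in> chart m ` {c..d}"
    then obtain z where z: "z \<in> {c..d}" "v = chart m z" by auto
    have "chart m ` closed_segment s z \<subseteq> K"
      by (rule maximal_common_arc_absorbs[OF K n(1)]) (use v0 v0s seg[OF z(1)] zero pos in auto)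
    then show "v \<in> K" using z by auto
  qed
  obtain \<xi> p w u a b \<epsilon> h where gb: "graph_box f f' n m \<xi> p w u a b \<epsilon> h" "a < c" "d < b"
  proof (rule graph_box_exists[of n c d m UNIV 1])
    show "d < c + 1" by (rule zero_interval_short[OF zi n(2)])
  qed (use n cd zero tang pos in auto)
  have v0c: "v0 \<in> chart m ` {c..d}" unfolding v0s using cd by (intro imageI) simp
  interpret zb: zero_box f f' n m \<xi> p w u a b \<epsilon> h c d by (rule zero_boxI[OF gb zi])
  have "K \<subseteq> chart m ` {c..d}"
    by (rule zb.connected_common_part[OF closed_arcD(2)[OF K'(1)] K'(2) v0 v0c])
  with sub have "K = chart m ` {c..d}" by blast
  then show ?thesis using zi pos by (intro that[of c d])
qed

lemma curve_sets:
  assumes \<gamma>: "\<And>s. \<gamma> s = span {f s}"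
  shows "{v \<in> affine_chart m. span {v} \<subseteq> {v. n \<bullet> v = 0}} = line_in m n"
    and "{v \<in> affine_chart m. span {v} \<in> range \<gamma>} = curve_in m"
proof -
  have "span {v} \<subseteq> {v. n \<bullet> v = 0} \<longleftrightarrow> n \<bullet> v = 0" for v :: "real^3"
    using span_base[of v "{v}"] by (auto simp: span_singleton)
  then show "{v \<in> affine_chart m. span {v} \<subseteq> {v. n \<bullet> v = 0}} = line_in m n"
    by (auto simp: affine_chart_def line_in_def)
  have "span {v} \<in> range \<gamma> \<longleftrightarrow> (\<exists>s. v \<times> f s = 0)" if "m \<bullet> v = 1" for v
  proof -
    have "v \<noteq> 0" using that by auto
    then have "span {v} = \<gamma> s \<longleftrightarrow> v \<times> f s = 0" for s
      unfolding \<gamma> by (rule span_singleton_eq_iff_cross) (rule nonzero)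
    then show ?thesis by (auto simp: image_iff)
  qed
  then show "{v \<in> affine_chart m. span {v} \<in> range \<gamma>} = curve_in m"
    by (auto simp: affine_chart_def curve_in_def)
qed

lemma span_chart:
  assumes "m \<bullet> f s \<noteq> 0"
  shows "span {chart m s} = span {f s}"
  by (subst span_singleton_eq_iff_cross) (use assms nonzero chart_cross in \<open>auto simp: chart_def\<close>)

end

text \<open>\<open>n\<close> stands for the tangent normal at a clean point, with the sign that
  makes it nonnegative after \<open>t\<close>; \<open>x0\<close> witnesses that the curve is not
  contained in its tangent line.\<close>

locale clean_tangent = antiperiodic_curve +
  fixes n :: "real^3" and t x0 :: real
  assumes n_nonzero: "n \<noteq> 0"
    and at_t: "n \<bullet> f t = 0" "n \<bullet> f' t = 0"
    and nonneg: "\<And>x. x \<in> {0..1} \<Longrightarrow> 0 \<le> n \<bullet> f (t + x)"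
    and x0: "n \<bullet> f x0 \<noteq> 0"
begin

lemma sign_after: "t \<le> s \<Longrightarrow> s \<le> t + 1 \<Longrightarrow> 0 \<le> n \<bullet> f s"
  using nonneg[of "s - t"] by simp

lemma sign_before: "t - 1 \<le> s \<Longrightarrow> s \<le> t \<Longrightarrow> n \<bullet> f s \<le> 0"
  using sign_after[of "s + 1"] by (simp add: antiperiodic)

text \<open>Every zero has a translate in \<open>[t, t + 1[\<close>, which is \<open>t\<close>
  itself or an interior minimum. So the line is tangent to the curve wherever they meet, as a box
  requires.\<close>

lemma tangent_at_zero:
  assumes "n \<bullet> f s = 0"
  shows "n \<bullet> f' s = 0"
proof -
  obtain k where k: "t \<le> s + of_int k" "s + of_int k < t + 1" by (rule reduce_int)
  have z: "n \<bullet> f (s + of_int k) = 0" using assms dot_shift_zero_iff by simp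
  have "n \<bullet> f' (s + of_int k) = 0"
  proof (cases "s + of_int k = t")
    case True then show ?thesis using at_t by simp
  next
    case False
    then show ?thesis using k z nonneg by (intro deriv_zero_at_min[of n t]) auto
  qed
  then show ?thesis by (simp add: deriv_shift_int split: if_splits)
qed

text \<open>A crossing in any chart comes from an interval \<open>[c, d]\<close> of zeros.
  Translated into the period from \<open>a\<close>, this interval either meets \<open>[a, b]\<close>
  and then coincides with it, or lies strictly between \<open>b\<close> and \<open>a + 1\<close>,
  where \<open>n \<bullet> f\<close> is nonnegative and no crossing can occur.\<close>

lemma crossing_arc_unique:
  assumes ab: "zero_interval n a b" "a \<le> t" "t \<le> b"
    and cr: "crosses_in (affine_chart m) (line_in m n) (curve_in m) K"
    and \<gamma>: "\<And>s. \<gamma> s = span {f s}"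
  shows "(\<lambda>v. span {v}) ` K = \<gamma> ` {a..b}"
proof -
  have max: "maximal_common_arc (line_in m n) (curve_in m) K" using cr by (simp add: crosses_in_def)
  obtain c d where cd: "zero_interval n c d" "\<And>s. s \<in> {c..d} \<Longrightarrow> 0 < m \<bullet> f s" "K = chart m ` {c..d}"
    by (rule maximal_common_arc_is_zero_interval[OF max n_nonzero x0 tangent_at_zero], assumption) (rule that)
  obtain k where k: "a \<le> c + of_int k" "c + of_int k < a + 1" by (rule reduce_int)
  let ?c = "c + of_int k" and ?d = "d + of_int k"
  have zi: "zero_interval n ?c ?d" by (rule zero_interval_shift[OF cd(1)])
  have cd_le: "c \<le> d" using cd(1) by (simp add: zero_interval_def)
  have "span {chart m s} = \<gamma> s" if "s \<in> {c..d}" for s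
    unfolding \<gamma> using cd(2)[OF that] by (intro span_chart) simp
  then have K\<gamma>: "(\<lambda>v. span {v}) ` K = \<gamma> ` {c..d}" unfolding cd(3) by (simp add: image_image)
  have shift\<gamma>: "\<gamma> (s + of_int k) = \<gamma> s" for s
    unfolding \<gamma> by (subst span_singleton_eq_iff_cross) (auto simp: nonzero shift_int)
  have "?c \<le> b"
  proof (rule ccontr)
    assume "\<not> ?c \<le> b"
    then have bc: "b < ?c" by simp
    \<comment> \<open>Otherwise zeros would fill a left neighbourhood of \<open>a + 1\<close>, and
      after a shift one of \<open>a\<close>, against left maximality.\<close>
    have da: "?d < a + 1"
    proof (rule ccontr)
      assume nd: "\<not> ?d < a + 1"
      have "a + 1 - ?c > 0" using k by simp
      then obtain s where s: "a - (a + 1 - ?c) < s" "s < a" "n \<bullet> f s \<noteq> 0"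
        using ab(1) unfolding zero_interval_def by blast
      then have "s + 1 \<in> {?c..?d}" using nd by auto
      then have "n \<bullet> f (s + 1) = 0" using zi unfolding zero_interval_def by blast
      then show False using s(3) by (simp add: antiperiodic)
    qed
    define r where "r = min (?c - b) (a + 1 - ?d)"
    have r: "r > 0" using bc da by (simp add: r_def)
    \<comment> \<open>The box is built at \<open>[c, d]\<close> instead of its translate, and
      \<open>\<tau>\<close> compensates the sign of \<open>f\<close> under an odd shift.\<close>
    define \<tau> :: real where "\<tau> = (if even k then 1 else -1)"
    define n' where "n' = \<tau> *\<^sub>R n"
    have n'_zero: "n' \<bullet> v = 0 \<longleftrightarrow> n \<bullet> v = 0" for v by (simp add: n'_def \<tau>_def)
    have sign: "0 \<le> n' \<bullet> f s" if "c - r \<le> s" "s \<le> d + r" for s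
    proof -
      have "t \<le> s + of_int k" "s + of_int k \<le> t + 1" using that ab by (auto simp: r_def)
      then have "0 \<le> n \<bullet> f (s + of_int k)" by (rule sign_after)
      then show ?thesis by (simp add: n'_def \<tau>_def shift_int split: if_splits)
    qed
    obtain B P Q U S T where cr': "open_subarc B (line_in m n)" "K \<subseteq> B" "P \<noteq> Q"
      "components (B - K) = {P, Q}" "openin (top_of_set (affine_chart m)) U" "B \<subseteq> U"
      "S \<noteq> T" "components (U - curve_in m) = {S, T}" "P \<subseteq> closure S" "Q \<subseteq> closure T"
      using cr unfolding crosses_in_def by (elim conjE exE) (rule that)
    obtain E where E: "open E" "U = affine_chart m \<inter> E" using cr'(5) unfolding openin_open by blast
    have dc: "d < c + 1" by (rule zero_interval_short[OF cd(1) x0])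
    have line: "line_in m n' = line_in m n" by (simp add: line_in_def n'_zero)
    have zi': "zero_interval n' c d" using cd(1) by (simp add: zero_interval_def n'_zero)
    have zero: "n \<bullet> f s = 0" if "s \<in> {c..d}" for s using cd(1) that unfolding zero_interval_def by blast
    obtain \<xi> p w u a' b' \<epsilon> h where gb: "graph_box f f' n' m \<xi> p w u a' b' \<epsilon> h" "a' < c" "d < b'"
      "c - r < a'" "b' < d + r"
      "\<And>v. m \<bullet> v = 1 \<Longrightarrow> \<xi> \<bullet> chart m a' < \<xi> \<bullet> v \<Longrightarrow> \<xi> \<bullet> v < \<xi> \<bullet> chart m b' \<Longrightarrow> \<bar>n' \<bullet> v\<bar> < \<epsilon> \<Longrightarrow> v \<in> E"
    proof (rule graph_box_exists[of n' c d m E r])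
      show "n' \<noteq> 0" using n_nonzero by (simp add: n'_def \<tau>_def)
      show "chart m s \<in> E" if "s \<in> {c..d}" for s
        using cr'(2,6) E(2) that unfolding cd(3) by blast
      show "n' \<bullet> f s = 0 \<and> n' \<bullet> f' s = 0" if "s \<in> {c..d}" for s
        unfolding n'_zero using zero[OF that] tangent_at_zero by blast
    qed (use cd_le dc cd(2) E(1) r in auto)
    interpret zb: zero_box f f' n' m \<xi> p w u a' b' \<epsilon> h c d by (rule zero_boxI[OF gb(1-3) zi'])
    show False
    proof (rule zb.not_crosses_if_same_sign[of B P Q U S T])
      show "0 \<le> n' \<bullet> f s" if "s \<in> {a'..b'}" for s using sign[of s] that gb by auto
      show "zb.box \<subseteq> U" unfolding E(2) zb.box_def zb.X_def affine_chart_def using gb(6) by blast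
      show "U \<subseteq> affine_chart m" using E(2) by simp
    qed (use cr' cd(3) line in auto)
  qed
  then have "?c = a \<and> ?d = b" using zero_interval_eq[OF ab(1) zi k(1)] by simp
  moreover have "(\<lambda>s. s + of_int k) ` {c..d} = {?c..?d}" by (rule image_add_atLeastAtMost')
  ultimately have "\<gamma> ` {a..b} = \<gamma> ` (\<lambda>s. s + of_int k) ` {c..d}" by simp
  also have "\<dots> = \<gamma> ` {c..d}" unfolding image_image shift\<gamma> ..
  finally show ?thesis unfolding K\<gamma> ..
qed

text \<open>The chart must contain the whole arc. As \<open>[a, b]\<close> is shorter than 1, the
  support functional at \<open>q\<close> is positive on it; \<open>q\<close> is chosen so that
  \<open>[a, b]\<close> is centred in \<open>[q, q + 1]\<close>.\<close>

lemma crossing_arc_exists: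
  assumes ab: "zero_interval n a b" "a \<le> t" "t \<le> b"
  obtains m where "m \<noteq> 0" "\<And>s. s \<in> {a..b} \<Longrightarrow> 0 < m \<bullet> f s"
    "crosses_in (affine_chart m) (line_in m n) (curve_in m) (chart m ` {a..b})"
proof -
  have ba: "b < a + 1" by (rule zero_interval_short[OF ab(1) x0])
  define q where "q = (a + b - 1) / 2"
  have q: "q < a" "b < q + 1" using ba by (auto simp: q_def field_simps)
  obtain m where m: "m \<bullet> f q = 0" "0 < m \<bullet> f' q"
    "\<And>s. q < s \<Longrightarrow> s < q + 1 \<Longrightarrow> 0 < m \<bullet> f s" "\<And>s. q - 1 < s \<Longrightarrow> s < q \<Longrightarrow> m \<bullet> f s < 0"
    by (rule supportE[of q]) (rule that)
  have pos: "0 < m \<bullet> f s" if "s \<in> {a..b}" for s using m(3)[of s] q that by auto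
  have zero: "n \<bullet> f s = 0" if "s \<in> {a..b}" for s using ab(1) that unfolding zero_interval_def by blast
  \<comment> \<open>This keeps the parameters of the box within \<open>[t - 1, t + 1]\<close>, where
    the sign of \<open>n \<bullet> f\<close> is known.\<close>
  define r where "r = min (a - (t - 1)) (t + 1 - b)"
  have r: "r > 0" using ab ba by (auto simp: r_def)
  obtain \<xi> p w u a' b' \<epsilon> h where gb: "graph_box f f' n m \<xi> p w u a' b' \<epsilon> h" "a' < a" "b < b'"
    "a - r < a'" "b' < b + r"
    by (rule graph_box_exists[of n a b m UNIV r])
       (use n_nonzero ab ba zero tangent_at_zero pos r in auto)
  interpret zb: zero_box f f' n m \<xi> p w u a' b' \<epsilon> h a b by (rule zero_boxI[OF gb(1-3) ab(1)])
  have "crosses_in (affine_chart m) (line_in m n) (curve_in m) (chart m ` {a..b})"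
  proof (rule zb.crosses_if_sign_change)
    show "n \<bullet> f s \<le> 0" if "s \<in> {a'..a}" for s
      using that gb ab by (intro sign_before) (auto simp: r_def)
    show "0 \<le> n \<bullet> f s" if "s \<in> {b..b'}" for s
      using that gb ab by (intro sign_after) (auto simp: r_def)
  qed
  moreover have "m \<noteq> 0" using m(2) by auto
  ultimately show ?thesis using pos by (intro that)
qed

text \<open>Crossing arcs are compared as sets of projective points, so all charts lead to one arc:
  the image under \<open>\<gamma>\<close> of the interval of zeros around \<open>t\<close>.\<close>

theorem crosses_only_once:
  assumes \<gamma>: "\<And>s. \<gamma> s = span {f s}"
  shows "crosses_only_once {v. n \<bullet> v = 0} \<gamma>"
proof -
  obtain a b where ab: "a \<le> t" "t \<le> b" "zero_interval n a b"
    by (rule zero_interval_exists[OF at_t(1) x0]) (rule that)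
  obtain m where m: "m \<noteq> 0" "\<And>s. s \<in> {a..b} \<Longrightarrow> 0 < m \<bullet> f s"
    "crosses_in (affine_chart m) (line_in m n) (curve_in m) (chart m ` {a..b})"
    by (rule crossing_arc_exists[OF ab(3,1,2)]) (rule that)
  have eq: "line_crosses_in {v. n \<bullet> v = 0} \<gamma> \<alpha> \<longleftrightarrow>
      (\<exists>m K. m \<noteq> 0 \<and> crosses_in (affine_chart m) (line_in m n) (curve_in m) K \<and> \<alpha> = (\<lambda>v. span {v}) ` K)" for \<alpha>
    unfolding line_crosses_in_def curve_sets[OF \<gamma>] ..
  show ?thesis unfolding crosses_only_once_def
  proof (rule ex1I[of _ "\<gamma> ` {a..b}"])
    have "(\<lambda>v. span {v}) ` chart m ` {a..b} = \<gamma> ` {a..b}"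
      by (rule crossing_arc_unique[OF ab(3,1,2) m(3) \<gamma>])
    then show "line_crosses_in {v. n \<bullet> v = 0} \<gamma> (\<gamma> ` {a..b})"
      unfolding eq using m(1,3) by (intro exI[of _ m] exI[of _ "chart m ` {a..b}"]) simp
  next
    fix \<alpha> assume "line_crosses_in {v. n \<bullet> v = 0} \<gamma> \<alpha>"
    then show "\<alpha> = \<gamma> ` {a..b}" unfolding eq using crossing_arc_unique[OF ab(3,1,2) _ \<gamma>] by blast
  qed
qed

end

section \<open>The antiperiodic lift\<close>

text \<open>For the reverse inclusion, the four-point relation of \<open>a\<close>,
  \<open>b\<close>, \<open>v\<close> and \<open>g = a \<times> b\<close> expresses
  \<open>(g \<bullet> g) *\<^sub>R v\<close> by \<open>a\<close> and \<open>b\<close>, because the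
  coefficient of \<open>g\<close> vanishes on the plane.\<close>

lemma span_pair_eq_plane:
  fixes a b :: "real^3"
  assumes "a \<times> b \<noteq> 0"
  shows "span {a, b} = {v. (a \<times> b) \<bullet> v = 0}"
proof (intro equalityI subsetI)
  have "subspace {v. (a \<times> b) \<bullet> v = 0}" by (rule subspace_hyperplane)
  then have "span {a, b} \<subseteq> {v. (a \<times> b) \<bullet> v = 0}"
    by (rule span_minimal[rotated]) (auto simp: dot_cross_self)
  then show "v \<in> {v. (a \<times> b) \<bullet> v = 0}" if "v \<in> span {a, b}" for v using that by blast
next
  fix v assume "v \<in> {v. (a \<times> b) \<bullet> v = 0}"
  then have v: "a \<bullet> (b \<times> v) = 0" by (simp add: cross3_simps)
  define g where "g = a \<times> b"
  have g: "a \<bullet> (b \<times> g) = g \<bullet> g" by (simp add: g_def cross3_simps)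
  then have "(g \<bullet> g) *\<^sub>R v = (b \<bullet> (g \<times> v)) *\<^sub>R a - (a \<bullet> (g \<times> v)) *\<^sub>R b"
    using four_point_relation[of b g v a] v by simp
  also have "\<dots> \<in> span {a, b}" by (intro span_diff span_scale span_base) auto
  finally have "(1 / (g \<bullet> g)) *\<^sub>R ((g \<bullet> g) *\<^sub>R v) \<in> span {a, b}" by (rule span_scale)
  then show "v \<in> span {a, b}" using assms by (simp add: g_def)
qed

lemma cross_nonzero_if_dim_2:
  fixes a b :: "real^3"
  assumes "dim {a, b} = 2"
  shows "a \<times> b \<noteq> 0"
proof
  assume 0: "a \<times> b = 0"
  have a: "a \<noteq> 0"
  proof
    assume "a = 0"
    then have "{a, b} \<subseteq> span {b}" by (auto intro: span_base span_0)
    then have "dim {a, b} \<le> card {b}" by (rule dim_le_card) simp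
    with assms show False by simp
  qed
  have "a \<times> (a \<times> b) = (a \<bullet> b) *\<^sub>R a - (a \<bullet> a) *\<^sub>R b" by (rule Lagrange)
  then have "(1 / (a \<bullet> a)) *\<^sub>R ((a \<bullet> a) *\<^sub>R b) = (1 / (a \<bullet> a)) *\<^sub>R ((a \<bullet> b) *\<^sub>R a)" using 0 by simp
  then have "b = ((a \<bullet> b) / (a \<bullet> a)) *\<^sub>R a" using a by simp
  then have "b \<in> span {a}" by (metis span_base span_scale singletonI)
  then have "{a, b} \<subseteq> span {a}" by (auto intro: span_base)
  then have "dim {a, b} \<le> card {a}" by (rule dim_le_card) simp
  with assms show False by simp
qed

lemma proj_line_eq_plane:
  assumes "proj_line L"
  obtains m where "m \<noteq> 0" "L = {v. m \<bullet> v = 0}"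
proof -
  have L: "subspace L" "dim L = 2" using assms by (auto simp: proj_line_def)
  then obtain m where m: "m \<noteq> 0" "span L \<subseteq> {v. m \<bullet> v = 0}"
    using lowdim_subset_hyperplane[of L] by auto
  have "L \<subseteq> {v. m \<bullet> v = 0}" using m(2) span_superset by blast
  then have "L = {v. m \<bullet> v = 0}"
    by (intro subspace_dim_equal L subspace_hyperplane) (use m L in \<open>simp_all add: dim_hyperplane\<close>)
  with m(1) show ?thesis by (rule that)
qed

lemma C1_lift_deriv:
  assumes "C1_lift \<gamma> t F"
  obtains e F' where "e > 0" "\<And>s. s \<in> ball t e \<Longrightarrow> (F has_vector_derivative F' s) (at s)"
    "continuous_on (ball t e) F'" "\<And>s. s \<in> ball t e \<Longrightarrow> F s \<noteq> 0 \<and> \<gamma> s = span {F s}"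
    "F' t = vderiv F t"
proof -
  from assms obtain e where e: "e > 0" "F C1_differentiable_on ball t e"
    "\<And>s. s \<in> ball t e \<Longrightarrow> F s \<noteq> 0 \<and> \<gamma> s = span {F s}" unfolding C1_lift_def by blast
  from e(2) have d: "\<And>s. s \<in> ball t e \<Longrightarrow> F differentiable at s" "continuous_on (ball t e) (vderiv F)"
    by (auto simp: C1_differentiable_on_eq)
  show ?thesis
    by (rule that[of e "vderiv F"]) (use e d in \<open>auto simp: vector_derivative_works[symmetric]\<close>)
qed

text \<open>Rescaling by \<open>c\<close> multiplies the cross product of lift and derivative by
  \<open>c * c\<close>, since the term with \<open>c'\<close> is parallel to \<open>F\<close>; so
  regularity survives on the sphere.\<close>

lemma normalized_deriv:
  fixes F F' :: "real \<Rightarrow> real^3"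
  assumes F: "\<And>s. s \<in> A \<Longrightarrow> (F has_vector_derivative F' s) (at s)"
    and F': "continuous_on A F'" and nz: "\<And>s. s \<in> A \<Longrightarrow> F s \<noteq> 0"
  obtains D where "\<And>s. s \<in> A \<Longrightarrow> ((\<lambda>s. (1 / norm (F s)) *\<^sub>R F s) has_vector_derivative D s) (at s)"
    "continuous_on A D" "\<And>s. s \<in> A \<Longrightarrow> F s \<times> F' s \<noteq> 0 \<Longrightarrow> ((1 / norm (F s)) *\<^sub>R F s) \<times> D s \<noteq> 0"
proof -
  define c where "c = (\<lambda>s. 1 / norm (F s))"
  define c' where "c' = (\<lambda>s. - (F s \<bullet> F' s) / (norm (F s) * (norm (F s))\<^sup>2))"
  define D where "D = (\<lambda>s. c s *\<^sub>R F' s + c' s *\<^sub>R F s)"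
  have contF: "continuous_on A F"
    using F has_vector_derivative_continuous by (blast intro: continuous_at_imp_continuous_on)
  have dc: "(c has_real_derivative c' s) (at s)" if s: "s \<in> A" for s
  proof -
    have pos: "0 < F s \<bullet> F s" using nz[OF s] by simp
    have "((\<lambda>s. F s \<bullet> F s) has_vector_derivative (F s \<bullet> F' s + F' s \<bullet> F s)) (at s)"
      by (rule bounded_bilinear.has_vector_derivative[OF bounded_bilinear_inner F[OF s] F[OF s]])
    then have d: "((\<lambda>s. F s \<bullet> F s) has_real_derivative 2 * (F s \<bullet> F' s)) (at s)"
      by (simp add: has_real_derivative_iff_has_vector_derivative inner_commute)
    have "((\<lambda>s. sqrt (F s \<bullet> F s)) has_real_derivative (inverse (sqrt (F s \<bullet> F s)) / 2) * (2 * (F s \<bullet> F' s))) (at s)"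
      by (rule DERIV_chain2[OF DERIV_real_sqrt[OF pos] d])
    then have dn: "((\<lambda>s. norm (F s)) has_real_derivative (F s \<bullet> F' s) / norm (F s)) (at s)"
      by (simp add: norm_eq_sqrt_inner field_simps)
    show ?thesis unfolding c_def c'_def
      by (rule DERIV_cong[OF DERIV_divide[OF DERIV_const dn]])
         (use nz[OF s] in \<open>simp_all add: power2_eq_square\<close>)
  qed
  have D: "((\<lambda>s. c s *\<^sub>R F s) has_vector_derivative D s) (at s)" if "s \<in> A" for s
    unfolding D_def by (rule has_vector_derivative_scaleR[OF dc[OF that] F[OF that]])
  moreover have "continuous_on A D" unfolding D_def c_def c'_def
    by (intro continuous_intros F' contF) (use nz in auto)
  moreover have "(c s *\<^sub>R F s) \<times> D s \<noteq> 0" if "s \<in> A" "F s \<times> F' s \<noteq> 0" for s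
  proof -
    have "(c s *\<^sub>R F s) \<times> D s = (c s * c s) *\<^sub>R (F s \<times> F' s)"
      by (simp add: D_def cross_mult_left cross_mult_right cross_add_right)
    moreover have "c s \<noteq> 0" using nz[OF that(1)] by (simp add: c_def)
    ultimately show ?thesis using that(2) by simp
  qed
  ultimately show ?thesis unfolding c_def by (rule that)
qed

lemma simple_closed_shift_int: "simple_closed \<gamma> \<Longrightarrow> \<gamma> (s + of_int k) = \<gamma> s"
  by (rule periodic_add_int[of \<gamma>]) (simp add: simple_closed_def)

lemma simple_closed_distinct:
  assumes "simple_closed \<gamma>" "t < s" "s < t + 1"
  shows "\<gamma> s \<noteq> \<gamma> t"
proof
  assume eq: "\<gamma> s = \<gamma> t"
  have "\<gamma> (frac x) = \<gamma> x" for x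
    using simple_closed_shift_int[OF assms(1), of x "- \<lfloor>x\<rfloor>"] by (simp add: frac_def)
  then have "\<gamma> (frac s) = \<gamma> (frac t)" using eq by simp
  moreover have "inj_on \<gamma> {0..<1}" using assms(1) by (simp add: simple_closed_def)
  ultimately have "frac s = frac t" by (auto simp: inj_on_def frac_lt_1)
  then have "s - t = of_int (\<lfloor>s\<rfloor> - \<lfloor>t\<rfloor>)" by (simp add: frac_def algebra_simps)
  moreover from this have "0 < \<lfloor>s\<rfloor> - \<lfloor>t\<rfloor>" "\<lfloor>s\<rfloor> - \<lfloor>t\<rfloor> < 1" using assms(2,3) by linarith+
  ultimately show False by simp
qed

lemma anti_convex_plane:
  assumes "anti_convex \<gamma>"
  obtains m where "m \<noteq> 0" "\<gamma> t \<subseteq> {v. m \<bullet> v = 0}" "tangent_line \<gamma> t \<noteq> {v. m \<bullet> v = 0}"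
    "\<And>s. t < s \<Longrightarrow> s < t + 1 \<Longrightarrow> \<not> \<gamma> s \<subseteq> {v. m \<bullet> v = 0}"
proof -
  obtain L where L: "proj_line L" "transversal \<gamma> L" "{q \<in> range \<gamma>. q \<subseteq> L} = {\<gamma> t}"
    using assms unfolding anti_convex_def by blast
  obtain m where m: "m \<noteq> 0" "L = {v. m \<bullet> v = 0}" by (rule proj_line_eq_plane[OF L(1)])
  have "\<gamma> t \<subseteq> L" using L(3) by blast
  moreover from this have "tangent_line \<gamma> t \<noteq> L" using L(2) by (simp add: transversal_def)
  moreover have "\<not> \<gamma> s \<subseteq> L" if "t < s" "s < t + 1" for s
  proof
    assume "\<gamma> s \<subseteq> L"
    then have "\<gamma> s = \<gamma> t" using L(3) by blast
    then show False using simple_closed_distinct[OF _ that] assms by (simp add: anti_convex_def)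
  qed
  ultimately show ?thesis using m by (intro that[of m]) auto
qed

text \<open>A line meeting the curve only at \<open>\<gamma> 0\<close> determines on which of the two rays of \<open>\<gamma> s\<close> the
  lift to the sphere lies, for \<open>0 < s < 1\<close>.\<close>

lemma sphere_lift_exists:
  assumes ac: "anti_convex \<gamma>"
  obtains f where "\<And>s. f (s + 1) = - f s" "\<And>s. \<gamma> s = span {f s}"
    "\<And>t. \<exists>e>0. \<exists>D. (\<forall>s\<in>ball t e. (f has_vector_derivative D s) (at s)) \<and> continuous_on (ball t e) D \<and> f t \<times> D t \<noteq> 0"
proof -
  have sc: "simple_closed \<gamma>" and reg: "C1_regular \<gamma>" using ac by (auto simp: anti_convex_def)
  have lift: "\<exists>F F' e. e > 0 \<and> (\<forall>s\<in>ball t e. (F has_vector_derivative F' s) (at s) \<and> F s \<noteq> 0 \<and> \<gamma> s = span {F s})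
    \<and> continuous_on (ball t e) F' \<and> F t \<times> F' t \<noteq> 0 \<and> tangent_line \<gamma> t = span {F t, F' t}" for t
  proof -
    obtain F where F: "C1_lift \<gamma> t F" "dim {F t, vderiv F t} = 2" using reg by (auto simp: C1_regular_def)
    obtain e F' where e: "e > 0" "\<And>s. s \<in> ball t e \<Longrightarrow> (F has_vector_derivative F' s) (at s)"
      "continuous_on (ball t e) F'" "\<And>s. s \<in> ball t e \<Longrightarrow> F s \<noteq> 0 \<and> \<gamma> s = span {F s}"
      "F' t = vderiv F t"
      by (rule C1_lift_deriv[OF F(1)]) (rule that)
    show ?thesis
      using e cross_nonzero_if_dim_2[OF F(2)] tangent_line_eq[OF F(1)]
      by (intro exI[of _ F] exI[of _ F'] exI[of _ e]) auto
  qed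
  obtain m where m: "m \<noteq> 0" "\<gamma> 0 \<subseteq> {v. m \<bullet> v = 0}" "tangent_line \<gamma> 0 \<noteq> {v. m \<bullet> v = 0}"
    "\<And>s. 0 < s \<Longrightarrow> s < 0 + 1 \<Longrightarrow> \<not> \<gamma> s \<subseteq> {v. m \<bullet> v = 0}"
    by (rule anti_convex_plane[OF ac, of 0]) (rule that)
  have m_nonzero: "m \<bullet> v \<noteq> 0" if "0 < s" "s < 1" "\<gamma> s = span {v}" for s v
    using m(4)[of s] that by (auto simp: span_singleton)
  \<comment> \<open>By transversality \<open>m \<bullet> F\<close> has a nonzero derivative at 0.
    The sign is chosen so that the local lift is positive for \<open>m\<close> just after 0 and
    negative just before.\<close>
  obtain F\<^sub>0 F\<^sub>0' e\<^sub>0 where F0: "e\<^sub>0 > 0" "\<And>s. s \<in> ball 0 e\<^sub>0 \<Longrightarrow> (F\<^sub>0 has_vector_derivative F\<^sub>0' s) (at s)"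
    "\<And>s. s \<in> ball 0 e\<^sub>0 \<Longrightarrow> F\<^sub>0 s \<noteq> 0 \<and> \<gamma> s = span {F\<^sub>0 s}" "continuous_on (ball 0 e\<^sub>0) F\<^sub>0'"
    "F\<^sub>0 0 \<times> F\<^sub>0' 0 \<noteq> 0" "0 < m \<bullet> F\<^sub>0' 0"
  proof -
    obtain F F' e where F: "e > 0" "\<forall>s\<in>ball 0 e. (F has_vector_derivative F' s) (at s) \<and> F s \<noteq> 0 \<and> \<gamma> s = span {F s}"
      "continuous_on (ball 0 e) F'" "F 0 \<times> F' 0 \<noteq> 0" "tangent_line \<gamma> 0 = span {F 0, F' 0}"
      using lift[of 0] by blast
    have mF: "m \<bullet> F 0 = 0" using m(2) F(1,2) span_base[of "F 0" "{F 0}"] by auto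
    have "m \<bullet> F' 0 \<noteq> 0"
    proof
      assume mF': "m \<bullet> F' 0 = 0"
      define k where "k = (m \<bullet> (F 0 \<times> F' 0)) / ((F 0 \<times> F' 0) \<bullet> (F 0 \<times> F' 0))"
      have k: "m = k *\<^sub>R (F 0 \<times> F' 0)" unfolding k_def by (rule parallel_to_cross[OF mF mF' F(4)])
      then have "k \<noteq> 0" using m(1) by auto
      then have "{v. m \<bullet> v = 0} = {v. (F 0 \<times> F' 0) \<bullet> v = 0}" by (subst k) simp
      then show False using m(3) F(5) span_pair_eq_plane[OF F(4)] by simp
    qed
    then have "0 < m \<bullet> F' 0 \<or> 0 < m \<bullet> - F' 0" by auto
    then consider "0 < m \<bullet> F' 0" | "0 < m \<bullet> - F' 0" by blast
    then show thesis
    proof cases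
      case 1
      show thesis by (rule that[of e F F']) (use F 1 in auto)
    next
      case 2
      have "span {- F s} = span {F s}" if "s \<in> ball 0 e" for s
        using F(2) that by (subst span_singleton_eq_iff_cross) auto
      then show thesis
        by (intro that[of e "\<lambda>s. - F s" "\<lambda>s. - F' s"])
           (use F 2 in \<open>auto intro!: has_vector_derivative_minus continuous_on_minus\<close>)
    qed
  qed
  define unit where "unit = (\<lambda>v :: real^3. (1 / norm v) *\<^sub>R v)"
  have unit_span: "span {unit v} = span {v}" if "v \<noteq> 0" for v
    by (subst span_singleton_eq_iff_cross) (use that in \<open>auto simp: unit_def cross_mult_left\<close>)
  have unit_eq: "unit v = unit w" if "span {v} = span {w}" "0 < m \<bullet> v" "0 < m \<bullet> w" for v w
  proof -
    have "v \<in> span {w}" using that(1) span_base[of v "{v}"] by simp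
    then obtain k where k: "v = k *\<^sub>R w" by (auto simp: span_singleton)
    then have "k > 0" using that(2,3) by (auto simp: zero_less_mult_iff)
    then show ?thesis using k by (simp add: unit_def)
  qed
  \<comment> \<open>Only one ray of \<open>\<gamma> s\<close> is positive for \<open>m\<close>, so
    normalising to length 1 makes the choice irrelevant. At 0, where \<open>m\<close> vanishes, the
    local lift decides.\<close>
  define H where "H = (\<lambda>s. if s = 0 then unit (F\<^sub>0 0) else unit (SOME v. \<gamma> s = span {v} \<and> 0 < m \<bullet> v))"
  have H: "H s = unit v" if "0 < s" "s < 1" "\<gamma> s = span {v}" "0 < m \<bullet> v" for s v
  proof -
    have "\<gamma> s = span {SOME v. \<gamma> s = span {v} \<and> 0 < m \<bullet> v} \<and> 0 < m \<bullet> (SOME v. \<gamma> s = span {v} \<and> 0 < m \<bullet> v)"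
      by (rule someI[of _ v]) (use that in auto)
    then show ?thesis using that unfolding H_def by (simp, intro unit_eq) auto
  qed
  define f where "f = (\<lambda>s. if even \<lfloor>s\<rfloor> then H (frac s) else - H (frac s))"
  have anti: "f (s + 1) = - f s" for s by (auto simp: f_def frac_def)
  have f01: "f s = H s" if "0 \<le> s" "s < 1" for s
    using that by (simp add: f_def frac_eq floor_eq_iff[of s 0, THEN iffD2])
  have fneg: "f s = - H (s + 1)" if "- 1 \<le> s" "s < 0" for s
    using anti[of s] f01[of "s + 1"] that by simp
  have good0: "\<exists>e>0. \<exists>F F'. (\<forall>s\<in>ball t e. (F has_vector_derivative F' s) (at s) \<and> F s \<noteq> 0 \<and> f s = unit (F s))
     \<and> continuous_on (ball t e) F' \<and> F t \<times> F' t \<noteq> 0" if t: "0 \<le> t" "t < 1" for t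
  proof (cases "t = 0")
    case True
    have "((\<lambda>s. m \<bullet> F\<^sub>0 s) has_real_derivative m \<bullet> F\<^sub>0' 0) (at 0)"
      unfolding has_real_derivative_iff_has_vector_derivative
      by (rule bounded_linear.has_vector_derivative[OF bounded_linear_inner_right F0(2)]) (use F0(1) in simp)
    note der = this
    have mF0: "m \<bullet> F\<^sub>0 0 = 0" using m(2) F0(1) F0(3)[of 0] span_base[of "F\<^sub>0 0" "{F\<^sub>0 0}"] by auto
    obtain d1 where d1: "d1 > 0" "\<And>h. 0 < h \<Longrightarrow> h < d1 \<Longrightarrow> 0 < m \<bullet> F\<^sub>0 h"
      using DERIV_pos_inc_right[OF der F0(6)] mF0 by auto
    obtain d2 where d2: "d2 > 0" "\<And>h. 0 < h \<Longrightarrow> h < d2 \<Longrightarrow> m \<bullet> F\<^sub>0 (- h) < 0"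
      using DERIV_pos_inc_left[OF der F0(6)] mF0 by auto
    define e where "e = min (min d1 d2) (min e\<^sub>0 1)"
    have e: "e > 0" "e \<le> d1" "e \<le> d2" "e \<le> e\<^sub>0" "e \<le> 1" using d1 d2 F0 by (auto simp: e_def)
    have sub: "s \<in> ball 0 e\<^sub>0" if "s \<in> ball 0 e" for s using that e by auto
    have "f s = unit (F\<^sub>0 s)" if s: "s \<in> ball 0 e" for s
    proof -
      have se: "- e < s" "s < e" using s by auto
      have \<gamma>s: "\<gamma> s = span {F\<^sub>0 s}" "F\<^sub>0 s \<noteq> 0" using F0(3)[OF sub[OF s]] by auto
      consider "s = 0" | "0 < s" | "s < 0" by linarith
      then show ?thesis
      proof cases
        case 1 then show ?thesis using f01[of 0] by (simp add: H_def)
      next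
        case 2
        then have "0 < m \<bullet> F\<^sub>0 s" using d1(2)[of s] se e by auto
        then show ?thesis using f01[of s] H[of s "F\<^sub>0 s"] 2 se e \<gamma>s by simp
      next
        case 3
        \<comment> \<open>For \<open>s < 0\<close> the positive ray of
          \<open>\<gamma> (s + 1)\<close> is that of \<open>- F\<^sub>0 s\<close>. The minus sign of
          antiperiodicity turns it back, so \<open>f\<close> is the normalised
          \<open>F\<^sub>0\<close> on both sides of 0.\<close>
        have neg: "0 < m \<bullet> - F\<^sub>0 s" using d2(2)[of "- s"] 3 se e by auto
        have "\<gamma> (s + 1) = \<gamma> s" using sc by (simp add: simple_closed_def)
        moreover have "span {- F\<^sub>0 s} = span {F\<^sub>0 s}"
          using \<gamma>s by (subst span_singleton_eq_iff_cross) auto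
        ultimately have "H (s + 1) = unit (- F\<^sub>0 s)"
          using 3 se e \<gamma>s neg by (intro H) auto
        then show ?thesis using fneg[of s] 3 se e by (simp add: unit_def)
      qed
    qed
    moreover have "continuous_on (ball 0 e) F\<^sub>0'"
      by (rule continuous_on_subset[OF F0(4)]) (use sub in blast)
    ultimately show ?thesis unfolding True using e(1) F0(2,3,5) sub
      by - (rule exI[of _ e], rule conjI, assumption, rule exI[of _ F\<^sub>0], rule exI[of _ F\<^sub>0'], blast)
  next
    case False
    then have t: "0 < t" "t < 1" using t by auto
    obtain F F' e where F: "e > 0" "\<forall>s\<in>ball t e. (F has_vector_derivative F' s) (at s) \<and> F s \<noteq> 0 \<and> \<gamma> s = span {F s}"
      "continuous_on (ball t e) F'" "F t \<times> F' t \<noteq> 0"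
      using lift[of t] by blast
    have "m \<bullet> F t \<noteq> 0" by (rule m_nonzero[OF t]) (use F in auto)
    define \<tau> where "\<tau> = sgn (m \<bullet> F t)"
    have \<tau>: "\<tau> \<noteq> 0" "0 < m \<bullet> (\<tau> *\<^sub>R F t)"
      using \<open>m \<bullet> F t \<noteq> 0\<close> by (auto simp: \<tau>_def sgn_if)
    define G where "G = (\<lambda>s. \<tau> *\<^sub>R F s)"
    have contG: "continuous_on (ball t e) G" unfolding G_def
      using F(2) has_vector_derivative_continuous
      by (intro continuous_intros) (blast intro: continuous_at_imp_continuous_on)
    have "open (ball t e \<inter> G -` {v. 0 < m \<bullet> v})"
      by (intro continuous_open_preimage contG open_ball open_Collect_less continuous_intros)
    then have "open (ball t e \<inter> G -` {v. 0 < m \<bullet> v} \<inter> {0<..<1})"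
      by (rule open_Int) (rule open_greaterThanLessThan)
    moreover have "t \<in> ball t e \<inter> G -` {v. 0 < m \<bullet> v} \<inter> {0<..<1}" using F(1) \<tau> t by (auto simp: G_def)
    ultimately obtain d where d: "d > 0" "ball t d \<subseteq> ball t e \<inter> G -` {v. 0 < m \<bullet> v} \<inter> {0<..<1}"
      by (rule openE)
    have in_e: "s \<in> ball t e" "0 < m \<bullet> G s" "0 < s" "s < 1" if "s \<in> ball t d" for s
      using subsetD[OF d(2) that] by auto
    have G: "(G has_vector_derivative \<tau> *\<^sub>R F' s) (at s) \<and> G s \<noteq> 0 \<and> f s = unit (G s)" if s: "s \<in> ball t d" for s
    proof (intro conjI)
      show "(G has_vector_derivative \<tau> *\<^sub>R F' s) (at s)" unfolding G_def
        using F(2) in_e(1)[OF s] by (intro bounded_linear.has_vector_derivative[OF bounded_linear_scaleR_right]) blast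
      show G0: "G s \<noteq> 0" using in_e(2)[OF s] by auto
      have "span {G s} = span {F s}" unfolding G_def
        using F(2) in_e(1)[OF s] \<tau>(1) by (subst span_singleton_eq_iff_cross) (auto simp: cross_mult_left)
      then have "\<gamma> s = span {G s}" using F(2) in_e(1)[OF s] by simp
      then show "f s = unit (G s)" using f01[of s] H[of s "G s"] in_e[OF s] by simp
    qed
    have "continuous_on (ball t d) (\<lambda>s. \<tau> *\<^sub>R F' s)"
      by (intro continuous_intros continuous_on_subset[OF F(3)]) (use in_e(1) in blast)
    moreover have "G t \<times> (\<tau> *\<^sub>R F' t) \<noteq> 0" using F(4) \<tau>(1) by (simp add: G_def cross_mult_left cross_mult_right)
    ultimately show ?thesis using d(1) G
      by (intro exI[of _ d] conjI exI[of _ G] exI[of _ "\<lambda>s. \<tau> *\<^sub>R F' s"]) auto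
  qed
  have good: "\<exists>e>0. \<exists>D. (\<forall>s\<in>ball t e. (f has_vector_derivative D s) (at s)) \<and> continuous_on (ball t e) D \<and> f t \<times> D t \<noteq> 0"
    if t: "0 \<le> t" "t < 1" for t
  proof -
    obtain e F F' where F: "e > 0" "\<forall>s\<in>ball t e. (F has_vector_derivative F' s) (at s) \<and> F s \<noteq> 0 \<and> f s = unit (F s)"
      "continuous_on (ball t e) F'" "F t \<times> F' t \<noteq> 0" using good0[OF t] by blast
    obtain D where D: "\<And>s. s \<in> ball t e \<Longrightarrow> ((\<lambda>s. (1 / norm (F s)) *\<^sub>R F s) has_vector_derivative D s) (at s)"
      "continuous_on (ball t e) D"
      "\<And>s. s \<in> ball t e \<Longrightarrow> F s \<times> F' s \<noteq> 0 \<Longrightarrow> ((1 / norm (F s)) *\<^sub>R F s) \<times> D s \<noteq> 0"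
      by (rule normalized_deriv[of "ball t e" F F']) (use F in auto)
    have "(f has_vector_derivative D s) (at s)" if "s \<in> ball t e" for s
      using D(1)[OF that] by (rule has_vector_derivative_transform_within_open[OF _ open_ball that])
        (use F(2) in \<open>auto simp: unit_def\<close>)
    moreover have "f t = (1 / norm (F t)) *\<^sub>R F t" using F(1,2) by (simp add: unit_def)
    then have "f t \<times> D t \<noteq> 0" by (simp only:) (rule D(3), use F(1,4) in auto)
    ultimately show ?thesis using F(1) D(2)
      by - (rule exI[of _ e], rule conjI, assumption, rule exI[of _ D], blast)
  qed
  have shift: "f (s + of_int k) = (if even k then f s else - f s)" for s k
    by (rule antiperiodic_add_int[of f, OF anti])
  show ?thesis
  proof (rule that[of f])
    show "f (s + 1) = - f s" for s by (rule anti)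
    show "\<gamma> s = span {f s}" for s
    proof -
      have f: "f s = H (frac s) \<or> f s = - H (frac s)" by (simp add: f_def)
      have \<gamma>f: "\<gamma> s = \<gamma> (frac s)"
        using simple_closed_shift_int[OF sc, of s "- \<lfloor>s\<rfloor>"] by (simp add: frac_def)
      obtain e F F' where F: "e > 0" "\<forall>x\<in>ball (frac s) e. (F has_vector_derivative F' x) (at x) \<and> F x \<noteq> 0 \<and> f x = unit (F x)"
        using good0[of "frac s"] by (auto simp: frac_lt_1)
      have H0: "H (frac s) \<noteq> 0" using F f01[of "frac s"] by (auto simp: frac_lt_1 unit_def)
      have "\<gamma> (frac s) = span {H (frac s)}"
      proof (cases "frac s = 0")
        case True
        show ?thesis unfolding True using F0(1) F0(3)[of 0] unit_span[of "F\<^sub>0 0"] by (simp add: H_def)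
      next
        case False
        then have fs: "0 < frac s" "frac s < 1" using frac_ge_0[of s] frac_lt_1[of s] by linarith+
        obtain F F' e where "e > 0" "\<forall>x\<in>ball (frac s) e. (F has_vector_derivative F' x) (at x) \<and> F x \<noteq> 0 \<and> \<gamma> x = span {F x}"
          using lift[of "frac s"] by blast
        then have F: "F (frac s) \<noteq> 0" "\<gamma> (frac s) = span {F (frac s)}" by auto
        define v where "v = (if 0 < m \<bullet> F (frac s) then F (frac s) else - F (frac s))"
        have "m \<bullet> F (frac s) \<noteq> 0" by (rule m_nonzero[OF fs F(2)])
        then have "0 < m \<bullet> v" by (auto simp: v_def)
        moreover have "span {v} = span {F (frac s)}" "v \<noteq> 0"
          using F(1) by (auto simp: v_def span_singleton_eq_iff_cross)
        ultimately show ?thesis using H[OF fs, of v] F(2) unit_span[of v] by simp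
      qed
      moreover have "span {- H (frac s)} = span {H (frac s)}"
        using H0 by (subst span_singleton_eq_iff_cross) auto
      ultimately show ?thesis using f \<gamma>f by auto
    qed
    show "\<exists>e>0. \<exists>D. (\<forall>s\<in>ball t e. (f has_vector_derivative D s) (at s)) \<and> continuous_on (ball t e) D \<and> f t \<times> D t \<noteq> 0" for t
    proof -
      define k where "k = \<lfloor>t\<rfloor>"
      define \<tau> :: real where "\<tau> = (if even k then 1 else -1)"
      have fk: "f s = \<tau> *\<^sub>R f (s - of_int k)" for s using shift[of "s - of_int k" k] by (simp add: \<tau>_def)
      have "0 \<le> t - of_int k" "t - of_int k < 1" unfolding k_def by linarith+
      from good[OF this] obtain e D where D: "e > 0"
        "\<forall>s\<in>ball (t - of_int k) e. (f has_vector_derivative D s) (at s)"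
        "continuous_on (ball (t - of_int k) e) D" "f (t - of_int k) \<times> D (t - of_int k) \<noteq> 0" by blast
      have in_ball: "s - of_int k \<in> ball (t - of_int k) e" if "s \<in> ball t e" for s
        using that by (simp add: dist_real_def)
      have der: "(f has_vector_derivative \<tau> *\<^sub>R D (s - of_int k)) (at s)" if "s \<in> ball t e" for s
      proof -
        have 1: "((\<lambda>s. s - of_int k) has_vector_derivative 1) (at s)"
          by (auto intro!: derivative_eq_intros)
        have 2: "(f has_vector_derivative D (s - of_int k)) (at (s - of_int k))"
          using D(2) in_ball[OF that] by blast
        have "((f \<circ> (\<lambda>s. s - of_int k)) has_vector_derivative 1 *\<^sub>R D (s - of_int k)) (at s)"
          by (rule vector_diff_chain_at[OF 1 2])
        then have "((\<lambda>s. \<tau> *\<^sub>R f (s - of_int k)) has_vector_derivative \<tau> *\<^sub>R D (s - of_int k)) (at s)"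
          by (intro bounded_linear.has_vector_derivative[OF bounded_linear_scaleR_right]) (simp add: o_def)
        then show ?thesis unfolding fk[symmetric] .
      qed
      have "continuous_on (ball t e) (\<lambda>s. \<tau> *\<^sub>R D (s - of_int k))"
        by (intro continuous_intros continuous_on_compose2[OF D(3)]) (use in_ball in auto)
      moreover have "f t \<times> (\<tau> *\<^sub>R D (t - of_int k)) \<noteq> 0"
        using D(4) by (subst fk) (auto simp: \<tau>_def cross_mult_left cross_mult_right)
      ultimately show ?thesis using D(1) der
        by (intro exI[of _ e] conjI exI[of _ "\<lambda>s. \<tau> *\<^sub>R D (s - of_int k)"]) auto
    qed
  qed
qed

text \<open>The point is \<open>support\<close>: the plane given by anti-convexity differs from the
  tangent plane, so its functional is nonzero on \<open>f' t\<close>. With the sign that makes it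
  positive there, it is positive on \<open>f\<close> just after \<open>t\<close> and, having no
  zero, on all of \<open>]t, t + 1[\<close>.\<close>

lemma antiperiodic_lift_exists:
  assumes ac: "anti_convex \<gamma>"
  obtains f f' where "antiperiodic_curve f f'" "\<And>s. \<gamma> s = span {f s}"
proof -
  obtain f where f: "\<And>s. f (s + 1) = - f s" "\<And>s. \<gamma> s = span {f s}"
    "\<And>t. \<exists>e>0. \<exists>D. (\<forall>s\<in>ball t e. (f has_vector_derivative D s) (at s)) \<and> continuous_on (ball t e) D \<and> f t \<times> D t \<noteq> 0"
    by (rule sphere_lift_exists[OF ac]) (rule that)
  define f' where "f' = vderiv f"
  have D: "\<exists>e>0. (\<forall>s\<in>ball t e. (f has_vector_derivative f' s) (at s)) \<and> continuous_on (ball t e) f' \<and> f t \<times> f' t \<noteq> 0" for t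
  proof -
    obtain e D where D: "e > 0" "\<forall>s\<in>ball t e. (f has_vector_derivative D s) (at s)"
      "continuous_on (ball t e) D" "f t \<times> D t \<noteq> 0" using f(3)[of t] by blast
    have eq: "f' s = D s" if "s \<in> ball t e" for s
      unfolding f'_def using D(2) that vector_derivative_at by blast
    have "continuous_on (ball t e) f'" by (rule continuous_on_eq[OF D(3)]) (rule eq[symmetric])
    then show ?thesis using D eq by (intro exI[of _ e]) auto
  qed
  have der: "(f has_vector_derivative f' t) (at t)" and reg: "f t \<times> f' t \<noteq> 0" for t using D[of t] by auto
  have isCont: "isCont f' t" for t
    using D[of t] by (metis centre_in_ball continuous_on_eq_continuous_at open_ball)
  have f0: "f t \<noteq> 0" for t using reg[of t] by auto
  have lift: "C1_lift \<gamma> t f" for t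
    unfolding C1_lift_def C1_differentiable_on_eq f'_def[symmetric]
    using f(2) f0 isCont
    by (intro exI[of _ 1]) (auto intro: differentiableI_vector[OF der] continuous_at_imp_continuous_on)
  have contf: "continuous_on S f" for S
    using der has_vector_derivative_continuous by (blast intro: continuous_at_imp_continuous_on)
  have "antiperiodic_curve f f'"
  proof
    fix t
    show "(f has_vector_derivative f' t) (at t)" by (rule der)
    show "continuous_on UNIV f'" using isCont by (simp add: continuous_at_imp_continuous_on)
    show "f (t + 1) = - f t" by (rule f(1))
    show "f t \<times> f' t \<noteq> 0" by (rule reg)
    obtain m where m: "m \<noteq> 0" "\<gamma> t \<subseteq> {v. m \<bullet> v = 0}" "tangent_line \<gamma> t \<noteq> {v. m \<bullet> v = 0}"
      "\<And>s. t < s \<Longrightarrow> s < t + 1 \<Longrightarrow> \<not> \<gamma> s \<subseteq> {v. m \<bullet> v = 0}"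
      by (rule anti_convex_plane[OF ac, of t]) (rule that)
    have mt: "m \<bullet> f t = 0" using m(2) f(2) span_base[of "f t" "{f t}"] by auto
    have ms: "m \<bullet> f s \<noteq> 0" if "t < s" "s < t + 1" for s
      using m(4)[OF that] f(2)[of s] by (auto simp: span_singleton)
    have "m \<bullet> f' t \<noteq> 0"
    proof
      assume mt': "m \<bullet> f' t = 0"
      define k where "k = (m \<bullet> (f t \<times> f' t)) / ((f t \<times> f' t) \<bullet> (f t \<times> f' t))"
      have k: "m = k *\<^sub>R (f t \<times> f' t)" unfolding k_def by (rule parallel_to_cross[OF mt mt' reg])
      then have "k \<noteq> 0" using m(1) by auto
      then have "{v. m \<bullet> v = 0} = {v. (f t \<times> f' t) \<bullet> v = 0}" by (subst k) simp
      then show False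
        using m(3) tangent_line_eq[OF lift[of t]] span_pair_eq_plane[OF reg[of t]] by (simp add: f'_def)
    qed
    then have "\<exists>n. (\<forall>v. n \<bullet> v = 0 \<longleftrightarrow> m \<bullet> v = 0) \<and> 0 < n \<bullet> f' t"
      by (cases "0 < m \<bullet> f' t") (auto intro: exI[of _ m] exI[of _ "- m"])
    then obtain n where n: "\<And>v. n \<bullet> v = 0 \<longleftrightarrow> m \<bullet> v = 0" "0 < n \<bullet> f' t" by blast
    have dn: "((\<lambda>x. n \<bullet> f x) has_real_derivative n \<bullet> f' t) (at t)"
      unfolding has_real_derivative_iff_has_vector_derivative
      by (rule bounded_linear.has_vector_derivative[OF bounded_linear_inner_right der])
    obtain d where d: "d > 0" "\<And>h. 0 < h \<Longrightarrow> h < d \<Longrightarrow> 0 < n \<bullet> f (t + h)"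
      using DERIV_pos_inc_right[OF dn n(2)] iffD2[OF n(1) mt] by auto
    have "0 < n \<bullet> f s" if s: "t < s" "s < t + 1" for s
    proof (rule ccontr)
      assume "\<not> 0 < n \<bullet> f s"
      define r where "r = min (t + d / 2) ((t + s) / 2)"
      have r: "t < r" "r < t + d" "r < s" using d(1) s by (auto simp: r_def min_def field_simps)
      have "0 < n \<bullet> f r" using d(2)[of "r - t"] r by simp
      then obtain x where "r \<le> x" "x \<le> s" "n \<bullet> f x = 0"
        using IVT2'[of "\<lambda>x. n \<bullet> f x" s 0 r] \<open>\<not> 0 < n \<bullet> f s\<close> r contf
        by (force intro: continuous_intros)
      then show False using ms[of x] n(1) r s by auto
    qed
    then show "\<exists>m. m \<bullet> f t = 0 \<and> 0 < m \<bullet> f' t \<and> (\<forall>s. t < s \<and> s < t + 1 \<longrightarrow> 0 < m \<bullet> f s)"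
      using n mt by (intro exI[of _ n]) auto
  qed
  then show ?thesis using f(2) by (rule that)
qed

section \<open>Clean points as inflection points\<close>

text \<open>If \<open>A > 0\<close>, then \<open>\<psi>\<close> is negative just before
  \<open>t\<close>, so \<open>\<phi>\<close> decreases to 0 and is positive there; if
  \<open>A < 0\<close>, then \<open>\<phi>\<close> decreases from 0 just after \<open>t\<close>.
  Either contradicts the signs.\<close>

lemma sign_change_second_derivative:
  fixes \<phi> \<psi> :: "real \<Rightarrow> real"
  assumes e: "e > 0" and d: "\<And>s. s \<in> ball t e \<Longrightarrow> (\<phi> has_real_derivative \<psi> s) (at s)"
    and dd: "(\<psi> has_real_derivative A) (at t)" and 0: "\<phi> t = 0" "\<psi> t = 0"
    and right: "\<And>s. t < s \<Longrightarrow> s < t + e \<Longrightarrow> 0 \<le> \<phi> s"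
    and left: "\<And>s. t - e < s \<Longrightarrow> s < t \<Longrightarrow> \<phi> s \<le> 0"
  shows "A = 0"
proof (rule ccontr)
  assume "A \<noteq> 0"
  then consider "0 < A" | "A < 0" by linarith
  then show False
  proof cases
    case 1
    obtain r where r: "r > 0" "\<And>h. 0 < h \<Longrightarrow> h < r \<Longrightarrow> \<psi> (t - h) < 0"
      using DERIV_pos_inc_left[OF dd 1] 0 by auto
    define h where "h = min r e / 2"
    have h: "0 < h" "h < r" "h < e" using r e by (auto simp: h_def)
    have "\<phi> t < \<phi> (t - h)"
    proof (rule DERIV_neg_imp_decreasing_open[of "t - h" t])
      show "t - h < t" using h by simp
      show "\<exists>y. (\<phi> has_real_derivative y) (at x) \<and> y < 0" if "t - h < x" "x < t" for x
        using d[of x] r(2)[of "t - x"] that h by (intro exI[of _ "\<psi> x"]) (auto simp: dist_real_def)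
      show "continuous_on {t - h..t} \<phi>"
        by (intro continuous_at_imp_continuous_on ballI DERIV_isCont[OF d]) (use h in \<open>auto simp: dist_real_def\<close>)
    qed
    then show False using left[of "t - h"] h 0 by simp
  next
    case 2
    obtain r where r: "r > 0" "\<And>h. 0 < h \<Longrightarrow> h < r \<Longrightarrow> \<psi> (t + h) < 0"
      using DERIV_neg_dec_right[OF dd 2] 0 by auto
    define h where "h = min r e / 2"
    have h: "0 < h" "h < r" "h < e" using r e by (auto simp: h_def)
    have "\<phi> (t + h) < \<phi> t"
    proof (rule DERIV_neg_imp_decreasing_open[of t "t + h"])
      show "t < t + h" using h by simp
      show "\<exists>y. (\<phi> has_real_derivative y) (at x) \<and> y < 0" if "t < x" "x < t + h" for x
        using d[of x] r(2)[of "x - t"] that h by (intro exI[of _ "\<psi> x"]) (auto simp: dist_real_def)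
      show "continuous_on {t..t + h} \<phi>"
        by (intro continuous_at_imp_continuous_on ballI DERIV_isCont[OF d]) (use h in \<open>auto simp: dist_real_def\<close>)
    qed
    then show False using right[of "t + h"] h 0 by simp
  qed
qed

context antiperiodic_curve
begin

lemma C1_lift_f:
  assumes \<gamma>: "\<And>s. \<gamma> s = span {f s}"
  shows "C1_lift \<gamma> t f" and "vderiv f t = f' t"
proof -
  have eq: "vderiv f = f'" using has_deriv vector_derivative_at by blast
  from fun_cong[OF this] show "vderiv f t = f' t" .
  show "C1_lift \<gamma> t f"
    unfolding C1_lift_def C1_differentiable_on_eq eq
    using \<gamma> nonzero
    by (intro exI[of _ 1]) (auto intro: differentiableI_vector[OF has_deriv] continuous_on_subset[OF cont_deriv])
qed

lemma tangent_line_plane: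
  assumes \<gamma>: "\<And>s. \<gamma> s = span {f s}"
  shows "tangent_line \<gamma> t = {v. (f t \<times> f' t) \<bullet> v = 0}"
  using tangent_line_eq[OF C1_lift_f(1)[OF \<gamma>], of t] span_pair_eq_plane[OF regular[of t]] C1_lift_f(2)[OF \<gamma>]
  by simp

text \<open>Antiperiodicity makes a planar curve cover its line: for a point \<open>v\<close> of the
  line, \<open>w = g \<times> v\<close> changes sign along \<open>f\<close> over a period and so has
  a zero, and vectors of the plane orthogonal to \<open>w\<close> are parallel to
  \<open>v\<close>.\<close>

lemma whole_line_if_planar:
  assumes \<gamma>: "\<And>s. \<gamma> s = span {f s}" and g: "g \<noteq> 0" "\<And>s. g \<bullet> f s = 0"
  shows "is_whole_line \<gamma>"
  unfolding is_whole_line_def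
proof (intro exI conjI)
  let ?L = "{v. g \<bullet> v = 0}"
  show "proj_line ?L" using g by (simp add: proj_line_def subspace_hyperplane dim_hyperplane)
  show "range \<gamma> = {p. proj_point p \<and> p \<subseteq> ?L}"
  proof (intro equalityI subsetI)
    fix q assume "q \<in> range \<gamma>"
    then obtain s where "q = span {f s}" using \<gamma> by auto
    moreover have "span {f s} \<subseteq> ?L"
      by (rule span_minimal[OF _ subspace_hyperplane]) (use g(2) in auto)
    moreover have "dim (span {f s}) = 1"
      using dim_span_eq_card_independent[of "{f s}"] nonzero[of s] by simp
    ultimately show "q \<in> {p. proj_point p \<and> p \<subseteq> ?L}" by (simp add: proj_point_def subspace_span)
  next
    fix q assume "q \<in> {p. proj_point p \<and> p \<subseteq> ?L}"
    then have q: "subspace q" "dim q = 1" "q \<subseteq> ?L" by (auto simp: proj_point_def)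
    have "\<exists>v. v \<in> q \<and> v \<noteq> 0"
    proof (rule ccontr)
      assume "\<not> ?thesis"
      then have "q \<subseteq> {0}" by blast
      then have "dim q = 0" by simp
      with q(2) show False by simp
    qed
    then obtain v where v: "v \<in> q" "v \<noteq> 0" by blast
    have "span {v} = q"
    proof (rule subspace_dim_equal)
      show "span {v} \<subseteq> q" by (rule span_minimal) (use v q in auto)
    qed (use v q in auto)
    define w where "w = g \<times> v"
    have cw: "continuous_on {0..1} (\<lambda>x. w \<bullet> f x)" by (intro continuous_intros cont)
    have "\<exists>s. w \<bullet> f s = 0"
    proof (cases "0 \<le> w \<bullet> f 0")
      case True
      then have "w \<bullet> f 1 \<le> 0" using antiperiodic[of 0] by simp
      then show ?thesis using IVT2'[of "\<lambda>x. w \<bullet> f x" 1 0 0] True cw by auto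
    next
      case False
      then have "0 \<le> w \<bullet> f 1" using antiperiodic[of 0] by simp
      then show ?thesis using IVT'[of "\<lambda>x. w \<bullet> f x" 0 0 1] False cw by auto
    qed
    then obtain s where s: "w \<bullet> f s = 0" by blast
    have "v \<times> f s = 0"
    proof (rule ccontr)
      assume nz: "v \<times> f s \<noteq> 0"
      have "g \<bullet> v = 0" using v(1) q(3) by auto
      from parallel_to_cross[OF this g(2) nz] have "g = ((g \<bullet> (v \<times> f s)) / ((v \<times> f s) \<bullet> (v \<times> f s))) *\<^sub>R (v \<times> f s)" .
      moreover have "g \<bullet> (v \<times> f s) = 0" using s unfolding w_def by (simp add: cross3_simps)
      ultimately show False using g(1) by simp
    qed
    then have "span {v} = \<gamma> s" unfolding \<gamma> using span_singleton_eq_iff_cross[OF v(2) nonzero] by blast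
    then show "q \<in> range \<gamma>" using \<open>span {v} = q\<close> by auto
  qed
qed

text \<open>Both signs together make the tangent normal vanish along a full period, which puts the
  curve on its tangent line.\<close>

lemma not_pos_and_neg_clean:
  assumes \<gamma>: "\<And>s. \<gamma> s = span {f s}" and "\<not> is_whole_line \<gamma>"
  shows "\<not> (pos_clean t \<and> neg_clean t)"
proof
  assume both: "pos_clean t \<and> neg_clean t"
  have "(f t \<times> f' t) \<bullet> f s = 0" for s
  proof -
    obtain k where k: "t \<le> s + of_int k" "s + of_int k < t + 1" by (rule reduce_int)
    then have "s + of_int k - t \<in> {0..1}" by auto
    then have "(f t \<times> f' t) \<bullet> f (t + (s + of_int k - t)) = 0"
      using both unfolding pos_clean_def neg_clean_def by (meson order_antisym)
    then show ?thesis using dot_shift_zero_iff[of _ s k] by simp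
  qed
  then have "is_whole_line \<gamma>" by (rule whole_line_if_planar[OF \<gamma> regular])
  with assms(2) show False by simp
qed

end

context clean_tangent
begin

text \<open>Second derivatives belong to the local lift \<open>F\<close>, signs to \<open>f\<close>.
  The two are proportional with a factor of constant sign \<open>\<tau>\<close> near
  \<open>t\<close>, so \<open>\<tau> * (n \<bullet> F)\<close> inherits the sign change at its
  double zero.\<close>

lemma inflection_at_t:
  assumes \<gamma>: "\<And>s. \<gamma> s = span {f s}" and "C2_regular \<gamma>"
  shows "inflection \<gamma> t"
proof -
  obtain F where F: "C2_lift \<gamma> t F" using assms(2) by (auto simp: C2_regular_def)
  then obtain e where e: "e > 0" "F C1_differentiable_on ball t e" "vderiv F C1_differentiable_on ball t e"
    "\<And>s. s \<in> ball t e \<Longrightarrow> F s \<noteq> 0 \<and> \<gamma> s = span {F s}" unfolding C2_lift_def by blast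
  have F1: "C1_lift \<gamma> t F" unfolding C1_lift_def using e by blast
  have dF: "(F has_vector_derivative vderiv F s) (at s)" if "s \<in> ball t e" for s
    using e(2) that by (auto simp: C1_differentiable_on_eq vector_derivative_works[symmetric])
  have ddF: "(vderiv F has_vector_derivative vderiv (vderiv F) t) (at t)"
    using e(1,3) by (auto simp: C1_differentiable_on_eq vector_derivative_works[symmetric])
  have "n \<bullet> v = 0" if "v \<in> {F t, vderiv F t}" for v
  proof -
    have "v \<in> span {f t, f' t}"
      using tangent_span_subset[OF C1_lift_f(1)[OF \<gamma>, of t] F1] C1_lift_f(2)[OF \<gamma>] that span_base[of v "{F t, vderiv F t}"] by auto
    moreover have "span {f t, f' t} \<subseteq> {v. n \<bullet> v = 0}"
      by (rule span_minimal[OF _ subspace_hyperplane]) (use at_t in auto)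
    ultimately show ?thesis by blast
  qed
  then have nF: "n \<bullet> F t = 0" "n \<bullet> vderiv F t = 0" by auto
  define c where "c = (\<lambda>s. F s \<bullet> f s)"
  have Fc: "(f s \<bullet> f s) *\<^sub>R F s = c s *\<^sub>R f s" if "s \<in> ball t e" for s
  proof -
    have "F s \<in> span {f s}" using e(4)[OF that] \<gamma>[of s] span_base[of "F s" "{F s}"] by auto
    then obtain k where "F s = k *\<^sub>R f s" by (auto simp: span_singleton)
    then show ?thesis by (simp add: c_def)
  qed
  have "c t \<noteq> 0"
    using Fc[of t] e(1) e(4)[of t] nonzero[of t] by auto
  define \<tau> where "\<tau> = sgn (c t)"
  have \<tau>: "0 < \<tau> * c t" "\<tau> \<noteq> 0" using \<open>c t \<noteq> 0\<close> by (auto simp: \<tau>_def sgn_if)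
  have "continuous_on (ball t e) c" unfolding c_def
    using dF has_vector_derivative_continuous
    by (intro continuous_intros cont) (blast intro: continuous_at_imp_continuous_on)
  then have "open (ball t e \<inter> c -` {x. 0 < \<tau> * x})"
    by (intro continuous_open_preimage open_ball open_Collect_less continuous_intros)
  moreover have "t \<in> ball t e \<inter> c -` {x. 0 < \<tau> * x}" using e(1) \<tau> by simp
  ultimately obtain d where d: "d > 0" "ball t d \<subseteq> ball t e \<inter> c -` {x. 0 < \<tau> * x}" by (rule openE)
  define r where "r = min d 1"
  have r: "r > 0" "r \<le> 1" "r \<le> d" using d by (auto simp: r_def)
  have in_r: "s \<in> ball t e" "0 < \<tau> * c s" if "s \<in> ball t r" for s
  proof -
    have "s \<in> ball t d" using that r by auto
    then show "s \<in> ball t e" "0 < \<tau> * c s" using d(2) by auto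
  qed
  have scale: "(\<tau> * (n \<bullet> F s)) * (f s \<bullet> f s) = (\<tau> * c s) * (n \<bullet> f s)" if "s \<in> ball t r" for s
  proof -
    have "n \<bullet> ((f s \<bullet> f s) *\<^sub>R F s) = n \<bullet> (c s *\<^sub>R f s)" using Fc[OF in_r(1)[OF that]] by simp
    then show ?thesis by (simp add: algebra_simps)
  qed
  have "\<tau> * (n \<bullet> vderiv (vderiv F) t) = 0"
  proof (rule sign_change_second_derivative[of r t "\<lambda>s. \<tau> * (n \<bullet> F s)" "\<lambda>s. \<tau> * (n \<bullet> vderiv F s)"])
    show "r > 0" by (rule r)
    show "((\<lambda>s. \<tau> * (n \<bullet> F s)) has_real_derivative \<tau> * (n \<bullet> vderiv F s)) (at s)" if "s \<in> ball t r" for s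
      unfolding has_real_derivative_iff_has_vector_derivative
      by (rule bounded_linear.has_vector_derivative[OF bounded_linear_const_mult[OF bounded_linear_inner_right] dF[OF in_r(1)[OF that]]])
    show "((\<lambda>s. \<tau> * (n \<bullet> vderiv F s)) has_real_derivative \<tau> * (n \<bullet> vderiv (vderiv F) t)) (at t)"
      unfolding has_real_derivative_iff_has_vector_derivative
      by (rule bounded_linear.has_vector_derivative[OF bounded_linear_const_mult[OF bounded_linear_inner_right] ddF])
    show "\<tau> * (n \<bullet> F t) = 0" "\<tau> * (n \<bullet> vderiv F t) = 0" using nF by auto
    show "0 \<le> \<tau> * (n \<bullet> F s)" if s: "t < s" "s < t + r" for s
    proof -
      have sr: "s \<in> ball t r" using s by (simp add: dist_real_def)
      have "0 \<le> (\<tau> * c s) * (n \<bullet> f s)"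
        using sign_after[of s] s r by (intro mult_nonneg_nonneg[OF less_imp_le[OF in_r(2)[OF sr]]]) auto
      then show ?thesis using scale[OF sr] nonzero[of s] by (metis inner_gt_zero_iff zero_le_mult_iff not_less)
    qed
    show "\<tau> * (n \<bullet> F s) \<le> 0" if s: "t - r < s" "s < t" for s
    proof -
      have sr: "s \<in> ball t r" using s by (simp add: dist_real_def)
      have "(\<tau> * c s) * (n \<bullet> f s) \<le> 0"
        using in_r(2)[OF sr] sign_before[of s] s r by (intro mult_nonneg_nonpos) auto
      then show ?thesis using scale[OF sr] nonzero[of s] by (metis inner_gt_zero_iff mult_le_0_iff not_less)
    qed
  qed
  then have n2: "n \<bullet> vderiv (vderiv F) t = 0" using \<tau>(2) by simp
  \<comment> \<open>Both cases express linear dependence: either the first two vectors are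
    dependent, or all three lie in the plane normal to \<open>n\<close>.\<close>
  have "F t \<bullet> (vderiv F t \<times> vderiv (vderiv F) t) = 0"
  proof (cases "F t \<times> vderiv F t = 0")
    case True
    have "F t \<bullet> (vderiv F t \<times> vderiv (vderiv F) t) = (F t \<times> vderiv F t) \<bullet> vderiv (vderiv F) t"
      by (simp add: cross3_simps)
    then show ?thesis using True by simp
  next
    case False
    let ?u = "F t \<times> vderiv F t"
    define k where "k = (n \<bullet> ?u) / (?u \<bullet> ?u)"
    have k: "n = k *\<^sub>R ?u" unfolding k_def by (rule parallel_to_cross[OF nF False])
    then have "k \<noteq> 0" using n_nonzero by auto
    moreover have "k * (?u \<bullet> vderiv (vderiv F) t) = 0" using n2 by (subst (asm) k) simp
    ultimately have "?u \<bullet> vderiv (vderiv F) t = 0" by simp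
    then show ?thesis by (simp add: cross3_simps)
  qed
  then show ?thesis unfolding inflection_def using F by (auto simp: dot_cross_det)
qed

end

context antiperiodic_curve
begin

lemma clean_inflection:
  assumes \<gamma>: "\<And>s. \<gamma> s = span {f s}" and "C2_regular \<gamma>" "\<not> is_whole_line \<gamma>" "clean t"
  shows "inflection \<gamma> t \<and> crosses_only_once (tangent_line \<gamma> t) \<gamma>"
proof -
  let ?g = "f t \<times> f' t"
  define n where "n = (if pos_clean t then ?g else - ?g)"
  have n: "n \<bullet> v = 0 \<longleftrightarrow> ?g \<bullet> v = 0" for v by (simp add: n_def)
  have "\<exists>x. ?g \<bullet> f x \<noteq> 0"
    using whole_line_if_planar[OF \<gamma> regular[of t]] assms(3) by blast
  then obtain x0 where x0: "?g \<bullet> f x0 \<noteq> 0" by blast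
  interpret clean_tangent f f' n t x0
  proof
    show "n \<noteq> 0" using regular[of t] by (simp add: n_def)
    show "n \<bullet> f t = 0" "n \<bullet> f' t = 0" by (simp_all add: n dot_cross_self)
    show "n \<bullet> f x0 \<noteq> 0" using x0 n by simp
    show "0 \<le> n \<bullet> f (t + x)" if "x \<in> {0..1}" for x
      using assms(4) that by (auto simp: n_def clean_def pos_clean_def neg_clean_def)
  qed
  have "tangent_line \<gamma> t = {v. n \<bullet> v = 0}" unfolding tangent_line_plane[OF \<gamma>] by (simp add: n)
  then show ?thesis using inflection_at_t[OF \<gamma> assms(2)] crosses_only_once[OF \<gamma>] by simp
qed

lemma clean_frac: "clean (frac t) \<longleftrightarrow> clean t"
  using periodic_add_int[of clean t "- \<lfloor>t\<rfloor>", OF clean_shift] by (simp add: frac_def)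

end

theorem theoremB:
  fixes \<gamma> :: "real \<Rightarrow> (real^3) set"
  assumes "C2_regular \<gamma>"
    and "anti_convex \<gamma>"
    and "\<not> is_whole_line \<gamma>"
  shows "\<exists>T \<subseteq> {0..<1}. card T = 3 \<and>
           (\<forall>t\<in>T. inflection \<gamma> t \<and> crosses_only_once (tangent_line \<gamma> t) \<gamma>)"
proof -
  obtain f f' where f: "antiperiodic_curve f f'" and \<gamma>: "\<And>s. \<gamma> s = span {f s}"
    by (rule antiperiodic_lift_exists[OF assms(2)]) (rule that)
  interpret antiperiodic_curve f f' by (rule f)
  obtain a b c where abc: "a < b" "b < c" "c < a + 1" "clean a" "clean b" "clean c"
    by (rule three_clean[OF not_pos_and_neg_clean[OF \<gamma> assms(3)]]) (rule that)
  \<comment> \<open>The clean points lie in a window of length less than 1 that need not start at an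
    integer; their fractional parts are still distinct.\<close>
  have ne: "frac x \<noteq> frac y" if "x < y" "y < x + 1" for x y :: real
  proof
    assume "frac x = frac y"
    then have "y - x = of_int (\<lfloor>y\<rfloor> - \<lfloor>x\<rfloor>)" by (simp add: frac_def algebra_simps)
    moreover from this have "0 < \<lfloor>y\<rfloor> - \<lfloor>x\<rfloor>" "\<lfloor>y\<rfloor> - \<lfloor>x\<rfloor> < 1" using that by linarith+
    ultimately show False by simp
  qed
  have "frac a \<noteq> frac b" "frac b \<noteq> frac c" "frac a \<noteq> frac c"
    using ne[of a b] ne[of b c] ne[of a c] abc by auto
  then have "card {frac a, frac b, frac c} = 3" by simp
  moreover have "clean t" if "t \<in> {frac a, frac b, frac c}" for t
    using that abc by (auto simp: clean_frac)
  then have "\<forall>t\<in>{frac a, frac b, frac c}. inflection \<gamma> t \<and> crosses_only_once (tangent_line \<gamma> t) \<gamma>"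
    using clean_inflection[OF \<gamma> assms(1,3)] by blast
  ultimately show ?thesis
    by (intro exI[of _ "{frac a, frac b, frac c}"]) (auto simp: frac_lt_1)
qed

end
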